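(* Let $t\geq 1$ be an integer, let $K$ be a field, let $H_t$ be the graph defined in the context, let $R_t$ be the polynomial ring over $K$ whose variables are the vertices of $H_t$, let $J_t\subseteq R_t$ be the cover ideal of $H_t$, and let $\chi(H_t)$ be the chromatic number of $H_t$. Then the sets of associated primes $\operatorname{Ass}(R_t/(J_t)^n)$ stabilize at $n=(\chi(H_t)-1)+t=2+t$.
   Context: **The graphs $H_t$.** All graphs are finite and simple. $H_1$ has vertex set $\{x_1,\dots,x_5,y_1\}$; the subgraph induced by $\{x_1,\dots,x_5\}$ is a $5$-cycle (with edges $\{x_i,x_{i+1}\}$ for $1\le i<5$ and $\{x_5,x_1\}$), and the neighbors of $y_1$ are precisely $x_1,x_2,x_3$. For $t>1$, $H_t$ has vertex set $\{x_1,\dots,x_{4t-1},y_1,\dots,y_t\}$; the subgraph induced by $\{x_1,\dots,x_{4t-1}\}$ is a $(4t-1)$-cycle (with edges $\{x_i,x_{i+1}\}$ for $1\le i<4t-1$ and $\{x_{4t-1},x_1\}$), the neighbors of $y_1$ are precisely $x_1,x_2,x_3$, and for $1<i\leq t$ the neighbors of $y_i$ are precisely $x_{4i-4},x_{4i-3},x_{4i-2},x_{4i-1}$. **Cover ideal.** For a graph $G$ with vertices $v_1,\dots,v_m$, put $R_G=K[v_1,\dots,v_m]$ (vertices are identified with variables). A vertex cover of $G$ is a set of vertices meeting every edge. The cover ideal $J_G\subseteq R_G$ is the ideal generated by all monomials $v_{i_1}\cdots v_{i_j}$ such that $\{v_{i_1},\dots,v_{i_j}\}$ is a vertex cover of $G$.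 Write $R_t=R_{H_t}$ and $J_t=J_{H_t}$. **Stabilization.** For an ideal $I$ of a ring $R$, the associated primes of $R/I^n$ "stabilize at $n=s$" means that $s$ is the smallest positive integer such that $\operatorname{Ass}(R/I^n)=\operatorname{Ass}(R/I^s)$ for all $n\geq s$. *)

theory Defs
  imports "HOL-Library.Poly_Mapping" "HOL-Algebra.Module" "HOL-Algebra.QuotRing" "HOL-Algebra.Ideal_Product"
begin

section \<open>Finite simple graphs\<close>

record 'v graph =
  verts :: "'v set"
  edges :: "'v set set"

definition finite_simple_graph :: "'v graph \<Rightarrow> bool" where
  "finite_simple_graph G \<longleftrightarrow>
     finite (verts G) \<and> (\<forall>e\<in>edges G. e \<subseteq> verts G \<and> card e = 2)"

definition vertex_cover :: "'v graph \<Rightarrow> 'v set \<Rightarrow> bool" where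
  "vertex_cover G C \<longleftrightarrow> C \<subseteq> verts G \<and> (\<forall>e\<in>edges G. C \<inter> e \<noteq> {})"

definition colorable :: "'v graph \<Rightarrow> nat \<Rightarrow> bool" where
  "colorable G k \<longleftrightarrow>
     (\<exists>c. c ` verts G \<subseteq> {..<k} \<and> (\<forall>u v. {u, v} \<in> edges G \<longrightarrow> c u \<noteq> c v))"

definition chromatic_number :: "'v graph \<Rightarrow> nat" where
  "chromatic_number G = (LEAST k. colorable G k)"


section \<open>The graphs \<open>H\<^sub>t\<close>\<close>

datatype vertex = Xv nat | Yv nat

definition cycle_length :: "nat \<Rightarrow> nat" where
  "cycle_length t = (if t = 1 then 5 else 4 * t - 1)"

definition H :: "nat \<Rightarrow> vertex graph" where
  "H t = \<lparr>
     verts = Xv ` {1..cycle_length t} \<union> Yv ` {1..t},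
     edges =
       {{Xv i, Xv (i + 1)} |i. 1 \<le> i \<and> i < cycle_length t} \<union>
       {{Xv (cycle_length t), Xv 1}} \<union>
       {{Yv 1, Xv j} |j. j \<in> {1, 2, 3}} \<union>
       {{Yv i, Xv j} |i j. 1 < i \<and> i \<le> t \<and> j \<in> {4 * i - 4, 4 * i - 3, 4 * i - 2, 4 * i - 1}}
   \<rparr>"

lemma finite_simple_graph_H:
  assumes "t \<ge> 1"
  shows "finite_simple_graph (H t)"
proof -
  define N where "N = cycle_length t"
  have N: "N \<ge> 3" "\<And>i. i \<le> t \<Longrightarrow> 1 < i \<Longrightarrow> 4 * i - 1 \<le> N"
    using assms by (auto simp: N_def cycle_length_def)
  have "e \<subseteq> verts (H t) \<and> card e = 2" if e_edge: "e \<in> edges (H t)" for e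
  proof -
    from e_edge consider
        (cycle) i where "e = {Xv i, Xv (i + 1)}" "1 \<le> i" "i < N"
      | (closing) "e = {Xv N, Xv 1}"
      | (first) j where "e = {Yv 1, Xv j}" "j \<in> {1, 2, 3}"
      | (later) i j where "e = {Yv i, Xv j}" "1 < i" "i \<le> t"
          "j \<in> {4 * i - 4, 4 * i - 3, 4 * i - 2, 4 * i - 1}"
      unfolding H_def N_def by (simp only: graph.simps) blast
    then show ?thesis
    proof cases
      case later
      then have "1 \<le> j" "j \<le> N" using N(2)[of i] by auto
      then show ?thesis using later by (simp add: H_def N_def)
    qed (use N(1) assms in \<open>auto simp: H_def simp flip: N_def\<close>)
  qed
  then show ?thesis by (simp add: finite_simple_graph_def H_def)
qed


section \<open>Polynomial rings with variables indexed by a set\<close>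

text \<open>A monomial is a finitely supported exponent function, and a polynomial is a finitely
  supported function from monomials to coefficients. The type allows all elements of \<open>'v\<close> as
  variables; the carrier keeps only the polynomials in the variables \<open>V\<close>.\<close>

type_synonym ('v, 'k) mpoly = "('v \<Rightarrow>\<^sub>0 nat) \<Rightarrow>\<^sub>0 'k"

definition Var :: "'v \<Rightarrow> ('v, 'k::field) mpoly" where
  "Var v = Poly_Mapping.single (Poly_Mapping.single v 1) 1"

definition mpoly_ring :: "'v set \<Rightarrow> ('v, 'k::field) mpoly ring" where
  "mpoly_ring V = \<lparr>
     carrier = {p. \<forall>m\<in>Poly_Mapping.keys p. Poly_Mapping.keys m \<subseteq> V},
     mult = (*), one = 1, zero = 0, add = (+)
   \<rparr>"

lemma cring_mpoly_ring: "cring (mpoly_ring V :: ('v, 'k::field) mpoly ring)"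
proof -
  let ?R = "mpoly_ring V :: ('v, 'k) mpoly ring"
  have add: "p + q \<in> carrier ?R" if "p \<in> carrier ?R" "q \<in> carrier ?R" for p q
    using that Poly_Mapping.keys_add[of p q] by (fastforce simp: mpoly_ring_def)
  have mult: "p * q \<in> carrier ?R" if "p \<in> carrier ?R" "q \<in> carrier ?R" for p q
  proof -
    have "Poly_Mapping.keys m \<subseteq> V" if "m \<in> Poly_Mapping.keys (p * q)" for m
    proof -
      from Poly_Mapping.keys_mult[of p q] that obtain a b where
        ab: "m = a + b" "a \<in> Poly_Mapping.keys p" "b \<in> Poly_Mapping.keys q" by blast
      then show ?thesis
        using Poly_Mapping.keys_add[of a b] \<open>p \<in> carrier ?R\<close> \<open>q \<in> carrier ?R\<close>
        by (fastforce simp: mpoly_ring_def)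
    qed
    then show ?thesis by (auto simp: mpoly_ring_def)
  qed
  have ops: "p \<otimes>\<^bsub>?R\<^esub> q = p * q" "p \<oplus>\<^bsub>?R\<^esub> q = p + q" "\<one>\<^bsub>?R\<^esub> = 1" "\<zero>\<^bsub>?R\<^esub> = 0" for p q
    by (simp_all add: mpoly_ring_def)
  have zero_one: "0 \<in> carrier ?R" "1 \<in> carrier ?R"
    by (simp_all add: mpoly_ring_def)
  have neg: "- p \<in> carrier ?R" if "p \<in> carrier ?R" for p
    using that by (simp add: mpoly_ring_def)
  show ?thesis
  proof (rule cringI)
    show "abelian_group ?R"
    proof (rule abelian_groupI; unfold ops)
      show "\<exists>q\<in>carrier ?R. q + p = 0" if "p \<in> carrier ?R" for p
        using neg[OF that] by (intro bexI[of _ "- p"]) simp_all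
    qed (simp_all only: add zero_one ac_simps add_0_left add_0_right)
    show "comm_monoid ?R"
      by (rule comm_monoidI; unfold ops)
        (simp_all only: mult zero_one ac_simps mult_1_left mult_1_right)
  qed (simp add: ops distrib_right)
qed

definition cover_ideal :: "'v graph \<Rightarrow> ('v, 'k::field) mpoly set" where
  "cover_ideal G =
     genideal (mpoly_ring (verts G)) {\<Prod>v\<in>C. Var v |C. vertex_cover G C}"


section \<open>Associated primes and their stabilization\<close>

text \<open>The quotient ring \<open>R / I\<close> as an \<open>R\<close>-module.\<close>

definition quotient_module :: "('a, 'b) ring_scheme \<Rightarrow> 'a set \<Rightarrow> ('a, 'a set) module" where
  "quotient_module R I = \<lparr>
     carrier = carrier (R Quot I),
     mult = mult (R Quot I), one = one (R Quot I),
     zero = zero (R Quot I), add = add (R Quot I),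
     smult = (\<lambda>r x. (I +>\<^bsub>R\<^esub> r) \<otimes>\<^bsub>R Quot I\<^esub> x)
   \<rparr>"

definition Ass :: "('a, 'b) ring_scheme \<Rightarrow> ('a, 'c, 'd) module_scheme \<Rightarrow> 'a set set" where
  "Ass R M = {P. primeideal P R \<and>
     (\<exists>x\<in>carrier M. P = {r \<in> carrier R. r \<odot>\<^bsub>M\<^esub> x = \<zero>\<^bsub>M\<^esub>})}"

text \<open>Powers of ideals are taken in the monoid \<^term>\<open>ideals_set R\<close>, whose multiplication is
  the product of ideals.\<close>

definition Ass_power :: "('a, 'b) ring_scheme \<Rightarrow> 'a set \<Rightarrow> nat \<Rightarrow> 'a set set" where
  "Ass_power R I n = Ass R (quotient_module R (I [^]\<^bsub>ideals_set R\<^esub> n))"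

definition Ass_stabilizes_at :: "('a, 'b) ring_scheme \<Rightarrow> 'a set \<Rightarrow> nat \<Rightarrow> bool" where
  "Ass_stabilizes_at R I s \<longleftrightarrow>
     s > 0 \<and> (\<forall>n\<ge>s. Ass_power R I n = Ass_power R I s) \<and>
     (\<forall>s'>0. (\<forall>n\<ge>s'. Ass_power R I n = Ass_power R I s') \<longrightarrow> s \<le> s')"

end

theory Submission
  imports Defs
begin

text \<open>
  The powers of a cover ideal are monomial ideals whose membership problem is a colouring problem.
  A monomial \<open>x^a\<close> lies in \<open>J^n\<close> iff it is divisible by a product of \<open>n\<close> vertex covers. Passing to
  the complements of the covers, which are stable sets, this says that with \<open>n\<close> colours one can give
  every vertex \<open>v\<close> a set of \<open>n - a v\<close> colours so that adjacent vertices get disjoint sets. An associated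
  prime of a monomial ideal is generated by variables and is the annihilator of a monomial. So
  the associated primes of \<open>R / J^n\<close> are the primes generated by those vertex sets \<open>W\<close> that support a
  demand \<open>b\<close> which cannot be met with \<open>n\<close> colours, but can be met as soon as the demand of any one
  vertex of \<open>W\<close> drops by one (\<open>Ass_power_cover_ideal\<close>). Such \<open>W\<close> are called critical below.

  The critical sets of \<open>H\<^sub>t\<close> can be listed. Cut the cycle into the block \<open>x\<^sub>1 x\<^sub>2 x\<^sub>3\<close>, in which \<open>y\<^sub>1\<close> is a
  twin of \<open>x\<^sub>2\<close>, and \<open>t - 1\<close> fans \<open>x\<^bsub>4j\<^esub>, ..., x\<^bsub>4j+3\<^esub>\<close> with apex \<open>y\<^bsub>j+1\<^esub>\<close>. A hole going round the ring
  crosses a fan either along its path or through its apex; the second way shortens the hole by one, so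
  an odd hole uses the apexes of an even set \<open>S\<close> of fans. Every stable set meets the complement
  of the middle vertices of the fans in \<open>S\<close> in at most half of the hole (\<open>twice_stable_card_le\<close>), which
  bounds the demand that \<open>n\<close> colours can meet. The main point is that these bounds and
  those given by cliques are the only obstructions: if all of them hold, colours can be
  propagated around the ring (\<open>ring_coloring_or_violation\<close>), because the block colourings that extend
  given colours at the ends depend only on the number of colours shared by these ends, and the
  possible values of this number form an interval. Hence a critical set is either an edge, a triangle, or contains an
  odd hole and avoids the middle vertices of the fans whose apexes the hole uses (\<open>critical_obstruction\<close>).

  Conversely each of these sets is critical for all \<open>n \<ge> t + 2\<close>. For an odd hole with further vertices
  (\<open>odd_hole_critical\<close>) take demand one on the hole, add for each further vertex a maximum stable set
  through it, and add copies of a maximum stable set of the hole; there are at most \<open>t\<close> further vertices,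
  all of them apexes. So the associated primes are constant from \<open>t + 2\<close> on.

  Finally, the set of all vertices is not critical for \<open>n = t + 1\<close> (\<open>not_critical_H\<close>). In a colouring that meets
  a critical demand with one unit removed, all colour classes are maximum stable sets. Such a class
  contains at most one of the \<open>t + 1\<close> vertices \<open>x\<^sub>2, y\<^sub>1, ..., y\<^sub>t\<close>; there are \<open>t + 1\<close> classes, so each contains exactly
  one, and then it contains both or none of \<open>x\<^sub>1\<close> and \<open>x\<^sub>3\<close>. Thus \<open>x\<^sub>1\<close> and \<open>x\<^sub>3\<close> get the same number of colours, whether the
  unit was removed from \<open>x\<^sub>1\<close> or from \<open>x\<^sub>3\<close>, which is absurd.
\<close>

section \<open>Weighted colourings and critical vertex sets\<close>

text \<open>Meeting the demand \<open>b\<close> amounts to colouring the graph in which each vertex \<open>v\<close> is blown up to a clique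
  of size \<open>b v\<close>.\<close>

definition multicolorable :: "'v graph \<Rightarrow> nat \<Rightarrow> ('v \<Rightarrow> nat) \<Rightarrow> bool" where
  "multicolorable G n b \<longleftrightarrow>
     (\<exists>A. (\<forall>v\<in>verts G. A v \<subseteq> {..<n} \<and> b v \<le> card (A v)) \<and>
          (\<forall>u v. {u, v} \<in> edges G \<longrightarrow> A u \<inter> A v = {}))"

text \<open>The blow-up of the subgraph induced by \<open>W\<close> is vertex-critical with chromatic number \<open>n + 1\<close>. The
  bound \<open>b v \<le> n\<close> excludes a single vertex with demand \<open>n + 1\<close>, which would be an exponent \<open>-1\<close>.\<close>

definition critical :: "'v graph \<Rightarrow> nat \<Rightarrow> 'v set \<Rightarrow> bool" where
  "critical G n W \<longleftrightarrow>
     (\<exists>b. {v. b v > 0} = W \<and> (\<forall>v. b v \<le> n) \<and> \<not> multicolorable G n b \<and>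
          (\<forall>v\<in>W. multicolorable G n (b(v := b v - 1))))"

lemma multicolorable_mono:
  assumes "multicolorable G n b" "\<And>v. v \<in> verts G \<Longrightarrow> b' v \<le> b v"
  shows "multicolorable G n b'"
  using assms unfolding multicolorable_def by (meson order_trans)

section \<open>Associated primes of monomial ideals\<close>

text \<open>Every element of \<open>R / I\<close> is a coset \<open>I + f\<close>, and its annihilator is the colon ideal \<open>(I : f)\<close>.\<close>

lemma (in cring) Ass_quotient_module:
  assumes "ideal I R"
  shows "Ass R (quotient_module R I) =
    {P. primeideal P R \<and> (\<exists>f\<in>carrier R. P = {r \<in> carrier R. r \<otimes> f \<in> I})}"
proof -
  interpret I: ideal I R by fact
  have smult: "r \<odot>\<^bsub>quotient_module R I\<^esub> (I +> f) = \<zero>\<^bsub>quotient_module R I\<^esub> \<longleftrightarrow> r \<otimes> f \<in> I"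
    if "r \<in> carrier R" "f \<in> carrier R" for r f
  proof -
    have "r \<odot>\<^bsub>quotient_module R I\<^esub> (I +> f) = I +> (r \<otimes> f)"
      using that by (simp add: quotient_module_def FactRing_def I.rcoset_mult_add)
    moreover have "\<zero>\<^bsub>quotient_module R I\<^esub> = I"
      by (simp add: quotient_module_def FactRing_def)
    moreover have "I +> (r \<otimes> f) = I \<longleftrightarrow> r \<otimes> f \<in> I"
      using that by (metis I.a_rcos_const I.a_rcos_self m_closed)
    ultimately show ?thesis by simp
  qed
  have carr: "carrier (quotient_module R I) = (\<lambda>f. I +> f) ` carrier R"
    by (auto simp: quotient_module_def FactRing_def A_RCOSETS_def')
  show ?thesis unfolding Ass_def carr using smult by (auto cong: conj_cong)
qed

definition monomial_ideal :: "'v set \<Rightarrow> ('v \<Rightarrow>\<^sub>0 nat) set \<Rightarrow> ('v, 'k::field) mpoly set" where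
  "monomial_ideal V U = {p \<in> carrier (mpoly_ring V). Poly_Mapping.keys p \<subseteq> U}"

definition exponents :: "'v set \<Rightarrow> ('v \<Rightarrow>\<^sub>0 nat) set" where
  "exponents V = {m. Poly_Mapping.keys m \<subseteq> V}"

definition upward_closed :: "'v set \<Rightarrow> ('v \<Rightarrow>\<^sub>0 nat) set \<Rightarrow> bool" where
  "upward_closed V U \<longleftrightarrow> U \<subseteq> exponents V \<and> (\<forall>m\<in>U. \<forall>k\<in>exponents V. k + m \<in> U)"

lemma mpoly_ring_simps:
  "carrier (mpoly_ring V) = {p. Poly_Mapping.keys p \<subseteq> exponents V}"
  "p \<otimes>\<^bsub>mpoly_ring V\<^esub> q = p * q" "p \<oplus>\<^bsub>mpoly_ring V\<^esub> q = p + q"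
  "\<one>\<^bsub>mpoly_ring V\<^esub> = 1" "\<zero>\<^bsub>mpoly_ring V\<^esub> = 0"
  by (auto simp: mpoly_ring_def exponents_def)

lemma keys_plus_nat: "Poly_Mapping.keys (a + b) = Poly_Mapping.keys a \<union> Poly_Mapping.keys b"
  for a b :: "'v \<Rightarrow>\<^sub>0 nat"
  by (auto simp: in_keys_iff lookup_add)

lemma exponents_add_iff: "a + b \<in> exponents V \<longleftrightarrow> a \<in> exponents V \<and> b \<in> exponents V"
  by (simp add: exponents_def keys_plus_nat)

lemma a_inv_mpoly_ring:
  assumes "p \<in> carrier (mpoly_ring V)"
  shows "\<ominus>\<^bsub>mpoly_ring V\<^esub> p = - p"
proof -
  interpret cring "mpoly_ring V" by (rule cring_mpoly_ring)
  show ?thesis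
    by (rule minus_equality) (use assms in \<open>auto simp: mpoly_ring_simps\<close>)
qed

lemma keys_times_subset:
  assumes "Poly_Mapping.keys p \<subseteq> A" "Poly_Mapping.keys q \<subseteq> B" "\<And>a b. a \<in> A \<Longrightarrow> b \<in> B \<Longrightarrow> a + b \<in> C"
  shows "Poly_Mapping.keys (p * q) \<subseteq> C"
  using Poly_Mapping.keys_mult[of p q] assms by blast

lemma keys_plus_subset:
  assumes "Poly_Mapping.keys p \<subseteq> A" "Poly_Mapping.keys q \<subseteq> A"
  shows "Poly_Mapping.keys (p + q) \<subseteq> A"
  using Poly_Mapping.keys_add[of p q] assms by blast

lemma ideal_monomial_ideal:
  assumes "upward_closed V U"
  shows "ideal (monomial_ideal V U :: ('v, 'k::field) mpoly set) (mpoly_ring V)"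
proof -
  let ?R = "mpoly_ring V :: ('v, 'k) mpoly ring"
  interpret cring ?R by (rule cring_mpoly_ring)
  have sub: "monomial_ideal V U \<subseteq> carrier ?R" by (auto simp: monomial_ideal_def)
  have mult: "r * p \<in> monomial_ideal V U"
    if "p \<in> monomial_ideal V U" "r \<in> carrier ?R" for r p :: "('v, 'k) mpoly"
  proof -
    have "Poly_Mapping.keys (r * p) \<subseteq> U"
      by (rule keys_times_subset[of _ "exponents V" _ U])
        (use that assms in \<open>auto simp: monomial_ideal_def mpoly_ring_simps upward_closed_def\<close>)
    then show ?thesis
      using assms by (auto simp: monomial_ideal_def mpoly_ring_simps upward_closed_def)
  qed
  have minus: "\<ominus>\<^bsub>?R\<^esub> p \<in> monomial_ideal V U" if "p \<in> monomial_ideal V U" for p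
    using that by (subst a_inv_mpoly_ring) (auto simp: monomial_ideal_def mpoly_ring_simps)
  show ?thesis
  proof (rule idealI)
    show "ring ?R" by (rule ring_axioms)
    show "subgroup (monomial_ideal V U) (add_monoid ?R)"
    proof (rule add.subgroupI)
      show "monomial_ideal V U \<subseteq> carrier ?R" by fact
      show "monomial_ideal V U \<noteq> {}"
        by (auto simp: monomial_ideal_def mpoly_ring_simps intro!: exI[of _ 0])
      show "p \<oplus>\<^bsub>?R\<^esub> q \<in> monomial_ideal V U"
        if "p \<in> monomial_ideal V U" "q \<in> monomial_ideal V U" for p q
        using that keys_plus_subset[of p _ q]
        by (simp add: monomial_ideal_def mpoly_ring_simps)
    qed (use minus in \<open>auto simp: a_inv_def\<close>)
  qed (use mult in \<open>auto simp: mpoly_ring_simps mult.commute\<close>)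
qed

lemma sum_monomials:
  fixes p :: "'a \<Rightarrow>\<^sub>0 'b::comm_monoid_add"
  shows "(\<Sum>m\<in>Poly_Mapping.keys p. Poly_Mapping.single m (Poly_Mapping.lookup p m)) = p"
  by (rule poly_mapping_eqI)
    (auto simp: lookup_sum lookup_single when_def in_keys_iff)

lemma mpoly_mem_by_monomials:
  fixes p :: "'a \<Rightarrow>\<^sub>0 'b::comm_monoid_add"
  assumes "0 \<in> S" and "\<And>p q. p \<in> S \<Longrightarrow> q \<in> S \<Longrightarrow> p + q \<in> S"
    and "\<And>m. m \<in> Poly_Mapping.keys p \<Longrightarrow> Poly_Mapping.single m (Poly_Mapping.lookup p m) \<in> S"
  shows "p \<in> S"
proof -
  have "(\<Sum>m\<in>M. Poly_Mapping.single m (Poly_Mapping.lookup p m)) \<in> S"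
    if "finite M" "M \<subseteq> Poly_Mapping.keys p" for M
    using that by (induction M rule: finite_induct) (use assms in auto)
  from this[of "Poly_Mapping.keys p"] show ?thesis by (simp add: sum_monomials)
qed

text \<open>A polynomial is a sum of monomials, and a monomial with exponent \<open>a + b\<close> is a product of a monomial
  in each of the two ideals.\<close>

lemma ideal_prod_monomial_ideal:
  assumes "upward_closed V U" "upward_closed V U'"
  shows "ideal_prod (mpoly_ring V) (monomial_ideal V U) (monomial_ideal V U') =
    (monomial_ideal V {a + b |a b. a \<in> U \<and> b \<in> U'} :: ('v, 'k::field) mpoly set)" (is "?L = ?M")
proof
  let ?R = "mpoly_ring V :: ('v, 'k) mpoly ring"
  interpret cring ?R by (rule cring_mpoly_ring)
  have id: "ideal ?L ?R"
    using assms by (intro ideal_prod_is_ideal ideal_monomial_ideal)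
  show "?L \<subseteq> ?M"
  proof
    fix p assume "p \<in> ?L"
    then show "p \<in> ?M"
    proof (induction rule: ideal_prod.induct)
      case (prod i j)
      have "Poly_Mapping.keys (i * j) \<subseteq> {a + b |a b. a \<in> U \<and> b \<in> U'}"
        by (rule keys_times_subset[of _ U _ U']) (use prod in \<open>auto simp: monomial_ideal_def\<close>)
      moreover have "{a + b |a b. a \<in> U \<and> b \<in> U'} \<subseteq> exponents V"
        using assms by (auto simp: exponents_add_iff upward_closed_def)
      ultimately show ?case
        unfolding monomial_ideal_def mpoly_ring_simps by blast
    next
      case (sum s1 s2)
      then show ?case
        using keys_plus_subset[of s1 _ s2] by (simp add: monomial_ideal_def mpoly_ring_simps)
    qed
  qed
  show "?M \<subseteq> ?L"
  proof
    fix p :: "('v, 'k) mpoly" assume p: "p \<in> ?M"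
    show "p \<in> ?L"
    proof (rule mpoly_mem_by_monomials)
      show "0 \<in> ?L"
        using additive_subgroup.zero_closed[OF ideal.axioms(1)[OF id]] by (simp add: mpoly_ring_simps)
      show "p + q \<in> ?L" if "p \<in> ?L" "q \<in> ?L" for p q
        using ideal_prod.sum[OF that] by (simp add: mpoly_ring_simps)
      fix m assume "m \<in> Poly_Mapping.keys p"
      then obtain a b where ab: "m = a + b" "a \<in> U" "b \<in> U'" using p by (auto simp: monomial_ideal_def)
      have "Poly_Mapping.single m (Poly_Mapping.lookup p m) =
        Poly_Mapping.single a (Poly_Mapping.lookup p m) * Poly_Mapping.single b 1"
        by (simp add: mult_single ab)
      moreover have "Poly_Mapping.single a (Poly_Mapping.lookup p m) \<in> monomial_ideal V U"
        "Poly_Mapping.single b 1 \<in> (monomial_ideal V U' :: ('v, 'k) mpoly set)"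
        using ab assms by (auto simp: monomial_ideal_def mpoly_ring_simps upward_closed_def)
      ultimately show "Poly_Mapping.single m (Poly_Mapping.lookup p m) \<in> ?L"
        using ideal_prod.prod[of _ "monomial_ideal V U" _ "monomial_ideal V U'" ?R]
        by (metis mpoly_ring_simps(2))
    qed
  qed
qed

lemma lookup_mult_unique_sum:
  fixes p q :: "'a::cancel_comm_monoid_add \<Rightarrow>\<^sub>0 'b::semiring_0"
  assumes "\<And>a' b'. a' \<in> Poly_Mapping.keys p \<Longrightarrow> b' \<in> Poly_Mapping.keys q \<Longrightarrow> a' + b' = a + b \<Longrightarrow> a' = a"
  shows "Poly_Mapping.lookup (p * q) (a + b) = Poly_Mapping.lookup p a * Poly_Mapping.lookup q b"
proof -
  have "Poly_Mapping.lookup p l * (\<Sum>k. Poly_Mapping.lookup q k when a + b = l + k) =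
      (Poly_Mapping.lookup p a * Poly_Mapping.lookup q b when l = a)" for l
  proof (cases "l = a")
    case True
    then show ?thesis by simp
  next
    case False
    show ?thesis
    proof (cases "l \<in> Poly_Mapping.keys p")
      case True
      have "(Poly_Mapping.lookup q k when a + b = l + k) = 0" for k
        using assms[OF True, of k] False
        by (cases "Poly_Mapping.lookup q k = 0") (auto simp: when_def in_keys_iff)
      then show ?thesis using False by simp
    qed (use False in \<open>simp add: in_keys_iff\<close>)
  qed
  then show ?thesis by (simp add: lookup_mult)
qed

lemma keys_monomial_mult:
  fixes f :: "('v, 'k::field) mpoly"
  assumes "c \<noteq> 0"
  shows "Poly_Mapping.keys (Poly_Mapping.single k c * f) = (+) k ` Poly_Mapping.keys f"
proof
  show "Poly_Mapping.keys (Poly_Mapping.single k c * f) \<subseteq> (+) k ` Poly_Mapping.keys f"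
    by (rule keys_times_subset[of _ "{k}" _ "Poly_Mapping.keys f"]) auto
  have "Poly_Mapping.lookup (Poly_Mapping.single k c * f) (k + m) = c * Poly_Mapping.lookup f m" for m
    by (subst lookup_mult_unique_sum) (auto split: if_splits)
  then show "(+) k ` Poly_Mapping.keys f \<subseteq> Poly_Mapping.keys (Poly_Mapping.single k c * f)"
    using assms by (auto simp: in_keys_iff)
qed

text \<open>No cancellation can occur at a leading exponent: a sum of two exponents that equals the sum of the
  largest ones has the largest ones as its summands.\<close>

lemma top_sum_in_keys_mult:
  fixes p q :: "('v::linorder, 'k::field) mpoly"
  assumes a: "a \<in> Poly_Mapping.keys p" and b: "b \<in> Poly_Mapping.keys q"
    and top: "\<And>a' b'. a' \<in> Poly_Mapping.keys p \<Longrightarrow> b' \<in> Poly_Mapping.keys q \<Longrightarrow> a' + b' = a + b \<Longrightarrow>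
      a' \<le> a \<and> b' \<le> b"
  shows "a + b \<in> Poly_Mapping.keys (p * q)"
proof -
  have "Poly_Mapping.lookup (p * q) (a + b) = Poly_Mapping.lookup p a * Poly_Mapping.lookup q b"
  proof (rule lookup_mult_unique_sum, rule ccontr)
    fix a' b' assume *: "a' \<in> Poly_Mapping.keys p" "b' \<in> Poly_Mapping.keys q" "a' + b' = a + b" "a' \<noteq> a"
    then have "a' + b' < a + b" using top[OF *(1-3)] by (intro add_less_le_mono) auto
    then show False using * by simp
  qed
  then show ?thesis using a b by (simp add: in_keys_iff)
qed

definition colon_monomial :: "'v set \<Rightarrow> ('v \<Rightarrow>\<^sub>0 nat) set \<Rightarrow> ('v \<Rightarrow>\<^sub>0 nat) \<Rightarrow> ('v, 'k::field) mpoly set" where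
  "colon_monomial V U m = {r \<in> carrier (mpoly_ring V). \<forall>k\<in>Poly_Mapping.keys r. k + m \<in> U}"

lemma colon_monomial_eq:
  assumes "upward_closed V U" "m \<in> exponents V"
  shows "(colon_monomial V U m :: ('v, 'k::field) mpoly set) =
    {r \<in> carrier (mpoly_ring V). r * Poly_Mapping.single m 1 \<in> monomial_ideal V U}"
  using assms
  by (auto simp: colon_monomial_def monomial_ideal_def mpoly_ring_simps keys_monomial_mult
      mult.commute[of _ "Poly_Mapping.single m 1"] add.commute exponents_add_iff subset_iff)

definition variable_prime :: "'v set \<Rightarrow> 'v set \<Rightarrow> ('v, 'k::field) mpoly set" where
  "variable_prime V W = monomial_ideal V {m \<in> exponents V. Poly_Mapping.keys m \<inter> W \<noteq> {}}"

text \<open>Consider the terms of two polynomials that contain no variable of \<open>W\<close>. If both polynomials have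
  such terms, then the product of the leading ones among them survives in the product.\<close>

lemma variable_prime_is_primeideal:
  "primeideal (variable_prime V W :: ('v::linorder, 'k::field) mpoly set) (mpoly_ring V)"
proof (rule primeidealI)
  let ?R = "mpoly_ring V :: ('v, 'k) mpoly ring"
  show "cring ?R" by (rule cring_mpoly_ring)
  show "ideal (variable_prime V W) ?R"
    unfolding variable_prime_def
    by (rule ideal_monomial_ideal) (auto simp: upward_closed_def exponents_add_iff keys_plus_nat)
  have "1 \<notin> (variable_prime V W :: ('v, 'k) mpoly set)"
    by (auto simp: variable_prime_def monomial_ideal_def)
  moreover have "1 \<in> carrier ?R" by (simp add: mpoly_ring_simps exponents_def)
  ultimately show "carrier ?R \<noteq> variable_prime V W" by blast
  fix p q :: "('v, 'k) mpoly"
  assume p: "p \<in> carrier ?R" and q: "q \<in> carrier ?R" and pq: "p \<otimes>\<^bsub>?R\<^esub> q \<in> variable_prime V W"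
  define free where "free r = {m \<in> Poly_Mapping.keys r. Poly_Mapping.keys m \<inter> W = {}}" for r :: "('v, 'k) mpoly"
  have fin: "finite (free r)" for r by (simp add: free_def)
  show "p \<in> variable_prime V W \<or> q \<in> variable_prime V W"
  proof (rule ccontr)
    assume "\<not> ?thesis"
    then have ne: "free p \<noteq> {}" "free q \<noteq> {}"
      using p q by (auto simp: variable_prime_def monomial_ideal_def free_def mpoly_ring_simps)
    define a where "a = Max (free p)"
    define b where "b = Max (free q)"
    have ab: "a \<in> free p" "b \<in> free q"
      using Max_in[OF fin ne(1)] Max_in[OF fin ne(2)] by (auto simp: a_def b_def)
    have "a + b \<in> Poly_Mapping.keys (p * q)"
    proof (rule top_sum_in_keys_mult)
      show "a \<in> Poly_Mapping.keys p" "b \<in> Poly_Mapping.keys q" using ab by (auto simp: free_def)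
      fix a' b' assume *: "a' \<in> Poly_Mapping.keys p" "b' \<in> Poly_Mapping.keys q" "a' + b' = a + b"
      then have "Poly_Mapping.keys a' \<union> Poly_Mapping.keys b' = Poly_Mapping.keys a \<union> Poly_Mapping.keys b"
        by (metis keys_plus_nat)
      then have "a' \<in> free p" "b' \<in> free q" using * ab by (auto simp: free_def)
      then show "a' \<le> a \<and> b' \<le> b" using fin by (auto simp: a_def b_def)
    qed
    then have "Poly_Mapping.keys (a + b) \<inter> W \<noteq> {}"
      using pq by (auto simp: variable_prime_def monomial_ideal_def mpoly_ring_simps)
    then show False using ab by (auto simp: free_def keys_plus_nat)
  qed
qed

lemma single_in_monomial_ideal [simp]:
  "c \<noteq> 0 \<Longrightarrow> Poly_Mapping.single m c \<in> monomial_ideal V U \<longleftrightarrow> m \<in> U \<and> m \<in> exponents V"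
  by (auto simp: monomial_ideal_def mpoly_ring_simps)

lemma variable_prime_inject:
  assumes "W \<subseteq> V" "W' \<subseteq> V" "(variable_prime V W :: ('v, 'k::field) mpoly set) = variable_prime V W'"
  shows "W = W'"
proof -
  have "v \<in> W \<longleftrightarrow> (Var v :: ('v, 'k) mpoly) \<in> variable_prime V W" if "v \<in> V" "W \<subseteq> V" for v W
    using that by (auto simp: variable_prime_def Var_def exponents_def)
  from this[of _ W] this[of _ W'] show ?thesis using assms by blast
qed

text \<open>Among all elements with annihilator \<open>P\<close> choose one, \<open>g\<close>, with the fewest terms. If multiplication by a monomial \<open>x^k\<close>
  outside \<open>P\<close> moved a term of \<open>g\<close> into the ideal, then \<open>x^k g\<close> without this term would again have
  annihilator \<open>P\<close>, with fewer terms. So \<open>x^k\<close> lies in \<open>P\<close> as soon as it moves one term of \<open>g\<close> into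
  the ideal. Leading terms then show that \<open>P\<close> is generated by monomials, and primality reduces these to variables.\<close>

lemma colon_prime_is_variable_prime:
  fixes P :: "('v::linorder, 'k::field) mpoly set"
  assumes V: "finite V" and U: "upward_closed V U" and prime: "primeideal P (mpoly_ring V)"
    and f: "f \<in> carrier (mpoly_ring V)"
    and P: "P = {r \<in> carrier (mpoly_ring V). r * f \<in> monomial_ideal V U}"
  obtains m W where "m \<in> exponents V" "W \<subseteq> V" "P = variable_prime V W" "P = colon_monomial V U m"
proof -
  let ?R = "mpoly_ring V :: ('v, 'k) mpoly ring"
  let ?I = "monomial_ideal V U :: ('v, 'k) mpoly set"
  interpret cring ?R by (rule cring_mpoly_ring)
  interpret P: primeideal P ?R by (rule prime)
  interpret I: ideal ?I ?R by (rule ideal_monomial_ideal[OF U])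
  define ann where "ann g = {r \<in> carrier ?R. r * g \<in> ?I}" for g
  define good where "good g \<longleftrightarrow> g \<in> carrier ?R \<and> P = ann g" for g
  have one: "1 \<notin> P" using P.I_notcarr P.one_imp_carrier by (auto simp: mpoly_ring_simps)
  have mult_carr: "p * q \<in> carrier ?R" if "p \<in> carrier ?R" "q \<in> carrier ?R" for p q
    using m_closed[OF that] by (simp add: mpoly_ring_simps)
  have I_add: "p + q \<in> ?I" if "p \<in> ?I" "q \<in> ?I" for p q
    using I.a_closed[OF that] by (simp add: mpoly_ring_simps)
  have I_uminus: "- p \<in> ?I" if "p \<in> ?I" for p
    using that by (simp add: monomial_ideal_def mpoly_ring_simps)
  have I_mult: "r * p \<in> ?I" if "p \<in> ?I" "r \<in> carrier ?R" for p r
    using I.I_l_closed[OF that] by (simp add: mpoly_ring_simps)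
  have ann_cong: "ann g = ann g'" if diff: "g - g' \<in> ?I" for g g'
  proof -
    have "r * g \<in> ?I \<longleftrightarrow> r * g' \<in> ?I" if r: "r \<in> carrier ?R" for r
    proof -
      have d: "r * (g - g') \<in> ?I" using diff r by (rule I_mult)
      have "r * g = r * g' + r * (g - g')" "r * g' = r * g + - (r * (g - g'))"
        by (simp_all add: right_diff_distrib)
      then show ?thesis using I_add d I_uminus[OF d] by metis
    qed
    then show ?thesis by (auto simp: ann_def)
  qed
  have "good f" unfolding good_def ann_def using f P by blast
  then have "\<exists>g. good g \<and> (\<forall>h. good h \<longrightarrow> card (Poly_Mapping.keys g) \<le> card (Poly_Mapping.keys h))"
    by (rule ex_has_least_nat)
  then obtain g where g: "good g" and min: "\<And>h. good h \<Longrightarrow> card (Poly_Mapping.keys g) \<le> card (Poly_Mapping.keys h)"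
    by auto
  have g_carr: "g \<in> carrier ?R" and P_ann: "P = ann g" using g unfolding good_def by blast+
  have P_iff: "r \<in> P \<longleftrightarrow> r * g \<in> ?I" if "r \<in> carrier ?R" for r
    using that unfolding P_ann ann_def by blast
  have "g \<noteq> 0"
  proof
    assume "g = 0"
    moreover have "1 \<in> carrier ?R" "0 \<in> ?I"
      by (simp_all add: mpoly_ring_simps exponents_def monomial_ideal_def)
    ultimately show False using one P_iff[of 1] by simp
  qed
  then obtain m where m: "m \<in> Poly_Mapping.keys g" by (metis keys_eq_empty ex_in_conv)
  have m_exp: "m' \<in> exponents V" if "m' \<in> Poly_Mapping.keys g" for m' using g_carr that by (auto simp: mpoly_ring_simps)
  have single_carr: "Poly_Mapping.single k c \<in> carrier ?R" if "k \<in> exponents V" for k c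
    using that by (simp add: mpoly_ring_simps)
  have key: "Poly_Mapping.single k 1 \<in> P"
    if k: "k \<in> exponents V" and m': "m' \<in> Poly_Mapping.keys g" and km: "k + m' \<in> U" for k m'
  proof (rule ccontr)
    let ?x = "Poly_Mapping.single k (1::'k)"
    assume notP: "?x \<notin> P"
    define h where "h = ?x * g - Poly_Mapping.single (k + m') (Poly_Mapping.lookup (?x * g) (k + m'))"
    have keys_h: "Poly_Mapping.keys h = (+) k ` Poly_Mapping.keys g - {k + m'}"
    proof -
      have "Poly_Mapping.lookup h l = (if l = k + m' then 0 else Poly_Mapping.lookup (?x * g) l)" for l
        by (simp add: h_def lookup_minus lookup_single when_def)
      note lookup_h = this
      have "Poly_Mapping.keys h = Poly_Mapping.keys (?x * g) - {k + m'}"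
      proof (rule Set.set_eqI)
        show "l \<in> Poly_Mapping.keys h \<longleftrightarrow> l \<in> Poly_Mapping.keys (?x * g) - {k + m'}" for l
          by (cases "l = k + m'") (simp_all add: in_keys_iff lookup_h)
      qed
      then show ?thesis by (simp add: keys_monomial_mult)
    qed
    have "ann h = ann (?x * g)"
      by (rule ann_cong[symmetric])
        (use km k m_exp[OF m'] in \<open>auto simp: h_def monomial_ideal_def mpoly_ring_simps exponents_add_iff\<close>)
    also have "\<dots> = P"
    proof -
      have "s * (?x * g) \<in> ?I \<longleftrightarrow> s \<in> P" if s: "s \<in> carrier ?R" for s
      proof -
        have "s * (?x * g) \<in> ?I \<longleftrightarrow> s * ?x \<in> P"
          using P_iff[OF mult_carr[OF s single_carr[OF k]]] by (simp add: mult.assoc)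
        also have "\<dots> \<longleftrightarrow> s \<in> P"
          using P.I_prime[OF s single_carr[OF k, of 1]] P.I_r_closed[of s ?x] notP single_carr[OF k]
          by (auto simp: mpoly_ring_simps(2))
        finally show ?thesis .
      qed
      then show ?thesis using P.Icarr unfolding ann_def by blast
    qed
    finally have "P = ann h" by (rule sym)
    moreover have "h \<in> carrier ?R"
      using keys_h m_exp k by (auto simp: mpoly_ring_simps exponents_add_iff)
    ultimately have "good h" unfolding good_def by blast
    moreover have "card (Poly_Mapping.keys h) < card (Poly_Mapping.keys g)"
    proof -
      have "card (Poly_Mapping.keys h) = card ((+) k ` Poly_Mapping.keys g) - 1"
        using m' keys_h by simp
      also have "card ((+) k ` Poly_Mapping.keys g) = card (Poly_Mapping.keys g)"
        by (rule card_image) (simp add: inj_on_def)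
      finally show ?thesis using m' by (metis card_gt_0_iff diff_less empty_iff finite_keys zero_less_one)
    qed
    ultimately show False using min[of h] by simp
  qed
  have single_P: "Poly_Mapping.single k 1 \<in> P \<longleftrightarrow> k + m \<in> U" if k: "k \<in> exponents V" for k
  proof
    assume "Poly_Mapping.single k 1 \<in> P"
    then have "Poly_Mapping.single k 1 * g \<in> ?I" using P_iff[OF single_carr[OF k]] by blast
    then have "(+) k ` Poly_Mapping.keys g \<subseteq> U"
      unfolding monomial_ideal_def by (simp add: keys_monomial_mult)
    then show "k + m \<in> U" using m by blast
  qed (rule key[OF k m])
  have single_P_scale: "Poly_Mapping.single k c \<in> P" if "Poly_Mapping.single k 1 \<in> P" for k c
    using P.I_l_closed[OF that, of "Poly_Mapping.single 0 c"]
    by (simp add: mpoly_ring_simps mult_single exponents_def)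
  have P_add: "p + q \<in> P" if "p \<in> P" "q \<in> P" for p q
    using P.a_closed[OF that] by (simp add: mpoly_ring_simps)
  have P_zero: "0 \<in> P" using P.zero_closed by (simp add: mpoly_ring_simps)
  have monomials: "\<forall>k\<in>Poly_Mapping.keys r. Poly_Mapping.single k 1 \<in> P" if "r \<in> P" for r
    using that
  proof (induction "card (Poly_Mapping.keys r)" arbitrary: r)
    case (0 r)
    then show ?case by simp
  next
    case (Suc d r)
    have ne: "Poly_Mapping.keys r \<noteq> {}" using Suc(2) by (metis card.empty nat.distinct(1))
    define a where "a = Max (Poly_Mapping.keys r)"
    define b where "b = Max (Poly_Mapping.keys g)"
    have a: "a \<in> Poly_Mapping.keys r" unfolding a_def by (rule Max_in[OF finite_keys ne])
    have b: "b \<in> Poly_Mapping.keys g" unfolding b_def by (rule Max_in) (use m in auto)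
    have "a + b \<in> Poly_Mapping.keys (r * g)"
      by (rule top_sum_in_keys_mult[OF a b]) (simp add: a_def b_def)
    moreover have "r * g \<in> ?I" using P_iff[OF P.Icarr[OF Suc(3)]] Suc(3) by (rule iffD1)
    ultimately have "a + b \<in> U" unfolding monomial_ideal_def by blast
    moreover have a_exp: "a \<in> exponents V" using P.Icarr[OF Suc(3)] a unfolding mpoly_ring_simps by blast
    ultimately have aP: "Poly_Mapping.single a 1 \<in> P" using key[OF a_exp b] by blast
    define r' where "r' = r + Poly_Mapping.single a (- Poly_Mapping.lookup r a)"
    have lookup_r': "Poly_Mapping.lookup r' l = (if l = a then 0 else Poly_Mapping.lookup r l)" for l
      by (simp add: r'_def lookup_add lookup_single when_def)
    have keys_r': "Poly_Mapping.keys r' = Poly_Mapping.keys r - {a}"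
    proof (rule Set.set_eqI)
      show "l \<in> Poly_Mapping.keys r' \<longleftrightarrow> l \<in> Poly_Mapping.keys r - {a}" for l
        by (cases "l = a") (simp_all add: in_keys_iff lookup_r')
    qed
    have r': "r' \<in> P" unfolding r'_def by (rule P_add[OF Suc(3) single_P_scale[OF aP]])
    have "d = card (Poly_Mapping.keys r')" using Suc(2) a keys_r' by simp
    then have "\<forall>k\<in>Poly_Mapping.keys r'. Poly_Mapping.single k 1 \<in> P" using r' by (rule Suc(1))
    then show ?case using aP keys_r' by blast
  qed
  have P_colon: "P = colon_monomial V U m"
  proof
    show "P \<subseteq> colon_monomial V U m"
    proof
      fix r assume r: "r \<in> P"
      have "k + m \<in> U" if "k \<in> Poly_Mapping.keys r" for k
        using monomials[OF r] single_P[of k] P.Icarr[OF r] that unfolding mpoly_ring_simps by blast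
      then show "r \<in> colon_monomial V U m"
        using P.Icarr[OF r] unfolding colon_monomial_def by blast
    qed
    show "colon_monomial V U m \<subseteq> P"
    proof
      fix r :: "('v, 'k) mpoly" assume r: "r \<in> colon_monomial V U m"
      show "r \<in> P"
      proof (rule mpoly_mem_by_monomials[OF P_zero P_add])
        fix k assume "k \<in> Poly_Mapping.keys r"
        then have "k \<in> exponents V" "k + m \<in> U"
          using r unfolding colon_monomial_def mpoly_ring_simps by blast+
        then show "Poly_Mapping.single k (Poly_Mapping.lookup r k) \<in> P"
          using single_P single_P_scale by blast
      qed
    qed
  qed
  define W where "W = {v \<in> V. Poly_Mapping.single v 1 + m \<in> U}"
  have split: "k = (k - Poly_Mapping.single v 1) + Poly_Mapping.single v 1" if "v \<in> Poly_Mapping.keys k" for v and k :: "'v \<Rightarrow>\<^sub>0 nat"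
    using that by (intro poly_mapping_eqI) (auto simp: lookup_add lookup_minus lookup_single when_def in_keys_iff)
  have mem_U: "k + m \<in> U \<longleftrightarrow> Poly_Mapping.keys k \<inter> W \<noteq> {}" if "k \<in> exponents V" for k
    using that
  proof (induction "\<Sum>v\<in>V. Poly_Mapping.lookup k v" arbitrary: k rule: less_induct)
    case less
    show ?case
    proof (cases "k = 0")
      case True
      then show ?thesis using one single_P[of 0] less(2) by simp
    next
      case False
      then obtain v where v: "v \<in> Poly_Mapping.keys k" by (metis keys_eq_empty ex_in_conv)
      define k' where "k' = k - Poly_Mapping.single v 1"
      have k: "k = k' + Poly_Mapping.single v 1" using split[OF v] by (simp add: k'_def)
      have exps: "k' \<in> exponents V" "Poly_Mapping.single v 1 \<in> exponents V" "v \<in> V"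
        using less(2) v by (auto simp: k exponents_add_iff) (auto simp: exponents_def keys_plus_nat)
      have "(\<Sum>v\<in>V. Poly_Mapping.lookup k v) = (\<Sum>v\<in>V. Poly_Mapping.lookup k' v) + 1"
        using V exps by (simp add: k lookup_add sum.distrib lookup_single when_def)
      then have IH: "k' + m \<in> U \<longleftrightarrow> Poly_Mapping.keys k' \<inter> W \<noteq> {}" using less(1) exps by simp
      have prod: "Poly_Mapping.single k (1::'k) = Poly_Mapping.single k' 1 * Poly_Mapping.single (Poly_Mapping.single v 1) 1"
        by (simp add: mult_single k)
      have "Poly_Mapping.single k 1 \<in> P \<longleftrightarrow> Poly_Mapping.single k' 1 \<in> P \<or> Poly_Mapping.single (Poly_Mapping.single v 1) 1 \<in> P"
        unfolding prod
        using P.I_prime[OF single_carr[OF exps(1), of 1] single_carr[OF exps(2), of 1]]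
          P.I_l_closed[OF _ single_carr[OF exps(1), of 1]] P.I_r_closed[OF _ single_carr[OF exps(2), of 1]]
        by (auto simp: mpoly_ring_simps(2))
      then have "k + m \<in> U \<longleftrightarrow> k' + m \<in> U \<or> v \<in> W"
        using single_P exps less(2) by (simp add: W_def)
      then show ?thesis using IH by (auto simp: k keys_plus_nat)
    qed
  qed
  have "P = variable_prime V W"
    unfolding P_colon colon_monomial_def variable_prime_def monomial_ideal_def mpoly_ring_simps
    using mem_U by blast
  moreover have "W \<subseteq> V" by (auto simp: W_def)
  ultimately show ?thesis using that[OF m_exp[OF m]] P_colon by blast
qed

section \<open>Powers of cover ideals and multicolourings\<close>

text \<open>The exponents of the monomials in the \<open>n\<close>-th power of the cover ideal.\<close>

definition cover_exponents :: "'v graph \<Rightarrow> nat \<Rightarrow> ('v \<Rightarrow>\<^sub>0 nat) set" where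
  "cover_exponents G n =
     {m \<in> exponents (verts G). multicolorable G n (\<lambda>v. n - Poly_Mapping.lookup m v)}"

lemma upward_closed_cover_exponents: "upward_closed (verts G) (cover_exponents G n)"
  unfolding upward_closed_def cover_exponents_def
  by (auto simp: exponents_add_iff lookup_add intro: multicolorable_mono)

definition set_exponent :: "'v set \<Rightarrow> ('v \<Rightarrow>\<^sub>0 nat)" where
  "set_exponent C = (\<Sum>v\<in>C. Poly_Mapping.single v 1)"

lemma lookup_set_exponent: "finite C \<Longrightarrow> Poly_Mapping.lookup (set_exponent C) v = (if v \<in> C then 1 else 0)"
  by (simp add: set_exponent_def lookup_sum lookup_single when_def)

lemma keys_set_exponent: "finite C \<Longrightarrow> Poly_Mapping.keys (set_exponent C) = C"
  by (auto simp: in_keys_iff lookup_set_exponent split: if_splits)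

lemma prod_Var: "finite C \<Longrightarrow> (\<Prod>v\<in>C. Var v) = Poly_Mapping.single (set_exponent C) 1"
  by (induction C rule: finite_induct) (auto simp: Var_def set_exponent_def mult_single)

lemma finite_vertex_cover: "finite_simple_graph G \<Longrightarrow> vertex_cover G C \<Longrightarrow> finite C"
  unfolding finite_simple_graph_def vertex_cover_def using finite_subset by blast

text \<open>The complement of a vertex cover is stable, so it can serve as the class of a new colour.\<close>

lemma cover_exponents_add_cover:
  assumes G: "finite_simple_graph G" and a: "a \<in> cover_exponents G n" and C: "vertex_cover G C"
  shows "a + set_exponent C \<in> cover_exponents G (Suc n)"
proof -
  have fin: "finite C" by (rule finite_vertex_cover[OF G C])
  obtain A where A: "\<forall>v\<in>verts G. A v \<subseteq> {..<n} \<and> n - Poly_Mapping.lookup a v \<le> card (A v)"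
    and disj: "\<forall>u v. {u, v} \<in> edges G \<longrightarrow> A u \<inter> A v = {}"
    using a unfolding cover_exponents_def multicolorable_def by blast
  define B where "B v = (if v \<in> C then A v else insert n (A v))" for v
  have "B v \<subseteq> {..<Suc n} \<and> Suc n - Poly_Mapping.lookup (a + set_exponent C) v \<le> card (B v)"
    if v: "v \<in> verts G" for v
  proof -
    have Av: "A v \<subseteq> {..<n}" "n - Poly_Mapping.lookup a v \<le> card (A v)" using A v by auto
    then have fin_A: "finite (A v)" "n \<notin> A v" using finite_subset by auto
    show ?thesis
    proof (cases "v \<in> C")
      case True
      then show ?thesis using Av by (simp add: B_def lookup_add lookup_set_exponent[OF fin] lessThan_Suc subset_insertI2)
    next
      case False
      then have "card (B v) = Suc (card (A v))" using fin_A by (simp add: B_def)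
      then show ?thesis
        using Av False by (simp add: B_def lookup_add lookup_set_exponent[OF fin] lessThan_Suc subset_insertI2)
    qed
  qed
  moreover have "B u \<inter> B v = {}" if e: "{u, v} \<in> edges G" for u v
  proof -
    have "{u, v} \<subseteq> verts G" using e G unfolding finite_simple_graph_def by blast
    then have n: "n \<notin> A u" "n \<notin> A v" using A by auto
    have "C \<inter> {u, v} \<noteq> {}" using C e unfolding vertex_cover_def by blast
    moreover have "A u \<inter> A v = {}" using disj e by blast
    ultimately show ?thesis using n by (auto simp: B_def)
  qed
  ultimately have "multicolorable G (Suc n) (\<lambda>v. Suc n - Poly_Mapping.lookup (a + set_exponent C) v)"
    unfolding multicolorable_def by (intro exI[of _ B]) simp
  moreover have "a + set_exponent C \<in> exponents (verts G)"
    using a C unfolding cover_exponents_def exponents_def vertex_cover_def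
    by (simp add: keys_plus_nat keys_set_exponent[OF fin])
  ultimately show ?thesis by (simp add: cover_exponents_def)
qed

text \<open>The vertices that do not carry the last colour form a vertex cover.\<close>

lemma cover_exponents_Suc_obtain:
  assumes G: "finite_simple_graph G" and m: "m \<in> cover_exponents G (Suc n)"
  obtains a C where "a \<in> cover_exponents G n" "vertex_cover G C" "m = a + set_exponent C"
proof -
  obtain A where A: "\<forall>v\<in>verts G. A v \<subseteq> {..<Suc n} \<and> Suc n - Poly_Mapping.lookup m v \<le> card (A v)"
    and disj: "\<forall>u v. {u, v} \<in> edges G \<longrightarrow> A u \<inter> A v = {}"
    using m unfolding cover_exponents_def multicolorable_def by blast
  define C where "C = {v \<in> verts G. n \<notin> A v}"
  have cover: "vertex_cover G C"
    unfolding vertex_cover_def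
  proof (intro conjI ballI)
    fix e assume e: "e \<in> edges G"
    then have "card e = 2" "e \<subseteq> verts G" using G by (auto simp: finite_simple_graph_def)
    then obtain u v where uv: "e = {u, v}" by (auto simp: card_2_iff)
    then have "A u \<inter> A v = {}" using disj e by blast
    then show "C \<inter> e \<noteq> {}" using uv \<open>e \<subseteq> verts G\<close> by (auto simp: C_def)
  qed (auto simp: C_def)
  have fin: "finite C" by (rule finite_vertex_cover[OF G cover])
  have pos: "Poly_Mapping.lookup m v \<ge> 1" if v: "v \<in> C" for v
  proof -
    have "A v \<subseteq> {..<Suc n}" "n \<notin> A v" using A v unfolding C_def by blast+
    then have "A v \<subseteq> {..<n}" by (simp add: lessThan_Suc subset_insert)
    then have "card (A v) \<le> n" using card_mono[of "{..<n}" "A v"] by simp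
    moreover have "Suc n - Poly_Mapping.lookup m v \<le> card (A v)" using A v by (auto simp: C_def)
    ultimately show ?thesis by linarith
  qed
  define a where "a = m - set_exponent C"
  have m_eq: "m = a + set_exponent C"
    by (rule poly_mapping_eqI) (use pos in \<open>auto simp: a_def lookup_add lookup_minus lookup_set_exponent[OF fin]\<close>)
  have "A v \<inter> {..<n} \<subseteq> {..<n} \<and> n - Poly_Mapping.lookup a v \<le> card (A v \<inter> {..<n})" if v: "v \<in> verts G" for v
  proof -
    have Av: "A v \<subseteq> {..<Suc n}" "Suc n - Poly_Mapping.lookup m v \<le> card (A v)" using A v by auto
    have "A v \<inter> {..<n} = A v - {n}" using Av(1) by (auto simp: lessThan_Suc)
    moreover have "card (A v - {n}) = card (A v) - (if n \<in> A v then 1 else 0)"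
      using finite_subset[OF Av(1)] by simp
    moreover have "Poly_Mapping.lookup m v = Poly_Mapping.lookup a v + (if n \<in> A v then 0 else 1)"
      unfolding m_eq lookup_add lookup_set_exponent[OF fin] using v by (simp add: C_def)
    ultimately show ?thesis using Av by (cases "n \<in> A v") auto
  qed
  moreover have "(A u \<inter> {..<n}) \<inter> (A v \<inter> {..<n}) = {}" if "{u, v} \<in> edges G" for u v
    using disj that by blast
  ultimately have "multicolorable G n (\<lambda>v. n - Poly_Mapping.lookup a v)"
    unfolding multicolorable_def by (intro exI[of _ "\<lambda>v. A v \<inter> {..<n}"] conjI ballI allI impI) simp_all
  moreover have "a \<in> exponents (verts G)"
    using m unfolding cover_exponents_def by (subst (asm) m_eq) (simp add: exponents_add_iff)
  ultimately have "a \<in> cover_exponents G n" by (simp add: cover_exponents_def)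
  then show ?thesis by (rule that[OF _ cover m_eq])
qed

lemma cover_exponents_0: "cover_exponents G 0 = exponents (verts G)"
  by (auto simp: cover_exponents_def multicolorable_def)

lemma cover_exponents_1_iff:
  assumes G: "finite_simple_graph G"
  shows "m \<in> cover_exponents G 1 \<longleftrightarrow> (\<exists>a C. a \<in> exponents (verts G) \<and> vertex_cover G C \<and> m = a + set_exponent C)"
proof
  assume "m \<in> cover_exponents G 1"
  then obtain a C where "a \<in> cover_exponents G 0" "vertex_cover G C" "m = a + set_exponent C"
    unfolding One_nat_def by (rule cover_exponents_Suc_obtain[OF G])
  then show "\<exists>a C. a \<in> exponents (verts G) \<and> vertex_cover G C \<and> m = a + set_exponent C"
    unfolding cover_exponents_0 by blast
next
  assume "\<exists>a C. a \<in> exponents (verts G) \<and> vertex_cover G C \<and> m = a + set_exponent C"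
  then obtain a C where "a \<in> cover_exponents G 0" "vertex_cover G C" "m = a + set_exponent C"
    unfolding cover_exponents_0 by blast
  then show "m \<in> cover_exponents G 1"
    unfolding One_nat_def using cover_exponents_add_cover[OF G] by blast
qed

lemma cover_exponents_Suc:
  assumes G: "finite_simple_graph G"
  shows "cover_exponents G (Suc n) = {a + b |a b. a \<in> cover_exponents G n \<and> b \<in> cover_exponents G 1}"
proof (intro equalityI subsetI)
  fix m assume "m \<in> cover_exponents G (Suc n)"
  then obtain a C where aC: "a \<in> cover_exponents G n" "vertex_cover G C" "m = a + set_exponent C"
    by (rule cover_exponents_Suc_obtain[OF G])
  have "set_exponent C \<in> cover_exponents G 1"
    unfolding cover_exponents_1_iff[OF G]
    using aC by (intro exI[of _ 0] exI[of _ C]) (simp add: exponents_def)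
  then show "m \<in> {a + b |a b. a \<in> cover_exponents G n \<and> b \<in> cover_exponents G 1}" using aC by blast
next
  fix m assume "m \<in> {a + b |a b. a \<in> cover_exponents G n \<and> b \<in> cover_exponents G 1}"
  then obtain a b where ab: "m = a + b" "a \<in> cover_exponents G n" "b \<in> cover_exponents G 1" by blast
  then obtain c C where c: "c \<in> exponents (verts G)" "vertex_cover G C" "b = c + set_exponent C"
    using cover_exponents_1_iff[OF G] by blast
  have "c + a \<in> cover_exponents G n"
    using upward_closed_cover_exponents[of G n] ab(2) c(1) unfolding upward_closed_def by blast
  then have "(c + a) + set_exponent C \<in> cover_exponents G (Suc n)"
    by (rule cover_exponents_add_cover[OF G]) (rule c)
  then show "m \<in> cover_exponents G (Suc n)" by (simp only: ab c ac_simps)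
qed

lemma cover_ideal_eq_monomial_ideal:
  assumes G: "finite_simple_graph G"
  shows "(cover_ideal G :: ('v, 'k::field) mpoly set) = monomial_ideal (verts G) (cover_exponents G 1)"
proof -
  let ?R = "mpoly_ring (verts G) :: ('v, 'k) mpoly ring"
  let ?S = "{\<Prod>v\<in>C. Var v |C. vertex_cover G C} :: ('v, 'k) mpoly set"
  let ?M = "monomial_ideal (verts G) (cover_exponents G 1) :: ('v, 'k) mpoly set"
  interpret cring ?R by (rule cring_mpoly_ring)
  have gens: "?S = (\<lambda>C. Poly_Mapping.single (set_exponent C) 1) ` {C. vertex_cover G C}"
    unfolding setcompr_eq_image by (rule image_cong) (simp_all add: prod_Var finite_vertex_cover[OF G])
  have cover: "set_exponent C \<in> cover_exponents G 1 \<and> set_exponent C \<in> exponents (verts G)"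
    if C: "vertex_cover G C" for C
  proof
    show "set_exponent C \<in> cover_exponents G 1"
      unfolding cover_exponents_1_iff[OF G]
      using C by (intro exI[of _ 0] exI[of _ C]) (simp add: exponents_def)
    then show "set_exponent C \<in> exponents (verts G)" by (simp add: cover_exponents_def)
  qed
  have S: "?S \<subseteq> carrier ?R" and sub: "?S \<subseteq> ?M"
    unfolding gens using cover by (simp_all add: image_subset_iff mpoly_ring_simps)
  have "genideal ?R ?S \<subseteq> ?M"
    by (rule genideal_minimal[OF ideal_monomial_ideal[OF upward_closed_cover_exponents] sub])
  moreover have "?M \<subseteq> genideal ?R ?S"
  proof
    interpret J: ideal "genideal ?R ?S" ?R by (rule genideal_ideal[OF S])
    fix p :: "('v, 'k) mpoly" assume p: "p \<in> ?M"
    show "p \<in> genideal ?R ?S"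
    proof (rule mpoly_mem_by_monomials)
      show "0 \<in> genideal ?R ?S" using J.zero_closed by (simp add: mpoly_ring_simps)
      show "q + r \<in> genideal ?R ?S" if "q \<in> genideal ?R ?S" "r \<in> genideal ?R ?S" for q r
        using J.a_closed[OF that] by (simp add: mpoly_ring_simps)
      fix m assume "m \<in> Poly_Mapping.keys p"
      then have "m \<in> cover_exponents G 1" using p unfolding monomial_ideal_def by blast
      then obtain a C where aC: "a \<in> exponents (verts G)" "vertex_cover G C" "m = a + set_exponent C"
        using cover_exponents_1_iff[OF G] by blast
      have "Poly_Mapping.single (set_exponent C) 1 \<in> ?S" unfolding gens using aC by blast
      then have "Poly_Mapping.single (set_exponent C) 1 \<in> genideal ?R ?S"
        using genideal_self[OF S] by blast
      moreover have "Poly_Mapping.single a (Poly_Mapping.lookup p m) \<in> carrier ?R"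
        using aC by (simp add: mpoly_ring_simps)
      ultimately have "Poly_Mapping.single a (Poly_Mapping.lookup p m) *
          Poly_Mapping.single (set_exponent C) 1 \<in> genideal ?R ?S"
        using J.I_l_closed unfolding mpoly_ring_simps(2) by blast
      then show "Poly_Mapping.single m (Poly_Mapping.lookup p m) \<in> genideal ?R ?S"
        by (simp add: mult_single aC)
    qed
  qed
  ultimately show ?thesis unfolding cover_ideal_def by blast
qed

lemma cover_ideal_power:
  assumes G: "finite_simple_graph G"
  shows "(cover_ideal G :: ('v, 'k::field) mpoly set) [^]\<^bsub>ideals_set (mpoly_ring (verts G))\<^esub> (n::nat) =
    monomial_ideal (verts G) (cover_exponents G n)"
proof (induction n)
  case 0
  show ?case
    by (auto simp: nat_pow_def ideals_set_def cover_exponents_0 monomial_ideal_def mpoly_ring_simps)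
next
  case (Suc n)
  have "(cover_ideal G :: ('v, 'k) mpoly set) [^]\<^bsub>ideals_set (mpoly_ring (verts G))\<^esub> Suc n =
     ideal_prod (mpoly_ring (verts G)) (cover_ideal G [^]\<^bsub>ideals_set (mpoly_ring (verts G))\<^esub> n) (cover_ideal G)"
    by (simp add: nat_pow_def ideals_set_def)
  also have "\<dots> = monomial_ideal (verts G) (cover_exponents G (Suc n))"
    unfolding Suc.IH unfolding cover_ideal_eq_monomial_ideal[OF G] cover_exponents_Suc[OF G]
    by (rule ideal_prod_monomial_ideal) (rule upward_closed_cover_exponents)+
  finally show ?case .
qed

text \<open>The exponent \<open>m\<close> with \<open>m v = n - b v\<close> turns the demand \<open>b\<close> into a monomial. Multiplying this monomial by a variable
  lowers one demand by one, so the annihilator is generated by the support of \<open>b\<close> exactly when \<open>b\<close> is critical.\<close>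

theorem Ass_power_cover_ideal:
  fixes G :: "'v::linorder graph"
  assumes G: "finite_simple_graph G"
  shows "Ass_power (mpoly_ring (verts G)) (cover_ideal G :: ('v, 'k::field) mpoly set) n =
    {variable_prime (verts G) W |W. W \<subseteq> verts G \<and> critical G n W}"
proof -
  let ?V = "verts G"
  let ?U = "cover_exponents G n"
  let ?R = "mpoly_ring ?V :: ('v, 'k) mpoly ring"
  let ?I = "monomial_ideal ?V ?U :: ('v, 'k) mpoly set"
  interpret cring ?R by (rule cring_mpoly_ring)
  have up: "upward_closed ?V ?U" by (rule upward_closed_cover_exponents)
  have fin: "finite ?V" using G by (simp add: finite_simple_graph_def)
  have Ass: "Ass_power ?R (cover_ideal G) n =
    {P. primeideal P ?R \<and> (\<exists>f\<in>carrier ?R. P = {r \<in> carrier ?R. r * f \<in> ?I})}"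
    unfolding Ass_power_def cover_ideal_power[OF G]
    by (subst Ass_quotient_module[OF ideal_monomial_ideal[OF up]]) (simp only: mpoly_ring_simps(2))
  show ?thesis
  proof (intro equalityI subsetI)
    fix P assume "P \<in> Ass_power ?R (cover_ideal G) n"
    then obtain f where prime: "primeideal P ?R" and f: "f \<in> carrier ?R"
      and P: "P = {r \<in> carrier ?R. r * f \<in> ?I}"
      unfolding Ass by blast
    obtain m W where m: "m \<in> exponents ?V" and W: "W \<subseteq> ?V"
      and PW: "P = variable_prime ?V W" and Pm: "P = colon_monomial ?V ?U m"
      by (rule colon_prime_is_variable_prime[OF fin up prime f P])
    have mem: "k + m \<in> ?U \<longleftrightarrow> Poly_Mapping.keys k \<inter> W \<noteq> {}" if k: "k \<in> exponents ?V" for k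
    proof -
      have "(Poly_Mapping.single k 1 :: ('v, 'k) mpoly) \<in> variable_prime ?V W \<longleftrightarrow>
          (Poly_Mapping.single k 1 :: ('v, 'k) mpoly) \<in> colon_monomial ?V ?U m"
        using PW Pm by simp
      then show ?thesis
        using k by (simp add: variable_prime_def colon_monomial_def mpoly_ring_simps)
    qed
    define b where "b v = (if v \<in> W then n - Poly_Mapping.lookup m v else 0)" for v
    have not_col: "\<not> multicolorable G n b"
    proof
      \<comment> \<open>multiplying by high powers of the variables outside \<open>W\<close> removes their demand\<close>
      define k where "k = (\<Sum>v\<in>?V - W. Poly_Mapping.single v n)"
      have k: "Poly_Mapping.lookup k v = (if v \<in> ?V - W then n else 0)" for v
        using fin by (simp add: k_def lookup_sum lookup_single when_def)
      then have "k \<in> exponents ?V" "Poly_Mapping.keys k \<inter> W = {}"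
        by (auto simp: exponents_def in_keys_iff split: if_splits)
      then have "k + m \<notin> ?U" using mem by blast
      moreover assume "multicolorable G n b"
      then have "multicolorable G n (\<lambda>v. n - Poly_Mapping.lookup (k + m) v)"
        by (rule multicolorable_mono) (use k in \<open>auto simp: b_def lookup_add\<close>)
      ultimately show False
        using m \<open>k \<in> exponents ?V\<close> by (simp add: cover_exponents_def exponents_add_iff)
    qed
    have col: "multicolorable G n (b(v := b v - 1))" if v: "v \<in> W" for v
    proof -
      have "Poly_Mapping.single v 1 + m \<in> ?U"
        using mem[of "Poly_Mapping.single v 1"] v W by (auto simp: exponents_def)
      then have "multicolorable G n (\<lambda>w. n - Poly_Mapping.lookup (Poly_Mapping.single v 1 + m) w)"
        by (simp add: cover_exponents_def)
      then show ?thesis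
        by (rule multicolorable_mono) (auto simp: b_def lookup_add lookup_single when_def)
    qed
    have "b v > 0" if "v \<in> W" for v
    proof (rule ccontr)
      assume "\<not> b v > 0"
      then have "b(v := b v - 1) = b" by auto
      then show False using col[OF that] not_col by simp
    qed
    then have "{v. b v > 0} = W" by (auto simp: b_def split: if_splits)
    moreover have "\<forall>v. b v \<le> n" by (simp add: b_def)
    ultimately have "critical G n W"
      unfolding critical_def by (intro exI[of _ b] conjI ballI not_col col)
    then show "P \<in> {variable_prime ?V W |W. W \<subseteq> ?V \<and> critical G n W}" using PW W by blast
  next
    fix P :: "('v, 'k) mpoly set"
    assume "P \<in> {variable_prime ?V W |W. W \<subseteq> ?V \<and> critical G n W}"
    then obtain W where PW: "P = variable_prime ?V W" and W: "W \<subseteq> ?V" and crit: "critical G n W" by blast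
    from crit obtain b where supp: "{v. b v > 0} = W" and le: "\<forall>v. b v \<le> n"
      and not_col: "\<not> multicolorable G n b"
      and col: "\<forall>v\<in>W. multicolorable G n (b(v := b v - 1))"
      unfolding critical_def by blast
    define m where "m = (\<Sum>v\<in>?V. Poly_Mapping.single v (n - b v))"
    have lookup_m: "Poly_Mapping.lookup m v = (if v \<in> ?V then n - b v else 0)" for v
      using fin by (simp add: m_def lookup_sum lookup_single when_def)
    have m: "m \<in> exponents ?V" by (auto simp: exponents_def in_keys_iff lookup_m split: if_splits)
    have mem: "k + m \<in> ?U \<longleftrightarrow> Poly_Mapping.keys k \<inter> W \<noteq> {}" if k: "k \<in> exponents ?V" for k
    proof -
      have "k + m \<in> ?U \<longleftrightarrow> multicolorable G n (\<lambda>v. b v - Poly_Mapping.lookup k v)"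
      proof -
        have eq: "n - Poly_Mapping.lookup (k + m) v = b v - Poly_Mapping.lookup k v" if "v \<in> ?V" for v
        proof -
          have "b v \<le> n" using le by blast
          then show ?thesis using that by (simp add: lookup_add lookup_m)
        qed
        have "multicolorable G n (\<lambda>v. n - Poly_Mapping.lookup (k + m) v) \<longleftrightarrow>
          multicolorable G n (\<lambda>v. b v - Poly_Mapping.lookup k v)"
          by (rule iffI; erule multicolorable_mono) (simp_all add: eq)
        then show ?thesis using k m by (simp add: cover_exponents_def exponents_add_iff)
      qed
      also have "\<dots> \<longleftrightarrow> Poly_Mapping.keys k \<inter> W \<noteq> {}"
      proof (cases "Poly_Mapping.keys k \<inter> W = {}")
        case True
        have "(\<lambda>v. b v - Poly_Mapping.lookup k v) = b"
        proof
          fix v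
          show "b v - Poly_Mapping.lookup k v = b v"
          proof (cases "v \<in> W")
            case True
            then have "Poly_Mapping.lookup k v = 0"
              using \<open>Poly_Mapping.keys k \<inter> W = {}\<close> by (auto simp: in_keys_iff)
            then show ?thesis by simp
          next
            case False
            then have "b v = 0" using supp by auto
            then show ?thesis by simp
          qed
        qed
        then show ?thesis using not_col True by simp
      next
        case False
        then obtain v where v: "v \<in> Poly_Mapping.keys k" "v \<in> W" by blast
        then have "multicolorable G n (b(v := b v - 1))" using col by blast
        then have "multicolorable G n (\<lambda>v. b v - Poly_Mapping.lookup k v)"
          by (rule multicolorable_mono) (use v in \<open>auto simp: in_keys_iff\<close>)
        then show ?thesis using False by simp
      qed
      finally show ?thesis .
    qed
    have "P = colon_monomial ?V ?U m"
      unfolding PW variable_prime_def monomial_ideal_def colon_monomial_def mpoly_ring_simps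
      using mem by blast
    then have "P = {r \<in> carrier ?R. r * Poly_Mapping.single m 1 \<in> ?I}"
      using colon_monomial_eq[OF up m] by blast
    moreover have "Poly_Mapping.single m 1 \<in> carrier ?R" using m by (simp add: mpoly_ring_simps)
    moreover have "primeideal P ?R" unfolding PW by (rule variable_prime_is_primeideal)
    ultimately show "P \<in> Ass_power ?R (cover_ideal G) n" unfolding Ass by blast
  qed
qed

section \<open>Multicolourings by stable sets\<close>

definition stable_set :: "'v graph \<Rightarrow> 'v set \<Rightarrow> bool" where
  "stable_set G I \<longleftrightarrow> (\<forall>u v. {u, v} \<in> edges G \<longrightarrow> \<not> (u \<in> I \<and> v \<in> I))"

lemma stable_subset: "stable_set G I \<Longrightarrow> J \<subseteq> I \<Longrightarrow> stable_set G J"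
  unfolding stable_set_def by blast

lemma multicolorableI:
  assumes "\<And>v. v \<in> verts G \<Longrightarrow> A v \<subseteq> {..<n}" "\<And>v. v \<in> verts G \<Longrightarrow> b v \<le> card (A v)"
    and "\<And>u v. {u, v} \<in> edges G \<Longrightarrow> A u \<inter> A v = {}"
  shows "multicolorable G n b"
  unfolding multicolorable_def by (rule exI[of _ A]) (use assms in simp)

text \<open>Superfluous colours can be dropped, so that the demand is met exactly.\<close>

lemma multicolorable_obtain:
  assumes G: "finite_simple_graph G" and col: "multicolorable G n b"
  obtains A where "\<And>v. A v \<subseteq> {..<n}" "\<And>v. v \<in> verts G \<Longrightarrow> card (A v) = b v"
    "\<And>v. v \<notin> verts G \<Longrightarrow> A v = {}" "\<And>c. stable_set G {v. c \<in> A v}"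
proof -
  obtain B where B: "\<forall>v\<in>verts G. B v \<subseteq> {..<n} \<and> b v \<le> card (B v)"
    and disj: "\<forall>u v. {u, v} \<in> edges G \<longrightarrow> B u \<inter> B v = {}"
    using col unfolding multicolorable_def by (elim exE conjE)
  have "\<forall>v. \<exists>S. v \<in> verts G \<longrightarrow> S \<subseteq> B v \<and> card S = b v"
    using B by (meson obtain_subset_with_card_n)
  then obtain A' where A': "\<And>v. v \<in> verts G \<Longrightarrow> A' v \<subseteq> B v \<and> card (A' v) = b v"
    by metis
  define A where "A v = (if v \<in> verts G then A' v else {})" for v
  have "stable_set G {v. c \<in> A v}" for c
    unfolding stable_set_def
  proof (intro allI impI notI)
    fix u v assume e: "{u, v} \<in> edges G" and c: "u \<in> {v. c \<in> A v} \<and> v \<in> {v. c \<in> A v}"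
    have "{u, v} \<subseteq> verts G" using e G unfolding finite_simple_graph_def by blast
    then have "c \<in> B u" "c \<in> B v" using c A' by (auto simp: A_def)
    then show False using disj e by blast
  qed
  moreover have "A v \<subseteq> {..<n}" for v using A'[of v] B by (auto simp: A_def)
  ultimately show ?thesis using A' by (intro that[of A]) (simp_all add: A_def)
qed

lemma card_eq_sum_indicator: "finite V \<Longrightarrow> I \<subseteq> V \<Longrightarrow> card I = (\<Sum>v\<in>V. if v \<in> I then 1 else 0)"
  by (simp add: sum.If_cases Int_absorb1 Int_absorb2)

lemma color_double_count:
  assumes "finite W" "\<And>v. A v \<subseteq> {..<n::nat}"
  shows "(\<Sum>v\<in>W. card (A v)) = (\<Sum>c<n. card {v\<in>W. c \<in> A v})"
proof -
  have "(\<Sum>v\<in>W. card (A v)) = (\<Sum>v\<in>W. \<Sum>c<n. if c \<in> A v then 1 else 0)"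
    by (intro sum.cong refl card_eq_sum_indicator) (use assms in auto)
  also have "\<dots> = (\<Sum>c<n. \<Sum>v\<in>W. if v \<in> {v\<in>W. c \<in> A v} then 1 else 0)"
    by (subst sum.swap) simp
  also have "\<dots> = (\<Sum>c<n. card {v\<in>W. c \<in> A v})"
    using assms by (intro sum.cong refl card_eq_sum_indicator[symmetric]) auto
  finally show ?thesis .
qed

text \<open>Each colour class is a stable set, and so accounts for at most \<open>k\<close> units of the demand in \<open>W\<close>.\<close>

lemma multicolorable_sum_le:
  assumes G: "finite_simple_graph G" and W: "W \<subseteq> verts G"
    and alpha: "\<And>I. I \<subseteq> W \<Longrightarrow> stable_set G I \<Longrightarrow> card I \<le> k" and col: "multicolorable G n b"
  shows "(\<Sum>v\<in>W. b v) \<le> n * k"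
proof -
  obtain A where A: "\<And>v. A v \<subseteq> {..<n}" "\<And>v. v \<in> verts G \<Longrightarrow> card (A v) = b v"
    "\<And>v. v \<notin> verts G \<Longrightarrow> A v = {}" "\<And>c. stable_set G {v. c \<in> A v}"
    using multicolorable_obtain[OF G col] by metis
  have fin: "finite W" using G W finite_subset by (auto simp: finite_simple_graph_def)
  have "(\<Sum>v\<in>W. b v) = (\<Sum>v\<in>W. card (A v))" using A(2) W by (intro sum.cong) auto
  also have "\<dots> = (\<Sum>c<n. card {v\<in>W. c \<in> A v})" by (rule color_double_count[OF fin A(1)])
  also have "\<dots> \<le> (\<Sum>c<n. k)"
    by (intro sum_mono alpha stable_subset[OF A(4)]) auto
  finally show ?thesis by simp
qed

lemma multicolorable_add:
  assumes "multicolorable G n b" "multicolorable G m c"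
  shows "multicolorable G (n + m) (\<lambda>v. b v + c v)"
proof -
  obtain A where A: "\<forall>v\<in>verts G. A v \<subseteq> {..<n} \<and> b v \<le> card (A v)"
    and dA: "\<forall>u v. {u, v} \<in> edges G \<longrightarrow> A u \<inter> A v = {}"
    using assms(1) unfolding multicolorable_def by (elim exE conjE)
  obtain B where B: "\<forall>v\<in>verts G. B v \<subseteq> {..<m} \<and> c v \<le> card (B v)"
    and dB: "\<forall>u v. {u, v} \<in> edges G \<longrightarrow> B u \<inter> B v = {}"
    using assms(2) unfolding multicolorable_def by (elim exE conjE)
  define C where "C v = A v \<inter> {..<n} \<union> (+) n ` B v" for v
  show ?thesis
  proof (rule multicolorableI[where A = C])
    fix v assume v: "v \<in> verts G"
    have Av: "A v \<subseteq> {..<n}" "b v \<le> card (A v)" and Bv: "B v \<subseteq> {..<m}" "c v \<le> card (B v)"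
      using A B v by auto
    have AC: "C v = A v \<union> (+) n ` B v" using Av by (auto simp: C_def)
    show "C v \<subseteq> {..<n + m}" using Av Bv by (auto simp: AC)
    have "card (C v) = card (A v) + card ((+) n ` B v)"
      unfolding AC using Av Bv finite_subset[OF Av(1)] finite_subset[OF Bv(1)]
      by (intro card_Un_disjoint) auto
    also have "card ((+) n ` B v) = card (B v)" by (rule card_image) (simp add: inj_on_def)
    finally show "b v + c v \<le> card (C v)" using Av Bv by simp
  next
    fix u v assume e: "{u, v} \<in> edges G"
    have "A u \<inter> A v = {}" "B u \<inter> B v = {}" using dA dB e by blast+
    then show "C u \<inter> C v = {}" by (auto simp: C_def)
  qed
qed

lemma multicolorable_stable:
  assumes "stable_set G I"
  shows "multicolorable G 1 (\<lambda>v. if v \<in> I then 1 else 0)"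
  by (rule multicolorableI[where A = "\<lambda>v. if v \<in> I then {0} else {}"]) (use assms in \<open>auto simp: stable_set_def\<close>)

lemma multicolorable_zero: "multicolorable G n (\<lambda>v. 0)"
  by (rule multicolorableI[where A = "\<lambda>v. {}"]) auto

lemma multicolorable_scale:
  assumes "stable_set G I"
  shows "multicolorable G m (\<lambda>v. if v \<in> I then m else 0)"
proof (induction m)
  case 0
  then show ?case using multicolorable_zero by (rule multicolorable_mono) auto
next
  case (Suc m)
  show ?case using multicolorable_add[OF Suc multicolorable_stable[OF assms]]
    unfolding Suc_eq_plus1 by (rule multicolorable_mono) auto
qed

lemma multicolorable_sum:
  assumes "finite F" "\<And>y. y \<in> F \<Longrightarrow> stable_set G (Y y)"
  shows "multicolorable G (card F) (\<lambda>v. \<Sum>y\<in>F. if v \<in> Y y then 1 else 0)"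
  using assms
proof (induction F rule: finite_induct)
  case empty
  then show ?case using multicolorable_zero by simp
next
  case (insert y F)
  have "multicolorable G (1 + card F) (\<lambda>v. (if v \<in> Y y then 1 else 0) + (\<Sum>y\<in>F. if v \<in> Y y then 1 else 0))"
    by (rule multicolorable_add[OF multicolorable_stable]) (use insert in auto)
  then show ?case using insert by simp
qed

text \<open>The distance from position \<open>j\<close> to position \<open>r\<close> in positive direction on a cycle with positions \<open>0, ..., 2k\<close>.\<close>

definition offset :: "nat \<Rightarrow> nat \<Rightarrow> nat \<Rightarrow> nat" where
  "offset k j r = (if j \<le> r then r - j else r + (2 * k + 1) - j)"

definition cyclic_neighbours :: "nat \<Rightarrow> nat \<Rightarrow> nat \<Rightarrow> bool" where
  "cyclic_neighbours k r s \<longleftrightarrow> r = s + 1 \<or> s = r + 1 \<or> r = 0 \<and> s = 2 * k \<or> s = 0 \<and> r = 2 * k"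

lemma offset_cyclic_neighbours:
  assumes "cyclic_neighbours k r s" "r \<le> 2 * k" "s \<le> 2 * k" "j \<le> 2 * k" "k \<ge> 1"
  shows "cyclic_neighbours k (offset k j r) (offset k j s)"
  using assms unfolding cyclic_neighbours_def offset_def by (auto split: if_splits)

lemma bij_betw_offset:
  assumes "j \<le> 2 * k"
  shows "bij_betw (offset k j) {..2 * k} {..2 * k}"
proof -
  have "offset k j ` {..2 * k} = {..2 * k}"
  proof (intro equalityI subsetI)
    fix s assume "s \<in> {..2 * k}"
    then have "s = offset k j (if s + j \<le> 2 * k then s + j else s + j - (2 * k + 1))"
      "(if s + j \<le> 2 * k then s + j else s + j - (2 * k + 1)) \<in> {..2 * k}"
      using assms by (auto simp: offset_def)
    then show "s \<in> offset k j ` {..2 * k}" by (rule image_eqI)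
  qed (use assms in \<open>auto simp: offset_def\<close>)
  then show ?thesis by (simp add: bij_betw_def eq_card_imp_inj_on)
qed

text \<open>Here \<open>R\<close> is an odd hole, with vertices placed around it by \<open>\<rho>\<close>, and each vertex of \<open>F\<close> sees at most four consecutive
  vertices of \<open>R\<close>. The demand sums to \<open>n k + 1\<close>, one more than \<open>n\<close> stable sets can cover. If a unit is
  removed at a vertex of the hole, the remaining path splits into two stable sets. If it is removed at
  \<open>y \<in> F\<close>, then the hole together with the rest of the stable set of \<open>y\<close> has demand two at the positions
  \<open>4, 6, ..., 2k\<close> counted from the neighbours of \<open>y\<close>, and one elsewhere; three stable sets cover this.\<close>

lemma odd_hole_critical:
  fixes G :: "'v graph"
  assumes G: "finite_simple_graph G" and RF: "R \<union> F \<subseteq> verts G" "R \<inter> F = {}" and k: "k \<ge> 2"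
    and rank: "bij_betw \<rho> R {..2 * k}"
    and R_edge: "\<And>u v. u \<in> R \<Longrightarrow> v \<in> R \<Longrightarrow> {u, v} \<in> edges G \<Longrightarrow> cyclic_neighbours k (\<rho> u) (\<rho> v)"
    and F_edge: "\<And>y. y \<in> F \<Longrightarrow>
      \<exists>j\<le>2 * k. \<forall>v\<in>R. {y, v} \<in> edges G \<longrightarrow> offset k j (\<rho> v) \<le> 3"
    and alpha: "\<And>I. I \<subseteq> R \<union> F \<Longrightarrow> stable_set G I \<Longrightarrow> card I \<le> k"
    and n: "n \<ge> 2 + card F"
  shows "critical G n (R \<union> F)"
proof -
  have fin: "finite R" "finite F"
    using G RF finite_subset by (auto simp: finite_simple_graph_def)
  have loop: "{v, v} \<notin> edges G" for v using G by (auto simp: finite_simple_graph_def)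
  have \<rho>: "\<rho> v \<le> 2 * k" if "v \<in> R" for v using rank that by (auto simp: bij_betw_def)
  have pos: "bij_betw (\<lambda>v. offset k j (\<rho> v)) R {..2 * k}" if "j \<le> 2 * k" for j
    using bij_betw_trans[OF rank bij_betw_offset[OF that]] by (simp add: comp_def)
  have card_pos: "card {v \<in> R. offset k j (\<rho> v) \<in> T} = card T" if "j \<le> 2 * k" "T \<subseteq> {..2 * k}" for j T
  proof -
    have "bij_betw (\<lambda>v. offset k j (\<rho> v)) {v \<in> R. offset k j (\<rho> v) \<in> T} T"
      using pos[OF that(1)] that(2) unfolding bij_betw_def
      by (auto simp: inj_on_def image_def) (smt (verit) mem_Collect_eq subset_iff)
    then show ?thesis by (rule bij_betw_same_card)
  qed
  have stable_pos: "stable_set G {v \<in> R. offset k j (\<rho> v) \<in> T}"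
    if j: "j \<le> 2 * k" and T: "\<And>r s. r \<in> T \<Longrightarrow> s \<in> T \<Longrightarrow> \<not> cyclic_neighbours k r s" for j T
    unfolding stable_set_def
  proof (intro allI impI notI)
    fix u v assume "{u, v} \<in> edges G"
      and uv: "u \<in> {v \<in> R. offset k j (\<rho> v) \<in> T} \<and> v \<in> {v \<in> R. offset k j (\<rho> v) \<in> T}"
    then have "cyclic_neighbours k (offset k j (\<rho> u)) (offset k j (\<rho> v))"
      using offset_cyclic_neighbours[OF R_edge \<rho> \<rho> j] k by simp
    then show False using T uv by blast
  qed
  have "\<forall>y\<in>F. \<exists>j\<le>2 * k. \<forall>v\<in>R. {y, v} \<in> edges G \<longrightarrow> offset k j (\<rho> v) \<le> 3" using F_edge by blast
  then obtain base where base: "\<And>y. y \<in> F \<Longrightarrow> base y \<le> 2 * k"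
    and base_edge: "\<And>y v. y \<in> F \<Longrightarrow> v \<in> R \<Longrightarrow> {y, v} \<in> edges G \<Longrightarrow> offset k (base y) (\<rho> v) \<le> 3"
    by metis
  define T where "T = {r. even r \<and> 4 \<le> r \<and> r \<le> 2 * k}"
  define far where "far y = {v \<in> R. offset k (base y) (\<rho> v) \<in> T}" for y
  define Y where "Y y = insert y (far y)" for y
  define Z where "Z = {v \<in> R. offset k 0 (\<rho> v) \<in> {r. odd r \<and> r \<le> 2 * k}}"
  define ones where "ones S v = (if v \<in> S then 1 else 0 :: nat)" for S :: "'v set" and v
  define m where "m = n - 2 - card F"
  define b where "b v = ones R v + (\<Sum>y\<in>F. ones (Y y) v) + (if v \<in> Z then m else 0)" for v
  have card_odd: "card {r. odd r \<and> r \<le> 2 * k} = k"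
  proof -
    have "{r. odd r \<and> r \<le> 2 * k} = (\<lambda>i. 2 * i + 1) ` {..<k}" by (auto elim!: oddE)
    then show ?thesis by (simp add: card_image inj_on_def)
  qed
  have card_T: "card T = k - 1"
  proof -
    have "T = (\<lambda>i. 2 * i) ` {2..k}" by (auto simp: T_def elim!: evenE)
    then show ?thesis by (simp add: card_image inj_on_def)
  qed
  have stable_Z: "stable_set G Z"
    unfolding Z_def by (rule stable_pos) (use k in \<open>auto simp: cyclic_neighbours_def\<close>)
  have stable_far: "stable_set G (far y)" if "y \<in> F" for y
    unfolding far_def by (rule stable_pos[OF base[OF that]]) (auto simp: T_def cyclic_neighbours_def)
  have stable_Y: "stable_set G (Y y)" if y: "y \<in> F" for y
    unfolding stable_set_def
  proof (intro allI impI notI)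
    fix u v assume e: "{u, v} \<in> edges G" and uv: "u \<in> Y y \<and> v \<in> Y y"
    have far_edge: "{y, w} \<notin> edges G" if "w \<in> far y" for w
      using base_edge[OF y, of w] that by (auto simp: far_def T_def)
    show False
      using e uv loop far_edge[of u] far_edge[of v] stable_far[OF y]
      by (auto simp: Y_def stable_set_def insert_commute)
  qed
  have card_Y: "card (Y y) = k" if y: "y \<in> F" for y
  proof -
    have "card (far y) = k - 1" unfolding far_def using card_pos[OF base[OF y], of T] card_T by (auto simp: T_def)
    moreover have "y \<notin> far y" "finite (far y)" using y RF fin by (auto simp: far_def)
    ultimately show ?thesis using k by (simp add: Y_def)
  qed
  have card_Z: "card Z = k" unfolding Z_def using card_pos[of 0 "{r. odd r \<and> r \<le> 2 * k}"] card_odd by auto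
  have card_R: "card R = 2 * k + 1" using bij_betw_same_card[OF rank] by simp
  have sub: "Z \<subseteq> R" "\<And>y. y \<in> F \<Longrightarrow> Y y \<subseteq> R \<union> F" "\<And>y. far y \<subseteq> R" by (auto simp: Z_def Y_def far_def)
  have sum_ones: "(\<Sum>v\<in>R \<union> F. ones S v) = card S" if "S \<subseteq> R \<union> F" for S
    unfolding ones_def using fin that by (intro card_eq_sum_indicator[symmetric]) auto
  have total: "(\<Sum>v\<in>R \<union> F. b v) = n * k + 1"
  proof -
    have "(\<Sum>v\<in>R \<union> F. b v) = card R + (\<Sum>y\<in>F. card (Y y)) + m * card Z"
    proof -
      have "(\<Sum>v\<in>R \<union> F. \<Sum>y\<in>F. ones (Y y) v) = (\<Sum>y\<in>F. card (Y y))"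
        by (subst sum.swap) (intro sum.cong refl sum_ones sub)
      moreover have "(\<Sum>v\<in>R \<union> F. if v \<in> Z then m else 0) = m * card Z"
      proof -
        have "(\<Sum>v\<in>R \<union> F. if v \<in> Z then m else 0) = (\<Sum>v\<in>R \<union> F. m * ones Z v)"
          by (intro sum.cong) (auto simp: ones_def)
        also have "\<dots> = m * card Z" unfolding sum_distrib_left[symmetric] using sub by (subst sum_ones) auto
        finally show ?thesis .
      qed
      ultimately show ?thesis by (simp add: b_def sum.distrib sum_ones)
    qed
    also have "\<dots> = 2 * k + 1 + card F * k + m * k" by (simp add: card_R card_Y card_Z)
    also have "\<dots> = n * k + 1"
    proof -
      have "n = 2 + card F + m" using n by (simp add: m_def)
      then show ?thesis by (simp add: algebra_simps)
    qed
    finally show ?thesis .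
  qed
  have supp: "{v. b v > 0} = R \<union> F"
  proof (intro equalityI subsetI)
    fix v assume "v \<in> {v. b v > 0}"
    then show "v \<in> R \<union> F"
    proof (rule contrapos_pp)
      assume v: "v \<notin> R \<union> F"
      then have "(\<Sum>y\<in>F. ones (Y y) v) = 0" using sub by (intro sum.neutral) (auto simp: ones_def)
      then show "v \<notin> {v. b v > 0}" using v sub by (auto simp: b_def ones_def)
    qed
  next
    fix v assume v: "v \<in> R \<union> F"
    show "v \<in> {v. b v > 0}"
    proof (cases "v \<in> R")
      case False
      then have "v \<in> F" using v by blast
      then have "ones (Y v) v \<le> (\<Sum>y\<in>F. ones (Y y) v)" using fin by (intro member_le_sum) auto
      then show ?thesis by (simp add: b_def ones_def Y_def)
    qed (simp add: b_def ones_def)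
  qed
  have le: "b v \<le> n" for v
  proof -
    have "(\<Sum>y\<in>F. ones (Y y) v) \<le> (\<Sum>y\<in>F. 1)" by (intro sum_mono) (simp add: ones_def)
    then show ?thesis using n by (auto simp: b_def ones_def m_def)
  qed
  have not_col: "\<not> multicolorable G n b"
    using multicolorable_sum_le[OF G RF(1) alpha, of n b] total by auto
  have col_ones: "multicolorable G 1 (ones I)" if "stable_set G I" for I
    unfolding ones_def by (rule multicolorable_stable[OF that])
  have col_F: "multicolorable G (card F') (\<lambda>v. \<Sum>y\<in>F'. ones (Y y) v)" if "F' \<subseteq> F" for F'
    unfolding ones_def by (rule multicolorable_sum) (use that fin finite_subset stable_Y in auto)
  have col: "multicolorable G n (b(v := b v - 1))" if v: "v \<in> R \<union> F" for v
  proof (cases "v \<in> R")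
    case True
    define O1 where "O1 = {w \<in> R. offset k (\<rho> v) (\<rho> w) \<in> {r. odd r \<and> r \<le> 2 * k}}"
    define E1 where "E1 = {w \<in> R. offset k (\<rho> v) (\<rho> w) \<in> {r. even r \<and> 2 \<le> r \<and> r \<le> 2 * k}}"
    have "stable_set G O1" "stable_set G E1"
      unfolding O1_def E1_def by (rule stable_pos[OF \<rho>[OF True]]; use k in \<open>auto simp: cyclic_neighbours_def\<close>)+
    then have col_n: "multicolorable G (((1 + 1) + card F) + m)
        (\<lambda>w. ((ones O1 w + ones E1 w) + (\<Sum>y\<in>F. ones (Y y) w)) + (if w \<in> Z then m else 0))"
      by (intro multicolorable_add col_ones col_F order_refl multicolorable_scale stable_Z)
    have n_eq: "((1 + 1) + card F) + m = n" using n by (simp add: m_def)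
    have split: "(ones R w - (if w = v then 1 else 0)) \<le> ones O1 w + ones E1 w" for w
    proof (cases "w \<in> R \<and> w \<noteq> v")
      case w: True
      have "offset k (\<rho> v) (\<rho> w) \<noteq> offset k (\<rho> v) (\<rho> v)"
        using pos[OF \<rho>[OF True]] True w by (auto simp: bij_betw_def inj_on_def)
      then have "offset k (\<rho> v) (\<rho> w) \<noteq> 0" by (simp add: offset_def)
      moreover have "offset k (\<rho> v) (\<rho> w) \<le> 2 * k" using pos[OF \<rho>[OF True]] w by (auto simp: bij_betw_def)
      ultimately have "w \<in> O1 \<or> w \<in> E1" using w by (auto simp: O1_def E1_def)
      then show ?thesis by (auto simp: ones_def)
    qed (auto simp: ones_def)
    have "(b(v := b v - 1)) w \<le> ((ones O1 w + ones E1 w) + (\<Sum>y\<in>F. ones (Y y) w)) + (if w \<in> Z then m else 0)" for w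
    proof (cases "w = v")
      case w: True
      have "ones R v = 1" using True by (simp add: ones_def)
      then show ?thesis by (simp add: b_def w)
    qed (use split[of w] in \<open>simp add: b_def\<close>)
    then show ?thesis by (rule multicolorable_mono[OF col_n[unfolded n_eq]])
  next
    case False
    then have vF: "v \<in> F" using v by blast
    note j = base[OF vF]
    \<comment> \<open>three stable sets for the hole and the far positions: the latter are covered twice, by \<open>T1\<close> and \<open>T2\<close>\<close>
    define T1 where "T1 = insert 1 T"
    define T2 where "T2 = insert 2 T"
    define T3 where "T3 = insert 0 {r. odd r \<and> 3 \<le> r \<and> r \<le> 2 * k}"
    define C where "C T' = {w \<in> R. offset k (base v) (\<rho> w) \<in> T'}" for T'
    have "stable_set G (C T1)" "stable_set G (C T2)" "stable_set G (C T3)"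
      unfolding C_def
      by (rule stable_pos[OF j]; use k in \<open>auto simp: T_def T1_def T2_def T3_def cyclic_neighbours_def\<close>)+
    then have col_n: "multicolorable G ((((1 + 1) + 1) + card (F - {v})) + m)
        (\<lambda>w. (((ones (C T1) w + ones (C T2) w) + ones (C T3) w) + (\<Sum>y\<in>F - {v}. ones (Y y) w)) + (if w \<in> Z then m else 0))"
      by (intro multicolorable_add col_ones col_F Diff_subset multicolorable_scale stable_Z)
    have n_eq: "(((1 + 1) + 1) + card (F - {v})) + m = n"
    proof -
      have "card F > 0" using vF fin by (auto simp: card_gt_0_iff)
      then show ?thesis using n vF by (simp add: m_def card_Diff_singleton)
    qed
    have "(b(v := b v - 1)) w \<le>
        (((ones (C T1) w + ones (C T2) w) + ones (C T3) w) + (\<Sum>y\<in>F - {v}. ones (Y y) w)) + (if w \<in> Z then m else 0)" for w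
    proof -
      have split: "(\<Sum>y\<in>F. ones (Y y) w) = ones (Y v) w + (\<Sum>y\<in>F - {v}. ones (Y y) w)"
        using fin vF by (simp add: sum.remove)
      have "ones R w + ones (far v) w \<le> ones (C T1) w + ones (C T2) w + ones (C T3) w"
      proof (cases "w \<in> R")
        case w: True
        define r where "r = offset k (base v) (\<rho> w)"
        have r: "r \<le> 2 * k" using pos[OF j] w by (auto simp: bij_betw_def r_def)
        have "w \<in> far v \<longleftrightarrow> r \<in> T" "\<And>T'. w \<in> C T' \<longleftrightarrow> r \<in> T'" using w by (auto simp: far_def C_def r_def)
        moreover have "r \<in> T \<or> r = 0 \<or> r = 1 \<or> r = 2 \<or> odd r \<and> 3 \<le> r"
          using r unfolding T_def by simp presburger
        ultimately show ?thesis using w r by (auto simp: ones_def T1_def T2_def T3_def)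
      next
        case w: False
        then have "w \<notin> far v" using sub by blast
        then show ?thesis using w by (simp add: ones_def)
      qed
      moreover have "ones (Y v) w = ones (far v) w + (if w = v then 1 else 0)"
        using False by (auto simp: ones_def Y_def far_def)
      ultimately show ?thesis using split by (cases "w = v") (simp_all add: b_def)
    qed
    then show ?thesis by (rule multicolorable_mono[OF col_n[unfolded n_eq]])
  qed
  show ?thesis
    unfolding critical_def by (intro exI[of _ b] conjI ballI allI supp le not_col col)
qed

lemma multicolorable_disjoint:
  assumes G: "finite_simple_graph G" and K: "finite K"
  shows "multicolorable G (\<Sum>v\<in>K. b v) (\<lambda>v. if v \<in> K then b v else 0)"
  using K
proof (induction K rule: finite_induct)
  case empty
  then show ?case using multicolorable_zero by simp
next
  case (insert x K)
  have "stable_set G {x}" using G by (auto simp: stable_set_def finite_simple_graph_def)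
  from multicolorable_add[OF multicolorable_scale[OF this, of "b x"] insert.IH]
  have "multicolorable G (\<Sum>v\<in>insert x K. b v) (\<lambda>v. (if v \<in> {x} then b x else 0) + (if v \<in> K then b v else 0))"
    using insert by simp
  then show ?case by (rule multicolorable_mono) (use insert in auto)
qed

definition is_clique :: "'v graph \<Rightarrow> 'v set \<Rightarrow> bool" where
  "is_clique G K \<longleftrightarrow> (\<forall>u\<in>K. \<forall>v\<in>K. u \<noteq> v \<longrightarrow> {u, v} \<in> edges G)"

lemma clique_stable_card:
  assumes "is_clique G K" "I \<subseteq> K" "stable_set G I"
  shows "card I \<le> 1"
proof -
  have "u = v" if "u \<in> I" "v \<in> I" for u v
    using assms that unfolding is_clique_def stable_set_def by blast
  then have "I = {} \<or> (\<exists>v. I = {v})" by blast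
  then show ?thesis by auto
qed

lemma clique_sum_le:
  assumes "finite_simple_graph G" "K \<subseteq> verts G" "is_clique G K" "multicolorable G n b"
  shows "(\<Sum>v\<in>K. b v) \<le> n"
  using multicolorable_sum_le[OF assms(1,2) clique_stable_card[OF assms(3)] assms(4)] by simp

text \<open>One vertex gets the demand that raises the total to \<open>n + 1\<close>, the others get demand one.\<close>

lemma clique_critical:
  assumes G: "finite_simple_graph G" and K: "K \<subseteq> verts G" "is_clique G K" "2 \<le> card K" "card K \<le> n + 1"
  shows "critical G n K"
proof -
  have fin: "finite K" using K(3) card.infinite by fastforce
  then obtain v0 where v0: "v0 \<in> K" using K(3) by fastforce
  define b where "b v = (if v = v0 then n + 2 - card K else if v \<in> K then 1 else 0)" for v
  have total: "(\<Sum>v\<in>K. b v) = n + 1"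
  proof -
    have "(\<Sum>v\<in>K. b v) = b v0 + (\<Sum>v\<in>K - {v0}. b v)" using fin v0 by (simp add: sum.remove)
    also have "(\<Sum>v\<in>K - {v0}. b v) = (\<Sum>v\<in>K - {v0}. 1)" by (rule sum.cong) (auto simp: b_def)
    also have "\<dots> = card K - 1" using fin v0 by simp
    finally show ?thesis using K(3,4) by (simp add: b_def)
  qed
  have pos: "0 < b v \<longleftrightarrow> v \<in> K" for v using v0 K(4) by (auto simp: b_def)
  show ?thesis
    unfolding critical_def
  proof (intro exI[of _ b] conjI allI ballI)
    show "{v. 0 < b v} = K" using pos by blast
    show "b v \<le> n" for v using K(3,4) by (auto simp: b_def)
    show "\<not> multicolorable G n b" using clique_sum_le[OF G K(1,2), of n b] total by auto
    fix v assume v: "v \<in> K"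
    let ?b = "b(v := b v - 1)"
    have "(\<Sum>w\<in>K. ?b w) = (b v - 1) + (\<Sum>w\<in>K - {v}. b w)" using fin v by (subst sum.remove[OF fin v]) simp
    moreover have "(\<Sum>w\<in>K. b w) = b v + (\<Sum>w\<in>K - {v}. b w)" by (rule sum.remove[OF fin v])
    ultimately have "(\<Sum>w\<in>K. ?b w) = n" using total pos[of v] v by linarith
    then have "multicolorable G n (\<lambda>w. if w \<in> K then ?b w else 0)" using multicolorable_disjoint[OF G fin, of ?b] by simp
    moreover have "?b w = 0" if "w \<notin> K" for w using that v pos[of w] by auto
    ultimately show "multicolorable G n ?b" by (elim multicolorable_mono) auto
  qed
qed

section \<open>Stable sets of \<open>H\<^sub>t\<close>\<close>

lemma verts_H: "verts (H t) = Xv ` {1..cycle_length t} \<union> Yv ` {1..t}"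
  by (simp add: H_def)

lemma H_edge_XX: "1 \<le> i \<Longrightarrow> i < cycle_length t \<Longrightarrow> {Xv i, Xv (i + 1)} \<in> edges (H t)"
  by (auto simp: H_def)

lemma H_edge_closing: "{Xv (cycle_length t), Xv 1} \<in> edges (H t)"
  by (simp add: H_def)

lemma H_edge_Y1: "j \<in> {1, 2, 3} \<Longrightarrow> {Yv 1, Xv j} \<in> edges (H t)"
  unfolding H_def graph.simps by (intro UnI1[OF UnI2] CollectI exI[of _ j] conjI refl)

lemma H_edge_Y: "j \<in> {1..<t} \<Longrightarrow> r \<in> {0, 1, 2, 3} \<Longrightarrow> {Yv (j + 1), Xv (4 * j + r)} \<in> edges (H t)"
  unfolding H_def graph.simps
  by (intro UnI2 CollectI exI[of _ "j + 1"] exI[of _ "4 * j + r"] conjI) auto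

lemma H_edge_cases:
  assumes "e \<in> edges (H t)"
  obtains (cycle) i where "1 \<le> i" "i < cycle_length t" "e = {Xv i, Xv (i + 1)}"
    | (closing) "e = {Xv (cycle_length t), Xv 1}"
    | (first) j where "j \<in> {1, 2, 3}" "e = {Yv 1, Xv j}"
    | (later) j r where "j \<in> {1..<t}" "r \<in> {0, 1, 2, 3}" "e = {Yv (j + 1), Xv (4 * j + r)}"
proof -
  consider i where "1 \<le> i" "i < cycle_length t" "e = {Xv i, Xv (i + 1)}"
    | "e = {Xv (cycle_length t), Xv 1}"
    | j where "j \<in> {1, 2, 3}" "e = {Yv 1, Xv j}"
    | i l where "1 < i" "i \<le> t" "l \<in> {4 * i - 4, 4 * i - 3, 4 * i - 2, 4 * i - 1}" "e = {Yv i, Xv l}"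
    using assms unfolding H_def by (simp only: graph.simps) blast
  then show ?thesis
  proof cases
    case (4 i l)
    have "i - 1 + 1 = i" "4 * (i - 1) + (l - (4 * i - 4)) = l" "i - 1 \<in> {1..<t}" "l - (4 * i - 4) \<in> {0, 1, 2, 3}"
      using 4(1-3) by auto
    then show ?thesis using later[of "i - 1" "l - (4 * i - 4)"] 4(4) by simp
  qed (rule cycle closing first; assumption)+
qed

text \<open>The two inner path vertices of each fan with index in \<open>S\<close>; the path of the fan \<open>j\<close> is \<open>x\<^bsub>4j\<^esub>, ..., x\<^bsub>4j+3\<^esub>\<close>.\<close>

definition middle :: "nat set \<Rightarrow> vertex set" where
  "middle S = {Xv k |k. (k mod 4 = 1 \<or> k mod 4 = 2) \<and> k div 4 \<in> S}"

lemma middle_simps [simp]: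
  "Yv i \<notin> middle S"
  "Xv (4 * j) \<notin> middle S" "Xv (4 * j + 3) \<notin> middle S"
  "Xv (4 * j + 1) \<in> middle S \<longleftrightarrow> j \<in> S" "Xv (4 * j + 2) \<in> middle S \<longleftrightarrow> j \<in> S"
proof -
  have "(4 * j + r) mod 4 = r \<and> (4 * j + r) div 4 = j" if "r < 4" for r :: nat using that by simp
  from this[of 0] this[of 1] this[of 2] this[of 3]
  show "Yv i \<notin> middle S"
    "Xv (4 * j) \<notin> middle S" "Xv (4 * j + 3) \<notin> middle S"
    "Xv (4 * j + 1) \<in> middle S \<longleftrightarrow> j \<in> S" "Xv (4 * j + 2) \<in> middle S \<longleftrightarrow> j \<in> S"
    by (simp_all add: middle_def)
qed

lemma sum_blocks:
  fixes g :: "vertex \<Rightarrow> 'a::comm_monoid_add"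
  assumes "t \<ge> 1"
  shows "(\<Sum>v\<in>Xv ` {1..4 * t - 1} \<union> Yv ` {1..t}. g v) =
    g (Xv 1) + g (Xv 2) + g (Xv 3) + g (Yv 1) +
    (\<Sum>j\<in>{1..<t}. g (Xv (4 * j)) + g (Xv (4 * j + 1)) + g (Xv (4 * j + 2)) + g (Xv (4 * j + 3)) + g (Yv (j + 1)))"
  using assms
proof (induction t rule: dec_induct)
  case base
  have "Xv ` {1..4 * 1 - 1} \<union> Yv ` {1..1} = {Xv 1, Xv 2, Xv 3, Yv 1}"
    by (auto simp: image_iff numeral_eq_Suc le_Suc_eq)
  then show ?case by (simp add: ac_simps)
next
  case (step t)
  let ?V = "Xv ` {1..4 * t - 1} \<union> Yv ` {1..t}"
  have "Xv ` {1..4 * Suc t - 1} \<union> Yv ` {1..Suc t} =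
    insert (Xv (4 * t)) (insert (Xv (4 * t + 1)) (insert (Xv (4 * t + 2)) (insert (Xv (4 * t + 3)) (insert (Yv (t + 1)) ?V))))"
  proof -
    have "{1..4 * Suc t - 1} = insert (4 * t) (insert (4 * t + 1) (insert (4 * t + 2) (insert (4 * t + 3) {1..4 * t - 1})))"
      using step(1) by auto
    moreover have "{1..Suc t} = insert (t + 1) {1..t}" by auto
    ultimately show ?thesis by auto
  qed
  then have "(\<Sum>v\<in>Xv ` {1..4 * Suc t - 1} \<union> Yv ` {1..Suc t}. g v) =
     g (Xv (4 * t)) + (g (Xv (4 * t + 1)) + (g (Xv (4 * t + 2)) + (g (Xv (4 * t + 3)) + (g (Yv (t + 1)) + sum g ?V))))"
    using step(1) by (simp add: image_iff)
  then show ?case using step by (simp add: ac_simps)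
qed

lemma stable_pair: "stable_set G I \<Longrightarrow> {u, v} \<in> edges G \<Longrightarrow> of_bool (u \<in> I) + of_bool (v \<in> I) \<le> (1::int)"
  by (auto simp: stable_set_def)

lemma stable_triangle:
  "stable_set G I \<Longrightarrow> {u, v} \<in> edges G \<Longrightarrow> {v, w} \<in> edges G \<Longrightarrow> {w, u} \<in> edges G \<Longrightarrow>
    of_bool (u \<in> I) + of_bool (v \<in> I) + of_bool (w \<in> I) \<le> (1::int)"
  by (auto simp: stable_set_def)

lemma cycle_length_ge_2: "t \<ge> 2 \<Longrightarrow> cycle_length t = 4 * t - 1"
  by (simp add: cycle_length_def)

lemma H_edge_next: "1 \<le> i \<Longrightarrow> i + 1 = k \<Longrightarrow> k \<le> cycle_length t \<Longrightarrow> {Xv i, Xv k} \<in> edges (H t)"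
  using H_edge_XX by auto

lemma H_edge_Y': "j \<in> {1..<t} \<Longrightarrow> k \<in> {4 * j..4 * j + 3} \<Longrightarrow> {Yv (j + 1), Xv k} \<in> edges (H t)"
  using H_edge_Y[of j t "k - 4 * j"] by force

text \<open>Add the inequalities for the cliques met on a walk along the ring. In a fan traversed along its path the apex
  is counted twice, as a member of the first and of the last triangle.\<close>

lemma stable_block_bounds:
  fixes f :: "vertex \<Rightarrow> int"
  assumes t: "t \<ge> 2" and I: "stable_set (H t) I" and f: "\<And>v. f v = of_bool (v \<in> I)"
  shows "j \<in> {1..<t} \<Longrightarrow> f (Xv (4 * j - 1)) + 2 * (f (Xv (4 * j)) + f (Xv (4 * j + 1)) + f (Xv (4 * j + 2)) +
          f (Xv (4 * j + 3)) + f (Yv (j + 1))) - f (Xv (4 * j + 3)) \<le> 4" (is "_ \<Longrightarrow> ?A")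
    and "j \<in> {1..<t} \<Longrightarrow> f (Xv (4 * j - 1)) + 2 * (f (Xv (4 * j)) + f (Xv (4 * j + 3)) + f (Yv (j + 1))) -
          f (Xv (4 * j + 3)) \<le> 3" (is "_ \<Longrightarrow> ?B")
    and "f (Xv (4 * t - 1)) + 2 * (f (Xv 1) + f (Xv 2) + f (Xv 3) + f (Yv 1)) - f (Xv 3) \<le> 3"
proof -
  note N = cycle_length_ge_2[OF t]
  have pair: "f u + f v \<le> 1" if "{u, v} \<in> edges (H t)" for u v
    unfolding f by (rule stable_pair[OF I that])
  have tri: "f u + f v + f w \<le> 1" if "{u, v} \<in> edges (H t)" "{w, u} \<in> edges (H t)" "{w, v} \<in> edges (H t)" for u v w
    unfolding f using that by (intro stable_triangle[OF I]) (simp_all add: insert_commute)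
  have four: "a + b \<le> 1 \<Longrightarrow> b + c + y \<le> 1 \<Longrightarrow> c + d \<le> 1 \<Longrightarrow> d + e + y \<le> 1 \<Longrightarrow>
    a + 2 * (b + c + d + e + y) - e \<le> 4" for a b c d e y :: int by presburger
  have three: "a + b \<le> 1 \<Longrightarrow> y + b \<le> 1 \<Longrightarrow> y + e \<le> 1 \<Longrightarrow> a + 2 * (b + e + y) - e \<le> 3"
    for a b e y :: int by presburger
  show ?A if j: "j \<in> {1..<t}"
  proof -
    have "f (Xv (4 * j - 1)) + f (Xv (4 * j)) \<le> 1"
      by (intro pair H_edge_next) (use j N in auto)
    moreover have "f (Xv (4 * j)) + f (Xv (4 * j + 1)) + f (Yv (j + 1)) \<le> 1"
      by (intro tri H_edge_next H_edge_Y') (use j N in auto)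
    moreover have "f (Xv (4 * j + 1)) + f (Xv (4 * j + 2)) \<le> 1"
      by (intro pair H_edge_next) (use j N in auto)
    moreover have "f (Xv (4 * j + 2)) + f (Xv (4 * j + 3)) + f (Yv (j + 1)) \<le> 1"
      by (intro tri H_edge_next H_edge_Y') (use j N in auto)
    ultimately show ?thesis by (rule four)
  qed
  show ?B if j: "j \<in> {1..<t}"
  proof -
    have "f (Xv (4 * j - 1)) + f (Xv (4 * j)) \<le> 1"
      by (intro pair H_edge_next) (use j N in auto)
    moreover have "f (Yv (j + 1)) + f (Xv (4 * j)) \<le> 1" "f (Yv (j + 1)) + f (Xv (4 * j + 3)) \<le> 1"
      by (intro pair H_edge_Y'; use j N in auto)+
    ultimately show ?thesis by (rule three)
  qed
  have three': "a + b \<le> 1 \<Longrightarrow> b + c + y \<le> 1 \<Longrightarrow> c + d + y \<le> 1 \<Longrightarrow> a + 2 * (b + c + d + y) - d \<le> 3"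
    for a b c d y :: int by presburger
  have "{Xv (4 * t - 1), Xv 1} \<in> edges (H t)" using H_edge_closing[of t] by (simp add: N)
  then have "f (Xv (4 * t - 1)) + f (Xv 1) \<le> 1" by (rule pair)
  moreover have "f (Xv 1) + f (Xv 2) + f (Yv 1) \<le> 1" "f (Xv 2) + f (Xv 3) + f (Yv 1) \<le> 1"
    by (intro tri H_edge_next H_edge_Y1; use t N in auto)+
  ultimately show "f (Xv (4 * t - 1)) + 2 * (f (Xv 1) + f (Xv 2) + f (Xv 3) + f (Yv 1)) - f (Xv 3) \<le> 3"
    by (rule three')
qed

lemma card_eq_sum_of_bool:
  "finite V \<Longrightarrow> int (card {v\<in>V. v \<in> I}) = (\<Sum>v\<in>V. of_bool (v \<in> I))"
  by (simp add: of_bool_def sum.If_cases Int_def)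

lemma telescope:
  fixes h :: "nat \<Rightarrow> int"
  assumes "t \<ge> 1"
  shows "(\<Sum>j\<in>{1..<t}. h (4 * j - 1) - h (4 * j + 3)) = h 3 - h (4 * t - 1)"
  using assms
proof (induction t rule: dec_induct)
  case (step t)
  then show ?case by (simp add: ac_simps)
qed simp

text \<open>The clique inequalities around the hole add up to twice the size of the stable set, because the
  contributions of the links between consecutive blocks telescope.\<close>

lemma twice_stable_card_le:
  assumes t: "t \<ge> 1" and S: "S \<subseteq> {1..<t}" and I: "stable_set (H t) I" "I \<subseteq> verts (H t) - middle S"
  shows "2 * card I + card S \<le> cycle_length t"
proof (cases "t = 1")
  case True
  define f where "f v = (of_bool (v \<in> I) :: int)" for v
  have len: "cycle_length 1 = 5" by (simp add: cycle_length_def)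
  have V: "verts (H 1) = {Xv 1, Xv 2, Xv 3, Xv 4, Xv 5, Yv 1}"
  proof -
    have "{1..cycle_length 1} = {1, 2, 3, 4, 5}" "{1..1::nat} = {1}" unfolding len by auto
    then show ?thesis by (simp only: verts_H) auto
  qed
  have I': "stable_set (H 1) I" using I True by simp
  have pair: "f u + f v \<le> 1" if "{u, v} \<in> edges (H 1)" for u v
    unfolding f_def by (rule stable_pair[OF I' that])
  have tri: "f u + f v + f w \<le> 1" if "{u, v} \<in> edges (H 1)" "{w, u} \<in> edges (H 1)" "{w, v} \<in> edges (H 1)" for u v w
    unfolding f_def using that by (intro stable_triangle[OF I']) (simp_all add: insert_commute)
  have "f (Xv 1) + f (Xv 2) + f (Yv 1) \<le> 1" "f (Xv 2) + f (Xv 3) + f (Yv 1) \<le> 1"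
    by (intro tri H_edge_next H_edge_Y1; use len in auto)+
  moreover have "f (Xv 3) + f (Xv 4) \<le> 1" "f (Xv 4) + f (Xv 5) \<le> 1"
    by (intro pair H_edge_next; use len in auto)+
  moreover have "{Xv 5, Xv 1} \<in> edges (H 1)" using H_edge_closing[of 1] unfolding len .
  then have "f (Xv 5) + f (Xv 1) \<le> 1" by (rule pair)
  moreover have "int (card I) = f (Xv 1) + f (Xv 2) + f (Xv 3) + f (Xv 4) + f (Xv 5) + f (Yv 1)"
  proof -
    have "I = {v \<in> verts (H 1). v \<in> I}" using I True by auto
    then have "int (card I) = (\<Sum>v\<in>verts (H 1). f v)"
      using card_eq_sum_of_bool[of "verts (H 1)" I] V by (simp add: f_def)
    then show ?thesis unfolding V by simp
  qed
  ultimately show ?thesis using True S len by simp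
next
  case False
  then have t2: "t \<ge> 2" using t by simp
  note N = cycle_length_ge_2[OF t2]
  define f where "f v = (of_bool (v \<in> I) :: int)" for v
  note bounds = stable_block_bounds[OF t2 I(1) f_def]
  have V: "verts (H t) = Xv ` {1..4 * t - 1} \<union> Yv ` {1..t}" by (simp add: verts_H N)
  have fin: "finite S" using S finite_subset by blast
  define c where "c j = f (Xv (4 * j)) + f (Xv (4 * j + 1)) + f (Xv (4 * j + 2)) + f (Xv (4 * j + 3)) + f (Yv (j + 1))" for j
  have card: "int (card I) = f (Xv 1) + f (Xv 2) + f (Xv 3) + f (Yv 1) + (\<Sum>j\<in>{1..<t}. c j)"
  proof -
    have "I = {v \<in> verts (H t). v \<in> I}" using I by auto
    then have "int (card I) = (\<Sum>v\<in>verts (H t). f v)"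
      using card_eq_sum_of_bool[of "verts (H t)" I] V by (simp add: f_def)
    then show ?thesis unfolding V c_def sum_blocks[OF t] .
  qed
  have "f (Xv (4 * j - 1)) - f (Xv (4 * j + 3)) + 2 * c j \<le> 4 - of_bool (j \<in> S)" if j: "j \<in> {1..<t}" for j
  proof (cases "j \<in> S")
    case True
    then have "Xv (4 * j + 1) \<in> middle S" "Xv (4 * j + 2) \<in> middle S" by (simp_all only: middle_simps)
    then have "f (Xv (4 * j + 1)) = 0" "f (Xv (4 * j + 2)) = 0" using I by (auto simp: f_def)
    then show ?thesis using bounds(2)[OF j] True by (simp add: c_def)
  next
    case False
    then show ?thesis using bounds(1)[OF j] by (simp add: c_def)
  qed
  then have "(\<Sum>j\<in>{1..<t}. f (Xv (4 * j - 1)) - f (Xv (4 * j + 3)) + 2 * c j) \<le> (\<Sum>j\<in>{1..<t}. 4 - of_bool (j \<in> S))"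
    by (rule sum_mono)
  moreover have "(\<Sum>j\<in>{1..<t}. f (Xv (4 * j - 1)) - f (Xv (4 * j + 3)) + 2 * c j) =
      f (Xv 3) - f (Xv (4 * t - 1)) + 2 * (\<Sum>j\<in>{1..<t}. c j)"
    using telescope[OF t, of "\<lambda>k. f (Xv k)"] by (simp add: sum.distrib sum_distrib_left)
  moreover have "(\<Sum>j\<in>{1..<t}. 4 - of_bool (j \<in> S)) = 4 * (int t - 1) - int (card S)"
  proof -
    have "{j \<in> {1..<t}. j \<in> S} = S" using S by auto
    then have "(\<Sum>j\<in>{1..<t}. of_bool (j \<in> S)) = int (card S)"
      using card_eq_sum_of_bool[of "{1..<t}" S] by simp
    then show ?thesis using t by (simp add: sum_subtractf of_nat_diff)
  qed
  ultimately show ?thesis using bounds(3) card t N by (simp add: of_nat_diff)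
qed

text \<open>For a maximum stable set the clique inequalities leave a total slack of one. An apex \<open>y\<^sub>i\<close> with \<open>i \<ge> 2\<close>
  uses up this slack, so every other clique is hit. Tightness forces the last vertices of the
  blocks before \<open>y\<^sub>i\<close> to be all in or all out, and the one next to \<open>y\<^sub>i\<close> is in. So \<open>x\<^sub>3\<close> is in, and then \<open>x\<^sub>1\<close> too.\<close>

lemma maximum_stable_hits_apex_once:
  assumes t: "t \<ge> 1" and I: "stable_set (H t) I" "I \<subseteq> verts (H t)" and max: "2 * card I + 1 = cycle_length t"
    and Z: "Z = insert (Xv 2) (Yv ` {1..t})"
  shows "card (I \<inter> Z) \<le> 1" and "I \<inter> Z \<noteq> {} \<Longrightarrow> Xv 1 \<in> I \<longleftrightarrow> Xv 3 \<in> I"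
proof -
  have "3 \<le> cycle_length t" using t by (auto simp: cycle_length_def)
  then have edges12: "{Xv 1, Xv 2} \<in> edges (H t)" "{Xv 2, Xv 3} \<in> edges (H t)"
    by (intro H_edge_next; simp)+
  have edgesY: "{Yv 1, Xv 2} \<in> edges (H t)" "{Yv 1, Xv 1} \<in> edges (H t)" "{Yv 1, Xv 3} \<in> edges (H t)"
    by (rule H_edge_Y1; simp)+
  have low: "\<not> (Xv 2 \<in> I \<and> Yv 1 \<in> I)" and low13: "Xv 2 \<in> I \<or> Yv 1 \<in> I \<Longrightarrow> Xv 1 \<notin> I \<and> Xv 3 \<notin> I"
    using edges12 edgesY I(1) unfolding stable_set_def by blast+
  have high: "Xv 1 \<in> I \<and> Xv 3 \<in> I \<and> (\<forall>j\<in>{1..<t}. Yv (j + 1) \<in> I \<longrightarrow> j = i)"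
    if i: "i \<in> {1..<t}" and Y: "Yv (i + 1) \<in> I" for i
  proof -
    have t2: "t \<ge> 2" using i by auto
    note N = cycle_length_ge_2[OF t2]
    define f where "f v = (of_bool (v \<in> I) :: int)" for v
    note bounds = stable_block_bounds[OF t2 I(1) f_def]
    have V: "verts (H t) = Xv ` {1..4 * t - 1} \<union> Yv ` {1..t}" by (simp add: verts_H N)
    define c where "c j = f (Xv (4 * j)) + f (Xv (4 * j + 1)) + f (Xv (4 * j + 2)) + f (Xv (4 * j + 3)) + f (Yv (j + 1))" for j
    define slack where "slack j = 4 - f (Xv (4 * j - 1)) - 2 * c j + f (Xv (4 * j + 3))" for j
    define slack1 where "slack1 = 3 - f (Xv (4 * t - 1)) - 2 * (f (Xv 1) + f (Xv 2) + f (Xv 3) + f (Yv 1)) + f (Xv 3)"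
    have nonneg: "slack j \<ge> 0" if "j \<in> {1..<t}" for j using bounds(1)[OF that] by (simp add: slack_def c_def)
    have nonneg1: "slack1 \<ge> 0" using bounds(3) by (simp add: slack1_def)
    have card: "int (card I) = f (Xv 1) + f (Xv 2) + f (Xv 3) + f (Yv 1) + (\<Sum>j\<in>{1..<t}. c j)"
    proof -
      have "I = {v \<in> verts (H t). v \<in> I}" using I by auto
      then have "int (card I) = (\<Sum>v\<in>verts (H t). f v)"
        using card_eq_sum_of_bool[of "verts (H t)" I] V by (simp add: f_def)
      then show ?thesis unfolding V c_def sum_blocks[OF t] .
    qed
    have "(\<Sum>j\<in>{1..<t}. slack j) = (\<Sum>j\<in>{1..<t}. 4 - 2 * c j) - (\<Sum>j\<in>{1..<t}. f (Xv (4 * j - 1)) - f (Xv (4 * j + 3)))"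
      unfolding slack_def sum_subtractf[symmetric] by (intro sum.cong) auto
    also have "\<dots> = 4 * (int t - 1) - 2 * (\<Sum>j\<in>{1..<t}. c j) - (f (Xv 3) - f (Xv (4 * t - 1)))"
      using t telescope[OF t, of "\<lambda>k. f (Xv k)"] by (simp add: sum_subtractf sum_distrib_left of_nat_diff)
    finally have "(\<Sum>j\<in>{1..<t}. slack j) + slack1 = 4 * int t - 1 - 2 * int (card I)"
      unfolding card slack1_def by simp
    then have total: "(\<Sum>j\<in>{1..<t}. slack j) + slack1 = 1"
      using max N t by (simp add: of_nat_diff)
    have f01: "f v = 0 \<or> f v = 1" for v by (simp add: f_def)
    have slack_Y: "slack j \<ge> 1 \<and> (slack j = 1 \<longrightarrow> Xv (4 * j - 1) \<in> I)" if j: "j \<in> {1..<t}" and Yj: "Yv (j + 1) \<in> I" for j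
    proof -
      have "f (Xv (4 * j + r)) = 0" if "r \<in> {0, 1, 2, 3}" for r
        using H_edge_Y[OF j that] I(1) Yj by (auto simp: f_def stable_set_def)
      from this[of 0] this[of 1] this[of 2] this[of 3]
      have "c j = 1" "f (Xv (4 * j + 3)) = 0" using Yj by (simp_all add: c_def f_def)
      then have "slack j = 2 - f (Xv (4 * j - 1))" by (simp add: slack_def)
      then show ?thesis by (auto simp: f_def)
    qed
    have others: "slack j = 0" if j: "j \<in> {1..<t}" "j \<noteq> i" for j
    proof -
      have "slack i + slack j \<le> (\<Sum>j\<in>{1..<t}. slack j)"
      proof -
        have "sum slack {i, j} \<le> sum slack {1..<t}" by (rule sum_mono2) (use i j nonneg in auto)
        then show ?thesis using j by simp
      qed
      then show ?thesis using total nonneg1 nonneg[OF j(1)] slack_Y[OF i Y] by linarith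
    qed
    have "slack i \<le> (\<Sum>j\<in>{1..<t}. slack j)" by (rule member_le_sum) (use i nonneg in auto)
    then have tight: "slack i = 1" "slack1 = 0" using total nonneg1 slack_Y[OF i Y] by linarith+
    have prev: "Xv (4 * i - 1) \<in> I" using slack_Y[OF i Y] tight by blast
    have "Xv (4 * j + 3) \<in> I \<longleftrightarrow> Xv 3 \<in> I" if "j < i" for j
      using that
    proof (induction j)
      case (Suc j)
      then have "slack (Suc j) = 0" using i by (intro others) auto
      then have "f (Xv (4 * Suc j + 3)) = f (Xv (4 * Suc j - 1))"
        using f01[of "Xv (4 * Suc j + 3)"] f01[of "Xv (4 * Suc j - 1)"] unfolding slack_def by presburger
      then have "Xv (4 * Suc j + 3) \<in> I \<longleftrightarrow> Xv (4 * Suc j - 1) \<in> I" unfolding f_def of_bool_eq_iff .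
      moreover have "4 * Suc j - 1 = 4 * j + 3" by simp
      moreover have "Xv (4 * j + 3) \<in> I \<longleftrightarrow> Xv 3 \<in> I" using Suc by simp
      ultimately show ?case by (simp only:)
    qed simp
    from this[of "i - 1"] have x3: "Xv 3 \<in> I"
    proof -
      assume "i - 1 < i \<Longrightarrow> (Xv (4 * (i - 1) + 3) \<in> I) = (Xv 3 \<in> I)"
      moreover have "4 * (i - 1) + 3 = 4 * i - 1" "i - 1 < i" using i by auto
      ultimately show ?thesis using prev by simp
    qed
    then have "Xv 2 \<notin> I" "Yv 1 \<notin> I" using low13 by blast+
    then have "f (Xv (4 * t - 1)) + 2 * f (Xv 1) = 2" using tight(2) x3 by (simp add: slack1_def f_def)
    then have "f (Xv 1) = 1" using f01[of "Xv (4 * t - 1)"] f01[of "Xv 1"] by linarith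
    then have "Xv 1 \<in> I" by (simp add: f_def)
    moreover have "j = i" if "j \<in> {1..<t}" "Yv (j + 1) \<in> I" for j
      using others[OF that(1)] slack_Y[OF that] by fastforce
    ultimately show ?thesis using x3 by blast
  qed
  have Z_cases: "v = Xv 2 \<or> v = Yv 1 \<or> (\<exists>j\<in>{1..<t}. v = Yv (j + 1))" if "v \<in> Z" for v
  proof -
    have "\<exists>j\<in>{1..<t}. i = j + 1" if "i \<in> {1..t}" "i \<noteq> 1" for i
      using that by (intro bexI[of _ "i - 1"]) auto
    then show ?thesis using that unfolding Z by blast
  qed
  have low_or_high: "(w = Xv 2 \<or> w = Yv 1) \<and> Xv 1 \<notin> I \<and> Xv 3 \<notin> I \<or>
      (\<exists>j\<in>{1..<t}. w = Yv (j + 1)) \<and> Xv 1 \<in> I \<and> Xv 3 \<in> I" if w: "w \<in> I" "w \<in> Z" for w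
    using Z_cases[OF w(2)]
  proof (elim disjE bexE)
    fix j assume j: "j \<in> {1..<t}" "w = Yv (j + 1)"
    then show ?thesis using high[OF j(1)] w by blast
  qed (use low13 w in blast)+
  have unique: "u = v" if u: "u \<in> I" "u \<in> Z" and v: "v \<in> I" "v \<in> Z" for u v
  proof (cases "Xv 1 \<in> I")
    case True
    then obtain i j where ij: "i \<in> {1..<t}" "j \<in> {1..<t}" "u = Yv (i + 1)" "v = Yv (j + 1)"
      using low_or_high[OF u] low_or_high[OF v] by blast
    then show ?thesis using high[OF ij(1)] u v by blast
  next
    case False
    then show ?thesis using low_or_high[OF u] low_or_high[OF v] low u v by blast
  qed
  have "I \<inter> Z = {} \<or> (\<exists>v. I \<inter> Z = {v})" using unique by blast
  then show "card (I \<inter> Z) \<le> 1" by auto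
  assume "I \<inter> Z \<noteq> {}"
  then obtain v where "v \<in> I" "v \<in> Z" by blast
  then show "Xv 1 \<in> I \<longleftrightarrow> Xv 3 \<in> I" using low_or_high[of v] by blast
qed

section \<open>Colouring a ring of fans\<close>

lemma exists_between:
  fixes l1 l2 l3 u1 u2 u3 :: int
  assumes "l1 \<le> u1" "l1 \<le> u2" "l1 \<le> u3" "l2 \<le> u1" "l2 \<le> u2" "l2 \<le> u3" "l3 \<le> u1" "l3 \<le> u2" "l3 \<le> u3"
  shows "\<exists>x. l1 \<le> x \<and> l2 \<le> x \<and> l3 \<le> x \<and> x \<le> u1 \<and> x \<le> u2 \<and> x \<le> u3"
  using assms by (intro exI[of _ "max l1 (max l2 l3)"]) (simp add: le_max_iff_disj)

lemma exists_between4: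
  fixes l1 l2 l3 l4 u1 u2 u3 u4 :: int
  assumes "l1 \<le> u1" "l1 \<le> u2" "l1 \<le> u3" "l1 \<le> u4" "l2 \<le> u1" "l2 \<le> u2" "l2 \<le> u3" "l2 \<le> u4"
    "l3 \<le> u1" "l3 \<le> u2" "l3 \<le> u3" "l3 \<le> u4" "l4 \<le> u1" "l4 \<le> u2" "l4 \<le> u3" "l4 \<le> u4"
  shows "\<exists>x. l1 \<le> x \<and> l2 \<le> x \<and> l3 \<le> x \<and> l4 \<le> x \<and> x \<le> u1 \<and> x \<le> u2 \<and> x \<le> u3 \<and> x \<le> u4"
  using assms by (intro exI[of _ "max (max l1 l2) (max l3 l4)"]) (simp add: le_max_iff_disj)

text \<open>The numerical half of one propagation step. \<open>X\<close> is a fixed set of \<open>x\<close> colours, \<open>Q\<close> the last set of the previous block,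
  \<open>P\<close> and \<open>Q'\<close> the first and last set of the new block; \<open>s\<close>, \<open>a\<close>, \<open>s'\<close> are the sizes of the
  intersections of \<open>X\<close> with \<open>Q\<close>, \<open>P\<close>, \<open>Q'\<close>, while \<open>r\<close> is that of \<open>P\<close> with \<open>Q'\<close> and \<open>e\<close> that of all three of \<open>X\<close>, \<open>P\<close>, \<open>Q'\<close>. The
  bounds for \<open>r\<close> are those under which the fan can be filled. Eliminating the unknowns one at a
  time leaves inequalities that follow from the clique bounds.\<close>

lemma block_arithmetic:
  fixes n x p q q' y m lo h s' :: int
  assumes nonneg: "0 \<le> p" "0 \<le> q" "0 \<le> q'" "0 \<le> y" "0 \<le> m" "x \<le> n"
    and cliques: "q + p \<le> n" "y + m \<le> n" "p + y \<le> n" "q' + y \<le> n" "p + q' + 2 * y + m \<le> 2 * n"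
    and inv: "0 \<le> lo" "x + q - n \<le> lo" "0 \<le> h" "x - q \<le> h" "lo \<le> x - h"
    and lo': "0 \<le> s'" "x + q' - n \<le> s'" "lo + (p + q' + y + m - 2 * n) \<le> s'" "h + (p + q' + q + y - 2 * n) \<le> s'"
    and h': "s' \<le> x" "s' \<le> q'" "lo + (p + y - n) \<le> x - s'" "h + (p + q + y + m - 2 * n) \<le> x - s'"
  obtains s a r e where
    "lo \<le> s" "s \<le> x - h" "0 \<le> a" "a \<le> p" "a \<le> x - s" "p - a \<le> n - q - x + s"
    "0 \<le> r" "r \<le> p" "r \<le> q'" "p + q' + y - n \<le> r" "r \<le> n - y - m"
    "0 \<le> e" "e \<le> a" "e \<le> r" "e \<le> s'" "r - e \<le> p - a" "s' - e \<le> x - a" "r + s' - e \<le> q'"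
    "q' - r - (s' - e) \<le> n - p - x + a"
proof -
  define loP where "loP = max 0 (x + p + q - n - (x - h))"
  define hiP where "hiP = min p (x - lo)"
  define l where "l = max 0 (p + q' + y - n)"
  define u where "u = min (min p q') (n - y - m)"
  have loP: "loP = 0 \<or> loP = p + q - n + h" "0 \<le> loP" "p + q - n + h \<le> loP" unfolding loP_def by linarith+
  have hiP: "hiP = p \<or> hiP = x - lo" "hiP \<le> p" "hiP \<le> x - lo" unfolding hiP_def by linarith+
  have l: "l = 0 \<or> l = p + q' + y - n" "0 \<le> l" "p + q' + y - n \<le> l" unfolding l_def by linarith+
  have u: "u = p \<or> u = q' \<or> u = n - y - m" "u \<le> p" "u \<le> q'" "u \<le> n - y - m" unfolding u_def by linarith+
  have hq: "h + q \<le> n" "lo \<le> q" "lo \<le> x" using inv by linarith+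
  have P: "loP \<le> hiP" "0 \<le> loP" "x + p - n \<le> loP" "hiP \<le> p" "hiP \<le> x"
    using loP(1) hiP(1) nonneg(1) hq cliques(1) inv(5) apply (elim disjE; linarith)
    using loP hiP inv hq by linarith+
  have L: "l \<le> u" "0 \<le> l" "p + q' - n \<le> l" "u \<le> p" "u \<le> q'"
    using l(1) u(1) nonneg(1,3) cliques(2-5) apply (elim disjE; linarith)
    using l u nonneg by linarith+
  have i: "loP + l \<le> p + s'"
    using loP(1) l(1) nonneg(1) lo'(1,4) hq(1) cliques(4) by (elim disjE; linarith)
  have ii: "p + x + q' - n - s' \<le> hiP + u"
    using hiP(1) u(1) nonneg(1,6) lo'(1,2,3) hq(2,3) cliques(1,2) by (elim disjE; linarith)
  have iii: "s' - q' \<le> hiP - l"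
    using hiP(1) l(1) nonneg(1) h'(2,3) hq(3) cliques(4) by (elim disjE; linarith)
  have iv: "loP - u \<le> x - s'"
    using loP(1) u(1) nonneg(1,3) h'(1,2,4) hq(1) cliques(1,2) inv by (elim disjE; linarith)
  have gr0: "l \<le> u" using L(1) by linarith
  have gr1: "l \<le> p + s' - loP" using i by linarith
  have gr2: "l \<le> hiP - (s' - q')" using iii by linarith
  have gr3: "loP - (x - s') \<le> u" using iv by linarith
  have gr4: "loP - (x - s') \<le> p + s' - loP" using P(1,4,5) by linarith
  have gr5: "loP - (x - s') \<le> hiP - (s' - q')" using P(1) h'(1,2) by linarith
  have gr6: "p + x + q' - n - s' - hiP \<le> u" using ii by linarith
  have gr7: "p + x + q' - n - s' - hiP \<le> p + s' - loP" using P(1) lo'(1,2) by linarith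
  have gr8: "p + x + q' - n - s' - hiP \<le> hiP - (s' - q')" using P(1,2,3) by linarith
  obtain r where r: "l \<le> r" "loP - (x - s') \<le> r" "p + x + q' - n - s' - hiP \<le> r" "r \<le> u" "r \<le> p + s' - loP" "r \<le> hiP - (s' - q')"
    using exists_between[OF gr0 gr1 gr2 gr3 gr4 gr5 gr6 gr7 gr8] by (elim exE conjE)
  have ga0: "loP \<le> hiP" using P(1) by linarith
  have ga1: "loP \<le> p + s' - r" using r(5) by linarith
  have ga2: "loP \<le> x - s' + r" using r(2) by linarith
  have ga3: "p + x + q' - n - s' - r \<le> hiP" using r(3) by linarith
  have ga4: "p + x + q' - n - s' - r \<le> p + s' - r" using lo'(1,2) by linarith
  have ga5: "p + x + q' - n - s' - r \<le> x - s' + r" using r(1) L(2,3) by linarith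
  have ga6: "s' - q' + r \<le> hiP" using r(6) by linarith
  have ga7: "s' - q' + r \<le> p + s' - r" using r(4) L(4,5) by linarith
  have ga8: "s' - q' + r \<le> x - s' + r" using h'(1,2) by linarith
  obtain a where a: "loP \<le> a" "p + x + q' - n - s' - r \<le> a" "s' - q' + r \<le> a" "a \<le> hiP" "a \<le> p + s' - r" "a \<le> x - s' + r"
    using exists_between[OF ga0 ga1 ga2 ga3 ga4 ga5 ga6 ga7 ga8] by (elim exE conjE)
  have "lo \<le> x - a" using a(4) hiP(3) by linarith
  moreover have "p + q + x - n - a \<le> x - h" using a(1) loP(3) by linarith
  moreover have "p + q + x - n - a \<le> x - a" using cliques(1) by linarith
  ultimately obtain s where s: "lo \<le> s" "p + q + x - n - a \<le> s" "s \<le> x - h" "s \<le> x - a"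
    using exists_between[of lo "x - h" "x - a" "x - a" "p + q + x - n - a" lo] inv(5) by blast
  have ge0: "0 \<le> a" using a(1) P(2) by linarith
  have ge1: "0 \<le> r" using r(1) L(2) by linarith
  have ge2: "0 \<le> s'" using lo'(1) by linarith
  have ge3: "0 \<le> n - p - x + a - q' + r + s'" using a(2) by linarith
  have ge4: "r - p + a \<le> a" using r(4) L(4) by linarith
  have ge5: "r - p + a \<le> r" using a(4) P(4) by linarith
  have ge6: "r - p + a \<le> s'" using a(5) by linarith
  have ge7: "r - p + a \<le> n - p - x + a - q' + r + s'" using lo'(2) by linarith
  have ge8: "s' - x + a \<le> a" using h'(1) by linarith
  have ge9: "s' - x + a \<le> r" using a(6) by linarith
  have ge10: "s' - x + a \<le> s'" using a(4) P(5) by linarith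
  have ge11: "s' - x + a \<le> n - p - x + a - q' + r + s'" using r(1) L(3) by linarith
  have ge12: "r + s' - q' \<le> a" using a(3) by linarith
  have ge13: "r + s' - q' \<le> r" using h'(2) by linarith
  have ge14: "r + s' - q' \<le> s'" using r(4) L(5) by linarith
  have ge15: "r + s' - q' \<le> n - p - x + a - q' + r + s'" using a(1) P(3) by linarith
  obtain e where e: "0 \<le> e" "r - p + a \<le> e" "s' - x + a \<le> e" "r + s' - q' \<le> e" "e \<le> a" "e \<le> r" "e \<le> s'" "e \<le> n - p - x + a - q' + r + s'"
    using exists_between4[OF ge0 ge1 ge2 ge3 ge4 ge5 ge6 ge7 ge8 ge9 ge10 ge11 ge12 ge13 ge14 ge15] by (elim exE conjE)
  have c0: "0 \<le> a" using a(1) P(2) by linarith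
  have c1: "a \<le> p" using a(4) P(4) by linarith
  have c2: "a \<le> x - s" using s(4) by linarith
  have c3: "p - a \<le> n - q - x + s" using s(2) by linarith
  have c4: "0 \<le> r" using r(1) L(2) by linarith
  have c5: "r \<le> p" using r(4) L(4) by linarith
  have c6: "r \<le> q'" using r(4) L(5) by linarith
  have c7: "p + q' + y - n \<le> r" using r(1) l(3) by linarith
  have c8: "r \<le> n - y - m" using r(4) u(4) by linarith
  have c9: "r - e \<le> p - a" using e(2) by linarith
  have c10: "s' - e \<le> x - a" using e(3) by linarith
  have c11: "r + s' - e \<le> q'" using e(4) by linarith
  have c12: "q' - r - (s' - e) \<le> n - p - x + a" using e(8) by linarith
  show ?thesis
    by (rule that[OF s(1) s(3) c0 c1 c2 c3 c4 c5 c6 c7 c8 e(1) e(5) e(6) e(7) c9 c10 c11 c12])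
qed

text \<open>The interval for the overlap never becomes empty: each of the sixteen combinations of a lower and an
  upper bound is a sum of clique inequalities.\<close>

lemma reach_invariant:
  fixes n x p q q' y m lo h :: int
  assumes nonneg: "0 \<le> p" "0 \<le> q" "0 \<le> q'" "0 \<le> y" "0 \<le> m" "0 \<le> x" "x \<le> n" "q' \<le> n"
    and cliques: "q + p \<le> n" "y + m \<le> n" "p + y \<le> n" "q' + y \<le> n" "p + q' + 2 * y + m \<le> 2 * n"
    and inv: "0 \<le> lo" "x + q - n \<le> lo" "0 \<le> h" "x - q \<le> h" "lo \<le> x - h"
    and lo': "lo' = max (max 0 (x + q' - n)) (max (lo + (p + q' + y + m - 2 * n)) (h + (p + q' + q + y - 2 * n)))"
    and h': "h' = max (max 0 (x - q')) (max (lo + (p + y - n)) (h + (p + q + y + m - 2 * n)))"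
  shows "0 \<le> lo'" "x + q' - n \<le> lo'" "0 \<le> h'" "x - q' \<le> h'" "lo' \<le> x - h'"
proof -
  show "0 \<le> lo'" "x + q' - n \<le> lo'" unfolding lo' by simp_all
  show "0 \<le> h'" "x - q' \<le> h'" unfolding h' by simp_all
  have hq: "h + q \<le> n" "lo \<le> q" "lo \<le> x" "h \<le> x" using inv by linarith+
  have c0: "0 + 0 \<le> x" using nonneg(6) by linarith
  have c1: "0 + (x - q') \<le> x" using nonneg(3) by linarith
  have c2: "0 + (lo + (p + y - n)) \<le> x" using hq(3) cliques(3) by linarith
  have c3: "0 + (h + (p + q + y + m - 2 * n)) \<le> x" using hq(4) cliques(1,2) by linarith
  have c4: "(x + q' - n) + 0 \<le> x" using nonneg(8) by linarith
  have c5: "(x + q' - n) + (x - q') \<le> x" using nonneg(7) by linarith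
  have c6: "(x + q' - n) + (lo + (p + y - n)) \<le> x" using hq(2) cliques(1,4) by linarith
  have c7: "(x + q' - n) + (h + (p + q + y + m - 2 * n)) \<le> x" using hq(1) nonneg(4) cliques(5) by linarith
  have c8: "(lo + (p + q' + y + m - 2 * n)) + 0 \<le> x" using hq(3) nonneg(4) cliques(5) by linarith
  have c9: "(lo + (p + q' + y + m - 2 * n)) + (x - q') \<le> x" using hq(2) cliques(1,2) by linarith
  have c10: "(lo + (p + q' + y + m - 2 * n)) + (lo + (p + y - n)) \<le> x" using hq(2,3) cliques(1,5) by linarith
  have c11: "(lo + (p + q' + y + m - 2 * n)) + (h + (p + q + y + m - 2 * n)) \<le> x" using inv(5) cliques(1,2,5) nonneg(4) by linarith
  have c12: "(h + (p + q' + q + y - 2 * n)) + 0 \<le> x" using hq(4) cliques(1,4) by linarith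
  have c13: "(h + (p + q' + q + y - 2 * n)) + (x - q') \<le> x" using hq(1) cliques(3) by linarith
  have c14: "(h + (p + q' + q + y - 2 * n)) + (lo + (p + y - n)) \<le> x" using inv(5) cliques(1,3,4) by linarith
  have c15: "(h + (p + q' + q + y - 2 * n)) + (h + (p + q + y + m - 2 * n)) \<le> x" using hq(1,4) cliques(1,5) by linarith
  have "lo' + h' \<le> x"
    unfolding lo' h' max_add_distrib_left max_add_distrib_right max.bounded_iff
    by (intro conjI c0 c1 c2 c3 c4 c5 c6 c7 c8 c9 c10 c11 c12 c13 c14 c15)
  then show "lo' \<le> x - h'" by linarith
qed

lemma ex_subset_of_card:
  assumes "finite S" "0 \<le> k" "k \<le> int (card S)"
  shows "\<exists>T. T \<subseteq> S \<and> int (card T) = k \<and> finite T"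
proof -
  have "nat k \<le> card S" using assms by simp
  then obtain T where "T \<subseteq> S" "card T = nat k" "finite T" by (rule obtain_subset_with_card_n)
  then show ?thesis using assms(2) by (intro exI[of _ T]) simp
qed

lemma choose_disjoint_set:
  fixes X Q :: "nat set" and n :: nat
  assumes sub: "X \<subseteq> {..<n}" "Q \<subseteq> {..<n}" and s: "int (card (X \<inter> Q)) = s"
    and a: "0 \<le> a" "a \<le> p" "a \<le> int (card X) - s" "p - a \<le> int n - int (card Q) - int (card X) + s"
  obtains P where "P \<subseteq> {..<n}" "P \<inter> Q = {}" "int (card P) = p" "int (card (X \<inter> P)) = a"
proof -
  have fin: "finite X" "finite Q" using sub finite_subset by blast+
  have "card (X - Q) = card X - card (X \<inter> Q)" using fin by (simp add: card_Diff_subset_Int)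
  moreover have "card (X \<inter> Q) \<le> card X" using fin by (simp add: card_mono)
  ultimately have XQ: "int (card (X - Q)) = int (card X) - s" using s by simp
  have "card ({..<n} - (X \<union> Q)) = n - card (X \<union> Q)" using sub fin by (subst card_Diff_subset) auto
  moreover have "card (X \<union> Q) \<le> n" using sub card_mono[of "{..<n}" "X \<union> Q"] by simp
  moreover have "card (X \<union> Q) + card (X \<inter> Q) = card X + card Q" using card_Un_Int[OF fin] by simp
  ultimately have O: "int (card ({..<n} - (X \<union> Q))) = int n - int (card Q) - int (card X) + s" using s by simp
  have "finite (X - Q)" "0 \<le> a" "a \<le> int (card (X - Q))" using fin XQ a by simp_all
  then obtain P1 where P1: "P1 \<subseteq> X - Q" "int (card P1) = a" "finite P1"
    using ex_subset_of_card by blast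
  have "finite ({..<n} - (X \<union> Q))" using fin by simp
  moreover have "0 \<le> p - a" "p - a \<le> int (card ({..<n} - (X \<union> Q)))" using O a by linarith+
  ultimately obtain P2 where P2: "P2 \<subseteq> {..<n} - (X \<union> Q)" "int (card P2) = p - a" "finite P2"
    using ex_subset_of_card[of "{..<n} - (X \<union> Q)"] by metis
  show ?thesis
  proof (rule that[of "P1 \<union> P2"])
    have "card (P1 \<union> P2) = card P1 + card P2" using P1 P2 by (intro card_Un_disjoint) auto
    then show "int (card (P1 \<union> P2)) = p" using P1 P2 by simp
    have "X \<inter> (P1 \<union> P2) = P1" using P1 P2 by auto
    then show "int (card (X \<inter> (P1 \<union> P2))) = a" using P1 by simp
  qed (use P1 P2 sub in auto)
qed

lemma choose_overlapping_set:
  fixes X P :: "nat set" and n :: nat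
  assumes sub: "X \<subseteq> {..<n}" "P \<subseteq> {..<n}" and a: "int (card (X \<inter> P)) = a"
    and e: "0 \<le> e" "e \<le> a" "e \<le> r" "e \<le> s'" "r - e \<le> int (card P) - a" "s' - e \<le> int (card X) - a" "r + s' - e \<le> q'"
    "q' - r - (s' - e) \<le> int n - int (card P) - int (card X) + a"
  obtains Q where "Q \<subseteq> {..<n}" "int (card Q) = q'" "int (card (P \<inter> Q)) = r" "int (card (X \<inter> Q)) = s'"
proof -
  have fin: "finite X" "finite P" using sub finite_subset by blast+
  have le: "card (X \<inter> P) \<le> card X" "card (X \<inter> P) \<le> card P" using fin by (simp_all add: card_mono)
  have "card (X - P) = card X - card (X \<inter> P)" "card (P - X) = card P - card (X \<inter> P)"
    using fin by (simp_all add: card_Diff_subset_Int Int_commute)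
  then have XP: "int (card (X - P)) = int (card X) - a" "int (card (P - X)) = int (card P) - a" using a le by simp_all
  have "card ({..<n} - (X \<union> P)) = n - card (X \<union> P)" using sub fin by (subst card_Diff_subset) auto
  moreover have "card (X \<union> P) \<le> n" using sub card_mono[of "{..<n}" "X \<union> P"] by simp
  moreover have "card (X \<union> P) + card (X \<inter> P) = card X + card P" using card_Un_Int[OF fin] by simp
  ultimately have O: "int (card ({..<n} - (X \<union> P))) = int n - int (card P) - int (card X) + a" using a by simp
  have "finite (X \<inter> P)" using fin by simp
  moreover have "0 \<le> e" "e \<le> int (card (X \<inter> P))" using  a e by linarith+
  ultimately obtain A where A: "A \<subseteq> X \<inter> P" "int (card A) = e" "finite A"
    using ex_subset_of_card[of "X \<inter> P"] by metis
  have "finite (P - X)" using fin by simp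
  moreover have "0 \<le> r - e" "r - e \<le> int (card (P - X))" using  XP e by linarith+
  ultimately obtain B where B: "B \<subseteq> P - X" "int (card B) = r - e" "finite B"
    using ex_subset_of_card[of "P - X"] by metis
  have "finite (X - P)" using fin by simp
  moreover have "0 \<le> s' - e" "s' - e \<le> int (card (X - P))" using  XP e by linarith+
  ultimately obtain C where C: "C \<subseteq> X - P" "int (card C) = s' - e" "finite C"
    using ex_subset_of_card[of "X - P"] by metis
  have "finite ({..<n} - (X \<union> P))" using fin by simp
  moreover have "0 \<le> q' - r - (s' - e)" "q' - r - (s' - e) \<le> int (card ({..<n} - (X \<union> P)))" using O e by linarith+
  ultimately obtain D where D: "D \<subseteq> {..<n} - (X \<union> P)" "int (card D) = q' - r - (s' - e)" "finite D"
    using ex_subset_of_card[of "{..<n} - (X \<union> P)"] by metis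
  let ?Q = "(A \<union> B) \<union> (C \<union> D)"
  show ?thesis
  proof (rule that[of ?Q])
    have "card ?Q = card (A \<union> B) + card (C \<union> D)" using A B C D by (intro card_Un_disjoint) auto
    also have "card (A \<union> B) = card A + card B" using A B by (intro card_Un_disjoint) auto
    also have "card (C \<union> D) = card C + card D" using C D by (intro card_Un_disjoint) auto
    finally show "int (card ?Q) = q'" using A B C D by simp
    have "P \<inter> ?Q = A \<union> B" using A B C D by auto
    moreover have "card (A \<union> B) = card A + card B" using A B by (intro card_Un_disjoint) auto
    ultimately show "int (card (P \<inter> ?Q)) = r" using A B by simp
    have "X \<inter> ?Q = A \<union> C" using A B C D by auto
    moreover have "card (A \<union> C) = card A + card C" using A C by (intro card_Un_disjoint) auto
    ultimately show "int (card (X \<inter> ?Q)) = s'" using A C by simp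
  qed (use A B C D sub in auto)
qed

text \<open>Set aside \<open>y\<close> colours for the apex. Among the rest, give the second path vertex first the colours that the third one
  cannot use, namely those of \<open>Q - P\<close>.\<close>

lemma fill_fan:
  fixes P Q :: "nat set" and n y b2 b3 :: nat
  assumes sub: "P \<subseteq> {..<n}" "Q \<subseteq> {..<n}" and r: "card (P \<inter> Q) = r"
    and cliques: "card P + b2 + y \<le> n" "card Q + b3 + y \<le> n"
    and lower: "card P + card Q + y \<le> n + r" and upper: "r + y + b2 + b3 \<le> n"
  obtains B C Y where "B \<subseteq> {..<n}" "C \<subseteq> {..<n}" "Y \<subseteq> {..<n}" "card B = b2" "card C = b3" "card Y = y"
    "P \<inter> B = {}" "B \<inter> C = {}" "C \<inter> Q = {}" "Y \<inter> P = {}" "Y \<inter> Q = {}" "Y \<inter> B = {}" "Y \<inter> C = {}"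
proof -
  have fin: "finite P" "finite Q" using sub finite_subset by blast+
  have un: "card (P \<union> Q) + r = card P + card Q" using card_Un_Int[OF fin] r by simp
  have "card ({..<n} - (P \<union> Q)) = n - card (P \<union> Q)" using sub fin by (subst card_Diff_subset) auto
  then have "y \<le> card ({..<n} - (P \<union> Q))" using un lower by linarith
  then obtain Y where Y: "Y \<subseteq> {..<n} - (P \<union> Q)" "card Y = y" "finite Y"
    by (rule obtain_subset_with_card_n)
  define U where "U = {..<n} - Y"
  have U: "finite U" "P \<subseteq> U" "Q \<subseteq> U" "U \<subseteq> {..<n}" using sub Y by (auto simp: U_def)
  have "Y \<subseteq> {..<n}" using Y by blast
  then have cardU: "card U + y = n" using Y card_mono[of "{..<n}" Y] unfolding U_def by (simp add: card_Diff_subset)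
  have QP: "card (Q - P) + r = card Q"
    using fin r card_mono[of Q "P \<inter> Q"] by (simp add: card_Diff_subset_Int Int_commute)
  have outQ: "card (U - Q) + card Q = card U" using U fin card_mono[of U Q] by (simp add: card_Diff_subset)
  have outPQ: "card (U - (P \<union> Q)) + card (P \<union> Q) = card U"
    using U fin card_mono[of U "P \<union> Q"] by (simp add: card_Diff_subset)
  obtain B where B: "B \<subseteq> U - P" "card B = b2" "finite B" "b3 \<le> card (U - Q - B)"
  proof (cases "b2 \<le> card (Q - P)")
    case True
    then obtain B where B: "B \<subseteq> Q - P" "card B = b2" "finite B" by (rule obtain_subset_with_card_n)
    then have "U - Q - B = U - Q" by blast
    moreover have "b3 \<le> card (U - Q)" using outQ cardU cliques by linarith
    moreover have "B \<subseteq> U - P" using B U by blast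
    ultimately show ?thesis using that[of B] B by simp
  next
    case False
    then have "b2 - card (Q - P) \<le> card (U - (P \<union> Q))" using outPQ un cardU cliques QP by linarith
    then obtain B' where B': "B' \<subseteq> U - (P \<union> Q)" "card B' = b2 - card (Q - P)" "finite B'"
      by (rule obtain_subset_with_card_n)
    have B'Q: "B' \<subseteq> U - Q" using B' by blast
    have "U - Q - ((Q - P) \<union> B') = (U - Q) - B'" by blast
    then have "card (U - Q - ((Q - P) \<union> B')) = card (U - Q) - card B'" using B' B'Q by (simp add: card_Diff_subset)
    then have "b3 \<le> card (U - Q - ((Q - P) \<union> B'))" using B' outQ QP cardU upper False by linarith
    moreover have "card ((Q - P) \<union> B') = card (Q - P) + card B'"
      using B' fin by (intro card_Un_disjoint) auto
    moreover have "(Q - P) \<union> B' \<subseteq> U - P" using B' U by blast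
    moreover have "card (Q - P) + card B' = b2" using B'(2) False by simp
    moreover have "finite ((Q - P) \<union> B')" using B'(3) fin by simp
    ultimately show ?thesis using that[of "(Q - P) \<union> B'"] by simp
  qed
  obtain C where C: "C \<subseteq> U - Q - B" "card C = b3" by (rule obtain_subset_with_card_n[OF B(4)])
  show ?thesis by (rule that[of B C Y]) (use B C Y U in \<open>auto simp: U_def\<close>)
qed

text \<open>The four lemmas from here concern a bound that comes from the previous block and exceeds the trivial
  bounds. Then the previous bound was not trivial either, and the demand of every vertex on the
  corresponding route through the fan is positive, since otherwise cliques would already cover the rest of
  the route. Long means along the path, short means through the apex.\<close>

lemma inner_step_long:
  fixes n x p q q' y b2 b3 lo h :: int
  assumes c: "q + p \<le> n" "p + b2 + y \<le> n" "b2 + b3 + y \<le> n" "b3 + q' + y \<le> n"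
    and nonneg: "0 \<le> y" "0 \<le> b2" "0 \<le> b3"
    and inv: "lo \<le> q" "lo \<le> x" "h \<le> x" "h + q \<le> n"
    and A: "0 < lo + (p + q' + y + (b2 + b3) - 2 * n)" "x + q' - n < lo + (p + q' + y + (b2 + b3) - 2 * n)"
  shows "0 < lo" "x + q - n < lo" "0 < p" "0 < q'" "0 < b2" "0 < b3"
proof -
  show "0 < lo" using A(1) c(2,4) nonneg(1) by linarith
  show "x + q - n < lo" using A(2) c(1,3) by linarith
  show "0 < p" using A(2) c(3) inv(2) by linarith
  show "0 < q'" using A(1) c(1,3) inv(1) by linarith
  show "0 < b2" using A(1) c(1,4) inv(1) by linarith
  show "0 < b3" using A(2) c(2) inv(2) by linarith
qed

lemma inner_step_short:
  fixes n x p q q' y b2 b3 lo h :: int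
  assumes c: "q + p \<le> n" "p + b2 + y \<le> n" "b2 + b3 + y \<le> n" "b3 + q' + y \<le> n"
    and nonneg: "0 \<le> y" "0 \<le> b2" "0 \<le> b3"
    and inv: "lo \<le> q" "lo \<le> x" "h \<le> x" "h + q \<le> n"
    and A: "0 < h + (p + q' + q + y - 2 * n)" "x + q' - n < h + (p + q' + q + y - 2 * n)"
  shows "0 < h" "x - q < h" "0 < p" "0 < q'" "0 < y"
proof -
  show "0 < h" using A(1) c(1,4) nonneg(3) by linarith
  show "x - q < h" using A(2) c(2) nonneg(2) by linarith
  show "0 < p" using A(1) c(4) inv(4) nonneg(3) by linarith
  show "0 < q'" using A(1) c(2) inv(4) nonneg(2) by linarith
  show "0 < y" using A(2) c(1) inv(3) by linarith
qed

lemma outer_step_long: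
  fixes n x p q q' y b2 b3 lo h :: int
  assumes c: "q + p \<le> n" "p + b2 + y \<le> n" "b2 + b3 + y \<le> n" "b3 + q' + y \<le> n"
    and nonneg: "0 \<le> y" "0 \<le> b2" "0 \<le> b3"
    and inv: "lo \<le> q" "lo \<le> x" "h \<le> x" "h + q \<le> n"
    and A: "0 < h + (p + q + y + (b2 + b3) - 2 * n)" "x - q' < h + (p + q + y + (b2 + b3) - 2 * n)"
  shows "0 < h" "x - q < h" "0 < p" "0 < q'" "0 < b2" "0 < b3"
proof -
  show "0 < h" using A(1) c(1,3) by linarith
  show "x - q < h" using A(2) c(2,4) nonneg(1) by linarith
  show "0 < p" using A(1) c(3) inv(4) by linarith
  show "0 < q'" using A(2) c(1,3) inv(3) by linarith
  show "0 < b2" using A(2) c(1,4) inv(3) by linarith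
  show "0 < b3" using A(1) c(2) inv(4) by linarith
qed

lemma outer_step_short:
  fixes n x p q q' y b2 b3 lo h :: int
  assumes c: "q + p \<le> n" "p + b2 + y \<le> n" "b2 + b3 + y \<le> n" "b3 + q' + y \<le> n"
    and nonneg: "0 \<le> y" "0 \<le> b2" "0 \<le> b3"
    and inv: "lo \<le> q" "lo \<le> x" "h \<le> x" "h + q \<le> n"
    and A: "0 < lo + (p + y - n)" "x - q' < lo + (p + y - n)"
  shows "0 < lo" "x + q - n < lo" "0 < p" "0 < q'" "0 < y"
proof -
  show "0 < lo" using A(1) c(2) nonneg(2) by linarith
  show "x + q - n < lo" using A(2) c(1,4) nonneg(3) by linarith
  show "0 < p" using A(2) c(4) inv(2) nonneg(3) by linarith
  show "0 < q'" using A(2) c(2) inv(2) nonneg(2) by linarith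
  show "0 < y" using A(1) c(1) inv(1) by linarith
qed

text \<open>The least size of the intersection of \<open>X\<close> with the last set \<open>Q\<close> of block \<open>i\<close>, and the least size of \<open>X - Q\<close>. In each
  component the last two terms come from the two routes through the fan: a short route exchanges
  the roles of the intersection and the difference, a long one keeps them.\<close>

primrec overlap_bounds ::
  "int \<Rightarrow> (nat \<Rightarrow> int) \<Rightarrow> (nat \<Rightarrow> int) \<Rightarrow> (nat \<Rightarrow> int) \<Rightarrow> (nat \<Rightarrow> int) \<Rightarrow> nat \<Rightarrow> int \<times> int" where
  "overlap_bounds n p q y m 0 = (q 0, 0)"
| "overlap_bounds n p q y m (Suc i) =
    (let lo = fst (overlap_bounds n p q y m i); h = snd (overlap_bounds n p q y m i) in
     (max (max 0 (q 0 + q (Suc i) - n))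
       (max (lo + (p (Suc i) + q (Suc i) + y (Suc i) + m (Suc i) - 2 * n))
            (h + (p (Suc i) + q (Suc i) + q i + y (Suc i) - 2 * n))),
      max (max 0 (q 0 - q (Suc i)))
       (max (lo + (p (Suc i) + y (Suc i) - n))
            (h + (p (Suc i) + q i + y (Suc i) + m (Suc i) - 2 * n)))))"

text \<open>Demands in a ring of \<open>N\<close> fans that satisfy all clique inequalities. Fan \<open>i\<close> has the path demands \<open>p i, b2 i, b3 i, q i\<close>
  and the apex demand \<open>y i\<close>. The closing block has the demands \<open>b1, bm, q 0\<close>, where \<open>bm\<close> stands for both twins.\<close>

locale fan_ring =
  fixes n N b1 bm :: nat and p q y b2 b3 :: "nat \<Rightarrow> nat"
  assumes link: "\<And>i. i < N \<Longrightarrow> q i + p (Suc i) \<le> n"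
    and fan1: "\<And>i. i < N \<Longrightarrow> p (Suc i) + b2 (Suc i) + y (Suc i) \<le> n"
    and fan2: "\<And>i. i < N \<Longrightarrow> b2 (Suc i) + b3 (Suc i) + y (Suc i) \<le> n"
    and fan3: "\<And>i. i < N \<Longrightarrow> b3 (Suc i) + q (Suc i) + y (Suc i) \<le> n"
    and closing: "q N + b1 \<le> n" "b1 + bm \<le> n" "bm + q 0 \<le> n"
begin

definition bounds :: "nat \<Rightarrow> int \<times> int" where
  "bounds = overlap_bounds (int n) (\<lambda>i. int (p i)) (\<lambda>i. int (q i)) (\<lambda>i. int (y i)) (\<lambda>i. int (b2 i) + int (b3 i))"

definition inner :: "nat \<Rightarrow> int" where "inner i = fst (bounds i)"
definition outer :: "nat \<Rightarrow> int" where "outer i = snd (bounds i)"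

lemma bounds_0: "inner 0 = int (q 0)" "outer 0 = 0"
  by (simp_all add: inner_def outer_def bounds_def)

lemma bounds_Suc:
  "inner (Suc i) = max (max 0 (int (q 0) + int (q (Suc i)) - int n))
       (max (inner i + (int (p (Suc i)) + int (q (Suc i)) + int (y (Suc i)) + (int (b2 (Suc i)) + int (b3 (Suc i))) - 2 * int n))
            (outer i + (int (p (Suc i)) + int (q (Suc i)) + int (q i) + int (y (Suc i)) - 2 * int n)))"
  "outer (Suc i) = max (max 0 (int (q 0) - int (q (Suc i))))
       (max (inner i + (int (p (Suc i)) + int (y (Suc i)) - int n))
            (outer i + (int (p (Suc i)) + int (q i) + int (y (Suc i)) + (int (b2 (Suc i)) + int (b3 (Suc i))) - 2 * int n)))"
  by (simp_all add: inner_def outer_def bounds_def Let_def)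

lemma clique_int:
  assumes "i < N"
  shows "int (q i) + int (p (Suc i)) \<le> int n"
    "int (p (Suc i)) + int (b2 (Suc i)) + int (y (Suc i)) \<le> int n"
    "int (b2 (Suc i)) + int (b3 (Suc i)) + int (y (Suc i)) \<le> int n"
    "int (b3 (Suc i)) + int (q (Suc i)) + int (y (Suc i)) \<le> int n"
  using link[OF assms] fan1[OF assms] fan2[OF assms] fan3[OF assms] by linarith+

lemma q0_le: "int (q 0) \<le> int n" using closing by linarith

lemma fan_sums:
  assumes "i < N"
  shows "int (y (Suc i)) + (int (b2 (Suc i)) + int (b3 (Suc i))) \<le> int n"
    "int (p (Suc i)) + int (y (Suc i)) \<le> int n" "int (q (Suc i)) + int (y (Suc i)) \<le> int n"
    "int (q (Suc i)) \<le> int n"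
    "int (p (Suc i)) + int (q (Suc i)) + 2 * int (y (Suc i)) + (int (b2 (Suc i)) + int (b3 (Suc i))) \<le> 2 * int n"
  using clique_int[OF assms] by linarith+

lemma bounds_inv:
  assumes "i \<le> N"
  shows "0 \<le> inner i \<and> int (q 0) + int (q i) - int n \<le> inner i \<and> 0 \<le> outer i \<and>
    int (q 0) - int (q i) \<le> outer i \<and> inner i \<le> int (q 0) - outer i"
  using assms
proof (induction i)
  case 0
  then show ?case using q0_le by (simp add: bounds_0)
next
  case (Suc i)
  then have i: "i < N" by simp
  have IH: "0 \<le> inner i" "int (q 0) + int (q i) - int n \<le> inner i" "0 \<le> outer i"
    "int (q 0) - int (q i) \<le> outer i" "inner i \<le> int (q 0) - outer i" using Suc by simp_all
  note c = clique_int(1)[OF i] fan_sums(1,2,3,5)[OF i]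
  have nn: "0 \<le> int (b2 (Suc i)) + int (b3 (Suc i))" by simp
  note inv = reach_invariant[OF of_nat_0_le_iff of_nat_0_le_iff of_nat_0_le_iff of_nat_0_le_iff nn
      of_nat_0_le_iff q0_le fan_sums(4)[OF i] c IH bounds_Suc[of i]]
  show ?case by (intro conjI inv)
qed

text \<open>Every overlap between the two bounds is attained by colours on the ends of the blocks such that all
  fans can be filled.\<close>

lemma reachable:
  assumes "i \<le> N" "inner i \<le> s" "s \<le> int (q 0) - outer i"
  shows "\<exists>P Q. Q 0 = {..<q 0} \<and> (\<forall>j\<le>i. Q j \<subseteq> {..<n} \<and> card (Q j) = q j) \<and>
    (\<forall>j<i. P (Suc j) \<subseteq> {..<n} \<and> card (P (Suc j)) = p (Suc j) \<and> P (Suc j) \<inter> Q j = {} \<and>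
       p (Suc j) + q (Suc j) + y (Suc j) \<le> n + card (P (Suc j) \<inter> Q (Suc j)) \<and>
       card (P (Suc j) \<inter> Q (Suc j)) + y (Suc j) + b2 (Suc j) + b3 (Suc j) \<le> n) \<and>
    int (card (Q 0 \<inter> Q i)) = s"
  using assms
proof (induction i arbitrary: s)
  case 0
  then have "s = int (q 0)" by (simp add: bounds_0)
  then show ?case using q0_le by (intro exI[of _ "\<lambda>_. {}"] exI[of _ "\<lambda>_. {..<q 0}"]) auto
next
  case (Suc i)
  then have i: "i < N" by simp
  have inv: "0 \<le> inner i" "int (q 0) + int (q i) - int n \<le> inner i" "0 \<le> outer i"
    "int (q 0) - int (q i) \<le> outer i" "inner i \<le> int (q 0) - outer i" using bounds_inv[of i] i by simp_all
  note c = clique_int(1)[OF i] fan_sums(1,2,3,5)[OF i]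
  have nn: "0 \<le> int (b2 (Suc i)) + int (b3 (Suc i))" by simp
  have s_lo: "0 \<le> s" "int (q 0) + int (q (Suc i)) - int n \<le> s"
    "inner i + (int (p (Suc i)) + int (q (Suc i)) + int (y (Suc i)) + (int (b2 (Suc i)) + int (b3 (Suc i))) - 2 * int n) \<le> s"
    "outer i + (int (p (Suc i)) + int (q (Suc i)) + int (q i) + int (y (Suc i)) - 2 * int n) \<le> s"
    using Suc.prems(2) unfolding bounds_Suc max.bounded_iff by blast+
  have "outer (Suc i) \<le> int (q 0) - s" using Suc.prems(3) by linarith
  then have s_hi: "0 \<le> int (q 0) - s" "int (q 0) - int (q (Suc i)) \<le> int (q 0) - s"
    "inner i + (int (p (Suc i)) + int (y (Suc i)) - int n) \<le> int (q 0) - s"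
    "outer i + (int (p (Suc i)) + int (q i) + int (y (Suc i)) + (int (b2 (Suc i)) + int (b3 (Suc i))) - 2 * int n) \<le> int (q 0) - s"
    unfolding bounds_Suc max.bounded_iff by blast+
  have s_hi': "s \<le> int (q 0)" "s \<le> int (q (Suc i))" using s_hi by linarith+
  obtain s0 a r e where s0: "inner i \<le> s0" "s0 \<le> int (q 0) - outer i"
    and a: "0 \<le> a" "a \<le> int (p (Suc i))" "a \<le> int (q 0) - s0"
      "int (p (Suc i)) - a \<le> int n - int (q i) - int (q 0) + s0"
    and r: "0 \<le> r" "r \<le> int (p (Suc i))" "r \<le> int (q (Suc i))"
      "int (p (Suc i)) + int (q (Suc i)) + int (y (Suc i)) - int n \<le> r"
      "r \<le> int n - int (y (Suc i)) - (int (b2 (Suc i)) + int (b3 (Suc i)))"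
    and e: "0 \<le> e" "e \<le> a" "e \<le> r" "e \<le> s" "r - e \<le> int (p (Suc i)) - a" "s - e \<le> int (q 0) - a"
      "r + s - e \<le> int (q (Suc i))" "int (q (Suc i)) - r - (s - e) \<le> int n - int (p (Suc i)) - int (q 0) + a"
    by (rule block_arithmetic[OF of_nat_0_le_iff of_nat_0_le_iff of_nat_0_le_iff of_nat_0_le_iff nn q0_le
          c inv s_lo s_hi' s_hi(3,4)])
  obtain P Q where Q0: "Q 0 = {..<q 0}" and Q: "\<forall>j\<le>i. Q j \<subseteq> {..<n} \<and> card (Q j) = q j"
    and P: "\<forall>j<i. P (Suc j) \<subseteq> {..<n} \<and> card (P (Suc j)) = p (Suc j) \<and> P (Suc j) \<inter> Q j = {} \<and>
       p (Suc j) + q (Suc j) + y (Suc j) \<le> n + card (P (Suc j) \<inter> Q (Suc j)) \<and>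
       card (P (Suc j) \<inter> Q (Suc j)) + y (Suc j) + b2 (Suc j) + b3 (Suc j) \<le> n"
    and sQ: "int (card (Q 0 \<inter> Q i)) = s0"
    using Suc.IH[of s0] i s0 by (auto simp del: of_nat_eq_iff)
  have sub: "Q 0 \<subseteq> {..<n}" "Q i \<subseteq> {..<n}" "card (Q 0) = q 0" "card (Q i) = q i" using Q by auto
  obtain P' where P': "P' \<subseteq> {..<n}" "P' \<inter> Q i = {}" "int (card P') = int (p (Suc i))" "int (card (Q 0 \<inter> P')) = a"
    by (rule choose_disjoint_set[OF sub(1,2) sQ a(1,2), unfolded sub(3,4), OF a(3,4)])
  have cardP': "card P' = p (Suc i)" using P' by simp
  obtain Q' where Q': "Q' \<subseteq> {..<n}" "int (card Q') = int (q (Suc i))" "int (card (P' \<inter> Q')) = r" "int (card (Q 0 \<inter> Q')) = s"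
    by (rule choose_overlapping_set[OF sub(1) P'(1) P'(4) e(1,2,3,4), unfolded sub(3) cardP', OF e(5,6,7,8)])
  have card_r: "p (Suc i) + q (Suc i) + y (Suc i) \<le> n + card (P' \<inter> Q')"
    "card (P' \<inter> Q') + y (Suc i) + b2 (Suc i) + b3 (Suc i) \<le> n"
    using r(4,5) Q'(3) by linarith+
  let ?P = "P(Suc i := P')" and ?Q = "Q(Suc i := Q')"
  have "\<forall>j\<le>Suc i. ?Q j \<subseteq> {..<n} \<and> card (?Q j) = q j" using Q Q' by (simp add: le_Suc_eq)
  moreover have "\<forall>j<Suc i. ?P (Suc j) \<subseteq> {..<n} \<and> card (?P (Suc j)) = p (Suc j) \<and> ?P (Suc j) \<inter> ?Q j = {} \<and>
       p (Suc j) + q (Suc j) + y (Suc j) \<le> n + card (?P (Suc j) \<inter> ?Q (Suc j)) \<and>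
       card (?P (Suc j) \<inter> ?Q (Suc j)) + y (Suc j) + b2 (Suc j) + b3 (Suc j) \<le> n"
    using P P' cardP' card_r by (simp add: less_Suc_eq)
  moreover have "int (card (?Q 0 \<inter> ?Q (Suc i))) = s" using Q' by simp
  ultimately show ?case using Q0 by (intro exI[of _ ?P] exI[of _ ?Q]) simp
qed

text \<open>Up to block \<open>i\<close>, all demands are positive on the route that passes through the apexes of the
  fans in \<open>S\<close> and along the paths of the others.\<close>

definition traversed :: "nat \<Rightarrow> nat set \<Rightarrow> bool" where
  "traversed i S \<longleftrightarrow> S \<subseteq> {1..i} \<and> 0 < q 0 \<and>
     (\<forall>j\<in>{1..i}. 0 < p j \<and> 0 < q j \<and> (j \<in> S \<longrightarrow> 0 < y j) \<and> (j \<notin> S \<longrightarrow> 0 < b2 j \<and> 0 < b3 j))"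

definition weight :: "nat \<Rightarrow> nat set \<Rightarrow> int" where
  "weight i S = int (q 0) + (\<Sum>j\<in>{1..i}. int (p j) + int (q j) + int (y j) - int n) +
     (\<Sum>j\<in>{1..i} - S. int (b2 j) + int (b3 j) - int n) - int n * int (card S div 2)"

lemma traversed_long:
  assumes "traversed i S" "0 < p (Suc i)" "0 < q (Suc i)" "0 < b2 (Suc i)" "0 < b3 (Suc i)"
  shows "traversed (Suc i) S"
    "weight (Suc i) S = weight i S + (int (p (Suc i)) + int (q (Suc i)) + int (y (Suc i)) - int n) +
      (int (b2 (Suc i)) + int (b3 (Suc i)) - int n)"
proof -
  have S: "S \<subseteq> {1..i}" using assms by (simp add: traversed_def)
  then have "Suc i \<notin> S" by auto
  then show "traversed (Suc i) S" using assms unfolding traversed_def by (auto simp: atLeastAtMostSuc_conv)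
  have "{1..Suc i} - S = insert (Suc i) ({1..i} - S)" using S by auto
  then show "weight (Suc i) S = weight i S + (int (p (Suc i)) + int (q (Suc i)) + int (y (Suc i)) - int n) +
      (int (b2 (Suc i)) + int (b3 (Suc i)) - int n)"
    by (simp add: weight_def)
qed

lemma traversed_short:
  assumes "traversed i S" "0 < p (Suc i)" "0 < q (Suc i)" "0 < y (Suc i)"
  shows "traversed (Suc i) (insert (Suc i) S)" "card (insert (Suc i) S) = Suc (card S)"
    "weight (Suc i) (insert (Suc i) S) = weight i S + (int (p (Suc i)) + int (q (Suc i)) + int (y (Suc i)) - int n) -
      (if odd (card S) then int n else 0)"
proof -
  have S: "S \<subseteq> {1..i}" using assms by (simp add: traversed_def)
  show "traversed (Suc i) (insert (Suc i) S)" using assms unfolding traversed_def by (auto simp: atLeastAtMostSuc_conv)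
  have "finite S" "Suc i \<notin> S" using S finite_subset by auto
  then show card: "card (insert (Suc i) S) = Suc (card S)" by simp
  have D: "{1..Suc i} - insert (Suc i) S = {1..i} - S" by auto
  have "Suc (card S) div 2 = card S div 2 + (if odd (card S) then 1 else 0)" by (auto elim!: oddE evenE)
  then show "weight (Suc i) (insert (Suc i) S) = weight i S + (int (p (Suc i)) + int (q (Suc i)) + int (y (Suc i)) - int n) -
      (if odd (card S) then int n else 0)"
    unfolding weight_def card D by (simp add: algebra_simps)
qed

text \<open>A bound that is not trivial stems from a route: an even number of short fans leads from the
  intersection bound back to itself, an odd number to the bound for the difference.\<close>

lemma bounds_realised:
  assumes "i \<le> N"
  shows "(inner i \<le> max 0 (int (q 0) + int (q i) - int n) \<or>
      (\<exists>S. traversed i S \<and> even (card S) \<and> inner i = weight i S)) \<and>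
    (outer i \<le> max 0 (int (q 0) - int (q i)) \<or>
      (\<exists>S. traversed i S \<and> odd (card S) \<and> outer i = weight i S - int (q i)))"
  using assms
proof (induction i)
  case 0
  have "traversed 0 {} \<and> even (card ({} :: nat set)) \<and> inner 0 = weight 0 {}" if "0 < q 0"
    using that by (simp add: traversed_def weight_def bounds_0)
  moreover have "inner 0 \<le> max 0 (int (q 0) + int (q 0) - int n)" if "q 0 = 0" using that by (simp add: bounds_0)
  moreover have "outer 0 \<le> max 0 (int (q 0) - int (q 0))" by (simp add: bounds_0)
  ultimately show ?case by (metis gr0I)
next
  case (Suc i)
  then have i: "i < N" by simp
  have inv0: "0 \<le> inner i" "int (q 0) + int (q i) - int n \<le> inner i" "0 \<le> outer i"
    "int (q 0) - int (q i) \<le> outer i" "inner i \<le> int (q 0) - outer i" using bounds_inv[of i] i by simp_all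
  then have inv: "inner i \<le> int (q i)" "inner i \<le> int (q 0)" "outer i \<le> int (q 0)" "outer i + int (q i) \<le> int n"
    by linarith+
  note pre = clique_int[OF i] of_nat_0_le_iff[of "y (Suc i)"] of_nat_0_le_iff[of "b2 (Suc i)"] of_nat_0_le_iff[of "b3 (Suc i)"] inv
  have IH_inner: "\<exists>S. traversed i S \<and> even (card S) \<and> inner i = weight i S"
    if "0 < inner i" "int (q 0) + int (q i) - int n < inner i"
    using Suc i that by (auto simp: max_def split: if_splits)
  have IH_outer: "\<exists>S. traversed i S \<and> odd (card S) \<and> outer i = weight i S - int (q i)"
    if "0 < outer i" "int (q 0) - int (q i) < outer i"
    using Suc i that by (auto simp: max_def split: if_splits)
  let ?al = "inner i + (int (p (Suc i)) + int (q (Suc i)) + int (y (Suc i)) + (int (b2 (Suc i)) + int (b3 (Suc i))) - 2 * int n)"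
  let ?be = "outer i + (int (p (Suc i)) + int (q (Suc i)) + int (q i) + int (y (Suc i)) - 2 * int n)"
  let ?ga = "inner i + (int (p (Suc i)) + int (y (Suc i)) - int n)"
  let ?de = "outer i + (int (p (Suc i)) + int (q i) + int (y (Suc i)) + (int (b2 (Suc i)) + int (b3 (Suc i))) - 2 * int n)"
  have "\<exists>S. traversed (Suc i) S \<and> even (card S) \<and> inner (Suc i) = weight (Suc i) S"
    if big: "\<not> inner (Suc i) \<le> max 0 (int (q 0) + int (q (Suc i)) - int n)"
  proof -
    have pos: "0 < inner (Suc i)" "int (q 0) + int (q (Suc i)) - int n < inner (Suc i)" using big by simp_all
    have "inner (Suc i) = max ?al ?be" using big unfolding bounds_Suc(1) by linarith
    then consider "inner (Suc i) = ?al" | "inner (Suc i) = ?be" by (metis max_def)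
    then show ?thesis
    proof cases
      case 1
      note st = inner_step_long[OF pre pos[unfolded 1]]
      obtain S where S: "traversed i S" "even (card S)" "inner i = weight i S" using IH_inner[OF st(1,2)] by blast
      have "0 < p (Suc i)" "0 < q (Suc i)" "0 < b2 (Suc i)" "0 < b3 (Suc i)" using st(3-6) by simp_all
      note tr = traversed_long[OF S(1) this]
      show ?thesis using tr S(2) unfolding 1 S(3) by (intro exI[of _ S]) simp
    next
      case 2
      note st = inner_step_short[OF pre pos[unfolded 2]]
      obtain S where S: "traversed i S" "odd (card S)" "outer i = weight i S - int (q i)" using IH_outer[OF st(1,2)] by blast
      have "0 < p (Suc i)" "0 < q (Suc i)" "0 < y (Suc i)" using st(3-5) by simp_all
      note tr = traversed_short[OF S(1) this]
      show ?thesis using tr S(2) unfolding 2 S(3) by (intro exI[of _ "insert (Suc i) S"]) simp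
    qed
  qed
  moreover have "\<exists>S. traversed (Suc i) S \<and> odd (card S) \<and> outer (Suc i) = weight (Suc i) S - int (q (Suc i))"
    if big: "\<not> outer (Suc i) \<le> max 0 (int (q 0) - int (q (Suc i)))"
  proof -
    have pos: "0 < outer (Suc i)" "int (q 0) - int (q (Suc i)) < outer (Suc i)" using big by simp_all
    have "outer (Suc i) = max ?ga ?de" using big unfolding bounds_Suc(2) by linarith
    then consider "outer (Suc i) = ?ga" | "outer (Suc i) = ?de" by (metis max_def)
    then show ?thesis
    proof cases
      case 1
      note st = outer_step_short[OF pre pos[unfolded 1]]
      obtain S where S: "traversed i S" "even (card S)" "inner i = weight i S" using IH_inner[OF st(1,2)] by blast
      have "0 < p (Suc i)" "0 < q (Suc i)" "0 < y (Suc i)" using st(3-5) by simp_all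
      note tr = traversed_short[OF S(1) this]
      show ?thesis using tr S(2) unfolding 1 S(3) by (intro exI[of _ "insert (Suc i) S"]) simp
    next
      case 2
      note st = outer_step_long[OF pre pos[unfolded 2]]
      obtain S where S: "traversed i S" "odd (card S)" "outer i = weight i S - int (q i)" using IH_outer[OF st(1,2)] by blast
      have "0 < p (Suc i)" "0 < q (Suc i)" "0 < b2 (Suc i)" "0 < b3 (Suc i)" using st(3-6) by simp_all
      note tr = traversed_long[OF S(1) this]
      show ?thesis using tr S(2) unfolding 2 S(3) by (intro exI[of _ S]) simp
    qed
  qed
  ultimately show ?case by blast
qed

text \<open>The demand outside the middle vertices of the fans in \<open>S\<close>.\<close>

definition total :: "nat set \<Rightarrow> nat" where
  "total S = q 0 + b1 + bm + (\<Sum>j\<in>{1..N}. p j + q j + y j) + (\<Sum>j\<in>{1..N} - S. b2 j + b3 j)"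

definition ring_coloring :: "(nat \<Rightarrow> nat set) \<Rightarrow> (nat \<Rightarrow> nat set) \<Rightarrow> (nat \<Rightarrow> nat set) \<Rightarrow> (nat \<Rightarrow> nat set) \<Rightarrow>
    (nat \<Rightarrow> nat set) \<Rightarrow> nat set \<Rightarrow> nat set \<Rightarrow> bool" where
  "ring_coloring P B C Q Y A M \<longleftrightarrow>
     Q 0 \<subseteq> {..<n} \<and> card (Q 0) = q 0 \<and> A \<subseteq> {..<n} \<and> card A = b1 \<and> M \<subseteq> {..<n} \<and> card M = bm \<and>
     A \<inter> M = {} \<and> M \<inter> Q 0 = {} \<and> Q N \<inter> A = {} \<and>
     (\<forall>i<N. P (Suc i) \<subseteq> {..<n} \<and> B (Suc i) \<subseteq> {..<n} \<and> C (Suc i) \<subseteq> {..<n} \<and> Q (Suc i) \<subseteq> {..<n} \<and> Y (Suc i) \<subseteq> {..<n} \<and>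
       card (P (Suc i)) = p (Suc i) \<and> card (B (Suc i)) = b2 (Suc i) \<and> card (C (Suc i)) = b3 (Suc i) \<and>
       card (Q (Suc i)) = q (Suc i) \<and> card (Y (Suc i)) = y (Suc i) \<and>
       Q i \<inter> P (Suc i) = {} \<and> P (Suc i) \<inter> B (Suc i) = {} \<and> B (Suc i) \<inter> C (Suc i) = {} \<and> C (Suc i) \<inter> Q (Suc i) = {} \<and>
       Y (Suc i) \<inter> P (Suc i) = {} \<and> Y (Suc i) \<inter> B (Suc i) = {} \<and> Y (Suc i) \<inter> C (Suc i) = {} \<and> Y (Suc i) \<inter> Q (Suc i) = {})"

text \<open>The ring closes up if the smallest overlap of the first and the last set leaves enough room for the
  twins. If it does not, that overlap is a nontrivial bound, so it comes from a route with an even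
  number of short fans, and this route violates its inequality.\<close>

theorem ring_coloring_or_violation:
  "(\<exists>P B C Q Y A M. ring_coloring P B C Q Y A M) \<or>
   (\<exists>S. traversed N S \<and> 0 < b1 \<and> 0 < bm \<and> even (card S) \<and> n * (2 * N + 1) < total S + n * (card S div 2))"
proof (cases "inner N \<le> int n - int b1 - int bm")
  case True
  have inv: "0 \<le> inner N" "int (q 0) + int (q N) - int n \<le> inner N" "0 \<le> outer N"
    "int (q 0) - int (q N) \<le> outer N" "inner N \<le> int (q 0) - outer N" using bounds_inv[of N] by simp_all
  have "\<exists>P Q. Q 0 = {..<q 0} \<and> (\<forall>j\<le>N. Q j \<subseteq> {..<n} \<and> card (Q j) = q j) \<and>
    (\<forall>j<N. P (Suc j) \<subseteq> {..<n} \<and> card (P (Suc j)) = p (Suc j) \<and> P (Suc j) \<inter> Q j = {} \<and>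
       p (Suc j) + q (Suc j) + y (Suc j) \<le> n + card (P (Suc j) \<inter> Q (Suc j)) \<and>
       card (P (Suc j) \<inter> Q (Suc j)) + y (Suc j) + b2 (Suc j) + b3 (Suc j) \<le> n) \<and>
    int (card (Q 0 \<inter> Q N)) = inner N"
    by (rule reachable[OF order_refl order_refl inv(5)])
  then obtain P Q where Q0: "Q 0 = {..<q 0}" and Q: "\<forall>j\<le>N. Q j \<subseteq> {..<n} \<and> card (Q j) = q j"
    and P: "\<forall>j<N. P (Suc j) \<subseteq> {..<n} \<and> card (P (Suc j)) = p (Suc j) \<and> P (Suc j) \<inter> Q j = {} \<and>
       p (Suc j) + q (Suc j) + y (Suc j) \<le> n + card (P (Suc j) \<inter> Q (Suc j)) \<and>
       card (P (Suc j) \<inter> Q (Suc j)) + y (Suc j) + b2 (Suc j) + b3 (Suc j) \<le> n"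
    and sQ: "int (card (Q 0 \<inter> Q N)) = inner N"
    by (elim exE conjE)
  have sub: "Q 0 \<subseteq> {..<n}" "Q N \<subseteq> {..<n}" "card (Q 0) = q 0" "card (Q N) = q N" using Q by auto
  define a where "a = min (int b1) (int (q 0) - inner N)"
  have a_cases: "a = int b1 \<or> a = int (q 0) - inner N" unfolding a_def by linarith
  have a: "0 \<le> a" "a \<le> int b1" "a \<le> int (q 0) - inner N" unfolding a_def using inv by linarith+
  have a4: "int b1 - a \<le> int n - int (q N) - int (q 0) + inner N"
    using a_cases inv(2) closing(1) by (elim disjE; linarith)
  have a5: "int b1 + int (q 0) + int bm - int n \<le> a"
    using a_cases True closing(3) by (elim disjE; linarith)
  obtain A where A: "A \<subseteq> {..<n}" "A \<inter> Q N = {}" "int (card A) = int b1" "int (card (Q 0 \<inter> A)) = a"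
    by (rule choose_disjoint_set[OF sub(1,2) sQ a(1,2), unfolded sub(3,4), OF a(3) a4])
  have fin: "finite (Q 0)" "finite A" using sub A finite_subset by blast+
  have "card ({..<n} - (Q 0 \<union> A)) = n - card (Q 0 \<union> A)" using sub A fin by (subst card_Diff_subset) auto
  moreover have "card (Q 0 \<union> A) + card (Q 0 \<inter> A) = card (Q 0) + card A" using card_Un_Int[OF fin] by simp
  ultimately have "bm \<le> card ({..<n} - (Q 0 \<union> A))" using A(3,4) a5 sub(3) by linarith
  then obtain M where M: "M \<subseteq> {..<n} - (Q 0 \<union> A)" "card M = bm" by (rule obtain_subset_with_card_n)
  define fill where "fill i B C Y \<longleftrightarrow> B \<subseteq> {..<n} \<and> C \<subseteq> {..<n} \<and> Y \<subseteq> {..<n} \<and>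
      card B = b2 (Suc i) \<and> card C = b3 (Suc i) \<and> card Y = y (Suc i) \<and>
      P (Suc i) \<inter> B = {} \<and> B \<inter> C = {} \<and> C \<inter> Q (Suc i) = {} \<and>
      Y \<inter> P (Suc i) = {} \<and> Y \<inter> B = {} \<and> Y \<inter> C = {} \<and> Y \<inter> Q (Suc i) = {}" for i B C Y
  have "\<exists>B C Y. fill i B C Y" if i: "i < N" for i
  proof -
    have PQ: "P (Suc i) \<subseteq> {..<n}" "Q (Suc i) \<subseteq> {..<n}" "card (P (Suc i)) = p (Suc i)" "card (Q (Suc i)) = q (Suc i)"
      "p (Suc i) + q (Suc i) + y (Suc i) \<le> n + card (P (Suc i) \<inter> Q (Suc i))"
      "card (P (Suc i) \<inter> Q (Suc i)) + y (Suc i) + b2 (Suc i) + b3 (Suc i) \<le> n"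
      using P Q i by simp_all
    have "q (Suc i) + b3 (Suc i) + y (Suc i) \<le> n" using fan3[OF i] by linarith
    note fan = fan1[OF i] this PQ(5,6)
    obtain B C Y where f: "B \<subseteq> {..<n}" "C \<subseteq> {..<n}" "Y \<subseteq> {..<n}" "card B = b2 (Suc i)" "card C = b3 (Suc i)" "card Y = y (Suc i)"
      "P (Suc i) \<inter> B = {}" "B \<inter> C = {}" "C \<inter> Q (Suc i) = {}" "Y \<inter> P (Suc i) = {}" "Y \<inter> Q (Suc i) = {}" "Y \<inter> B = {}" "Y \<inter> C = {}"
      by (rule fill_fan[OF PQ(1,2) refl, unfolded PQ(3,4), OF fan])
    have "fill i B C Y" unfolding fill_def by (intro conjI f)
    then show ?thesis by (intro exI)
  qed
  then have "\<exists>B C Y. \<forall>i<N. fill i (B i) (C i) (Y i)" by metis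
  then obtain B C Y where BCY: "\<forall>i<N. fill i (B i) (C i) (Y i)" by (elim exE)
  have "ring_coloring P (\<lambda>i. B (i - 1)) (\<lambda>i. C (i - 1)) Q (\<lambda>i. Y (i - 1)) A M"
    unfolding ring_coloring_def
  proof (intro conjI allI impI)
    show "Q 0 \<subseteq> {..<n}" "card (Q 0) = q 0" "A \<subseteq> {..<n}" "card A = b1" "card M = bm" using sub A M by simp_all
    show "A \<inter> M = {}" "M \<inter> Q 0 = {}" "M \<subseteq> {..<n}" using M by blast+
    show "Q N \<inter> A = {}" using A(2) by blast
    fix i assume i: "i < N"
    show "P (Suc i) \<subseteq> {..<n}" "card (P (Suc i)) = p (Suc i)" "Q (Suc i) \<subseteq> {..<n}" "card (Q (Suc i)) = q (Suc i)"
      using P Q i by simp_all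
    have "P (Suc i) \<inter> Q i = {}" using P i by simp
    then show "Q i \<inter> P (Suc i) = {}" by blast
  qed (use BCY in \<open>simp_all add: fill_def\<close>)
  then show ?thesis by (intro disjI1 exI)
next
  case False
  have inv: "inner N \<le> int (q N)" "inner N \<le> int (q 0)" using bounds_inv[of N] by linarith+
  have "\<not> inner N \<le> max 0 (int (q 0) + int (q N) - int n)" using False closing by linarith
  then obtain S where S: "traversed N S" "even (card S)" "inner N = weight N S" using bounds_realised[of N] by blast
  have pos: "0 < b1" "0 < bm"
    using False inv(2) closing(3) False inv(1) closing(1) by linarith+
  have sub: "S \<subseteq> {1..N}" using S by (simp add: traversed_def)
  then have "card ({1..N} - S) = N - card S" "card S \<le> N"
    using finite_subset[OF sub] card_mono[OF _ sub] by (simp_all add: card_Diff_subset)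
  then have card: "int (card ({1..N} - S)) = int N - int (card S)" by simp
  have "weight N S = int (q 0) + int (\<Sum>j\<in>{1..N}. p j + q j + y j) - int n * int N +
      int (\<Sum>j\<in>{1..N} - S. b2 j + b3 j) - int n * (int N - int (card S)) - int n * int (card S div 2)"
    unfolding weight_def sum_subtractf by (simp add: card[unfolded One_nat_def] mult.commute)
  then have "int n * int N + int n * (int N - int (card S)) + int n * int (card S div 2) + int n < int (total S)"
    using False S(3) by (simp add: total_def)
  moreover have "int (card S) = 2 * int (card S div 2)" using S(2) by (auto elim!: evenE)
  ultimately have "int n * (2 * int N + 1) < int (total S) + int n * int (card S div 2)"
    by (simp add: algebra_simps)
  then have "int (n * (2 * N + 1)) < int (total S + n * (card S div 2))"
    by (simp only: of_nat_add of_nat_mult of_nat_numeral of_nat_1)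
  then have "n * (2 * N + 1) < total S + n * (card S div 2)" unfolding of_nat_less_iff .
  then show ?thesis using S pos by blast
qed

end

section \<open>Odd holes of \<open>H\<^sub>t\<close> are critical\<close>

text \<open>Used to number the vertices of a hole in the order in which they are met.\<close>

lemma rank_bij:
  fixes key :: "'v \<Rightarrow> nat"
  assumes fin: "finite R" and inj: "inj_on key R"
  shows "bij_betw (\<lambda>v. card {w \<in> R. key w < key v}) R {..<card R}"
proof -
  let ?\<rho> = "\<lambda>v. card {w \<in> R. key w < key v}"
  have less: "?\<rho> u < ?\<rho> v" if "u \<in> R" "key u < key v" for u v
    by (rule psubset_card_mono) (use fin that in auto)
  have "inj_on ?\<rho> R"
  proof (rule inj_onI)
    fix u v assume uv: "u \<in> R" "v \<in> R" "?\<rho> u = ?\<rho> v"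
    have "key u = key v"
    proof (rule ccontr)
      assume "key u \<noteq> key v"
      then consider "key u < key v" | "key v < key u" by linarith
      then show False
      proof cases
        case 1
        from less[OF uv(1) this] uv(3) show False by simp
      next
        case 2
        from less[OF uv(2) this] uv(3) show False by simp
      qed
    qed
    then show "u = v" using inj_onD[OF inj _ uv(1,2)] by blast
  qed
  moreover have "?\<rho> v < card R" if "v \<in> R" for v
    by (rule psubset_card_mono) (use fin that in auto)
  then have "?\<rho> ` R \<subseteq> {..<card R}" by auto
  moreover have "card (?\<rho> ` R) = card {..<card R}" using card_image[OF \<open>inj_on ?\<rho> R\<close>] by simp
  ultimately show ?thesis unfolding bij_betw_def by (metis card_subset_eq finite_lessThan)
qed

lemma rank_next:
  fixes key :: "'v \<Rightarrow> nat"
  assumes fin: "finite R" and inj: "inj_on key R" and uv: "u \<in> R" "key u < key v"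
    and between: "\<And>w. w \<in> R \<Longrightarrow> key u < key w \<Longrightarrow> key w < key v \<Longrightarrow> False"
  shows "card {w \<in> R. key w < key v} = card {w \<in> R. key w < key u} + 1"
proof -
  have "w = u \<or> key w < key u" if "w \<in> R" "key w < key v" for w
    using between[OF that(1)] that inj_onD[OF inj _ that(1) uv(1)] by (meson linorder_neqE_nat)
  then have "{w \<in> R. key w < key v} = insert u {w \<in> R. key w < key u}" using uv by auto
  then show ?thesis using fin by simp
qed

lemma rank_diff_le:
  fixes key :: "'v \<Rightarrow> nat"
  assumes fin: "finite R" and inj: "inj_on key R" and le: "key u \<le> key v"
  shows "card {w \<in> R. key w < key u} \<le> card {w \<in> R. key w < key v}"
    and "card {w \<in> R. key w < key v} \<le> card {w \<in> R. key w < key u} + (key v - key u)"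
proof -
  show "card {w \<in> R. key w < key u} \<le> card {w \<in> R. key w < key v}"
    by (rule card_mono) (use fin le in auto)
  have "{w \<in> R. key w < key v} \<subseteq> {w \<in> R. key w < key u} \<union> {w \<in> R. key u \<le> key w \<and> key w < key v}" by auto
  then have "card {w \<in> R. key w < key v} \<le> card ({w \<in> R. key w < key u} \<union> {w \<in> R. key u \<le> key w \<and> key w < key v})"
    using fin by (intro card_mono) auto
  also have "\<dots> \<le> card {w \<in> R. key w < key u} + card {w \<in> R. key u \<le> key w \<and> key w < key v}"
    by (rule card_Un_le)
  also have "card {w \<in> R. key u \<le> key w \<and> key w < key v} \<le> card {key u..<key v}"
    by (rule card_inj_on_le[where f = key]) (use inj in \<open>auto simp: inj_on_def\<close>)
  finally show "card {w \<in> R. key w < key v} \<le> card {w \<in> R. key w < key u} + (key v - key u)" by simp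
qed

lemma cyclic_neighbours_sym: "cyclic_neighbours k r s \<Longrightarrow> cyclic_neighbours k s r"
  unfolding cyclic_neighbours_def by blast

text \<open>\<open>W\<close> contains the hole that passes through the apexes of the fans in \<open>S\<close> and uses one of the twins \<open>x\<^sub>2\<close>, \<open>y\<^sub>1\<close>. Its length is
  \<open>cycle_length t - card S\<close>.\<close>

definition spans_odd_hole :: "nat \<Rightarrow> nat set \<Rightarrow> vertex set \<Rightarrow> bool" where
  "spans_odd_hole t S W \<longleftrightarrow> S \<subseteq> {1..<t} \<and> even (card S) \<and> Xv 1 \<in> W \<and> Xv 3 \<in> W \<and>
     (Xv 2 \<in> W \<or> Yv 1 \<in> W) \<and> (\<forall>k\<in>{4..cycle_length t}. Xv k \<notin> middle S \<longrightarrow> Xv k \<in> W) \<and>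
     (\<forall>j\<in>S. Yv (j + 1) \<in> W)"

lemma card_middle:
  assumes "finite S"
  shows "card (middle S) = 2 * card S" "finite (middle S)"
proof -
  have eq: "middle S = (\<lambda>j. Xv (4 * j + 1)) ` S \<union> (\<lambda>j. Xv (4 * j + 2)) ` S"
  proof (rule Set.set_eqI)
    fix v
    show "v \<in> middle S \<longleftrightarrow> v \<in> (\<lambda>j. Xv (4 * j + 1)) ` S \<union> (\<lambda>j. Xv (4 * j + 2)) ` S"
    proof
      assume "v \<in> middle S"
      then obtain k where k: "v = Xv k" "k mod 4 = 1 \<or> k mod 4 = 2" "k div 4 \<in> S" by (auto simp: middle_def)
      have "k = 4 * (k div 4) + k mod 4" by simp
      then have "v = Xv (4 * (k div 4) + 1) \<or> v = Xv (4 * (k div 4) + 2)" using k by metis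
      then show "v \<in> (\<lambda>j. Xv (4 * j + 1)) ` S \<union> (\<lambda>j. Xv (4 * j + 2)) ` S" using k(3) by blast
    next
      assume "v \<in> (\<lambda>j. Xv (4 * j + 1)) ` S \<union> (\<lambda>j. Xv (4 * j + 2)) ` S"
      then obtain j where j: "j \<in> S" "v = Xv (4 * j + 1) \<or> v = Xv (4 * j + 2)" by blast
      then show "v \<in> middle S" using middle_simps(4,5)[of j S] by (elim disjE) (simp_all only:)
    qed
  qed
  have ne: "4 * i + 1 \<noteq> 4 * j + 2" for i j :: nat by presburger
  have "card (middle S) = card ((\<lambda>j. Xv (4 * j + 1)) ` S) + card ((\<lambda>j. Xv (4 * j + 2)) ` S)"
    unfolding eq using assms ne by (intro card_Un_disjoint) auto
  also have "card ((\<lambda>j. Xv (4 * j + 1)) ` S) = card S" by (rule card_image) (simp add: inj_on_def)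
  also have "card ((\<lambda>j. Xv (4 * j + 2)) ` S) = card S" by (rule card_image) (simp add: inj_on_def)
  finally show "card (middle S) = 2 * card S" by simp
  show "finite (middle S)" unfolding eq using assms by simp
qed

text \<open>The vertices outside the hole are the unused twin and apexes of fans traversed along their path.
  The order on the hole is given by \<open>key\<close>, which places an apex between the two end vertices of its
  fan and the chosen twin at position two.\<close>

lemma odd_hole_critical_H:
  assumes t: "t \<ge> 1" and W: "W \<subseteq> verts (H t)" and span: "spans_odd_hole t S W"
    and mid: "W \<inter> middle S = {}" and n: "n \<ge> t + 2"
  shows "critical (H t) n W"
proof -
  have S: "S \<subseteq> {1..<t}" "even (card S)" and W13: "Xv 1 \<in> W" "Xv 3 \<in> W" and W2: "Xv 2 \<in> W \<or> Yv 1 \<in> W"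
    and WX: "\<And>k. k \<in> {4..cycle_length t} \<Longrightarrow> Xv k \<notin> middle S \<Longrightarrow> Xv k \<in> W"
    and WY: "\<And>j. j \<in> S \<Longrightarrow> Yv (j + 1) \<in> W"
    using span unfolding spans_odd_hole_def by blast+
  have finS: "finite S" using S finite_subset by blast
  have cS: "card S \<le> t - 1" using card_mono[OF _ S(1)] by simp
  define L where "L = cycle_length t"
  have L_cases: "L = 5 \<and> t = 1 \<or> L = 4 * t - 1 \<and> 2 \<le> t"
    using t unfolding L_def cycle_length_def by auto
  then have L: "odd L" "L \<ge> 5 + card S" "L \<ge> 1 + 2 * card S"
    using cS by (elim disjE conjE; simp)+
  have L5: "4 * j + 3 \<le> L" if "j \<in> {1..<t}" for j
  proof -
    have "1 \<le> j" "j + 1 \<le> t" using that by auto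
    then show ?thesis using L_cases by (elim disjE conjE) linarith+
  qed
  have L4: "4 * j + 3 \<le> L" if "j \<in> S" for j
    by (rule L5[OF subsetD[OF S(1) that]])
  define z where "z = (if Xv 2 \<in> W then Xv 2 else Yv 1)"
  have zW: "z \<in> W" using W2 by (auto simp: z_def)
  define X where "X = Xv ` {1..L} - ({Xv 2} \<union> middle S)"
  define R where "R = X \<union> ({z} \<union> (\<lambda>j. Yv (j + 1)) ` S)"
  have R_cases: "(\<exists>k. v = Xv k \<and> 1 \<le> k \<and> k \<le> L \<and> k \<noteq> 2 \<and> Xv k \<notin> middle S) \<or> v = z \<or> (\<exists>j\<in>S. v = Yv (j + 1))" if "v \<in> R" for v
    using that unfolding R_def X_def by auto
  have S1: "1 \<le> j" if "j \<in> S" for j using S that by auto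
  have finR: "finite R" using finS by (simp add: R_def X_def)
  have RW: "R \<subseteq> W"
  proof
    fix v assume "v \<in> R"
    from R_cases[OF this] show "v \<in> W"
    proof (elim disjE exE bexE conjE)
      fix k assume k: "v = Xv k" "1 \<le> k" "k \<le> L" "k \<noteq> 2" "Xv k \<notin> middle S"
      then have "k = 1 \<or> k = 3 \<or> k \<in> {4..cycle_length t}" by (auto simp: L_def)
      then show ?thesis using k W13 WX by auto
    qed (use zW WY in auto)
  qed
  define F where "F = W - R"
  have RF: "R \<union> F = W" using RW by (auto simp: F_def)
  have Xv_R: "Xv k \<in> R" if "1 \<le> k" "k \<le> L" "k \<noteq> 2" "Xv k \<notin> middle S" for k
    using that by (auto simp: R_def X_def)
  have cardR: "card R = L - card S"
  proof -
    have m2: "Xv 2 \<notin> middle S" using S1 by (auto simp: middle_def)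
    have "{Xv 2} \<union> middle S \<subseteq> Xv ` {1..L}"
    proof -
      have "Xv k \<in> Xv ` {1..L}" if "Xv k \<in> middle S" for k
      proof -
        have "k mod 4 = 1 \<or> k mod 4 = 2" "k div 4 \<in> S" using that by (auto simp: middle_def)
        moreover from this(2) have "4 * (k div 4) + 3 \<le> L" by (rule L4)
        moreover have "k = 4 * (k div 4) + k mod 4" by simp
        ultimately have "1 \<le> k" "k \<le> L" by linarith+
        then show ?thesis by auto
      qed
      then show ?thesis using L(2) by (auto simp: middle_def)
    qed
    then have "card X = L - card ({Xv 2} \<union> middle S)"
      unfolding X_def using card_middle[OF finS] by (subst card_Diff_subset) (auto simp: card_image inj_on_def)
    also have "card ({Xv 2} \<union> middle S) = 1 + 2 * card S" using m2 card_middle[OF finS] by simp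
    finally have cX: "card X = L - (1 + 2 * card S)" .
    have "z \<notin> (\<lambda>j. Yv (j + 1)) ` S" using S1 by (auto simp: z_def)
    then have "card ({z} \<union> (\<lambda>j. Yv (j + 1)) ` S) = 1 + card S"
      using finS by (simp add: card_image inj_on_def)
    moreover have "card R = card X + card ({z} \<union> (\<lambda>j. Yv (j + 1)) ` S)"
      unfolding R_def by (rule card_Un_disjoint) (use finS in \<open>auto simp: X_def z_def\<close>)
    ultimately show ?thesis using cX L(3) by simp
  qed
  define k where "k = (L - card S) div 2"
  have "odd (L - card S)" using L(1,2) S(2) by simp
  then have k: "2 * k + 1 = L - card S" unfolding k_def by (rule odd_two_times_div_two_succ)
  have k2: "k \<ge> 2" using k L(2) by linarith
  define key where "key v = (case v of Xv k \<Rightarrow> k | Yv i \<Rightarrow> if i = 1 then 2 else 4 * i - 3)" for v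
  have key_z: "key z = 2" by (simp add: key_def z_def)
  have key_X: "key (Xv k) = k" for k by (simp add: key_def)
  have key_Y: "key (Yv (j + 1)) = 4 * j + 1" if "1 \<le> j" for j using that by (simp add: key_def)
  have key_R: "(key v = i) \<longleftrightarrow> v = (if i = 2 then z else if i mod 4 = 1 \<and> i div 4 \<in> S then Yv (i div 4 + 1) else Xv i)"
    if v: "v \<in> R" for v i
    using R_cases[OF v]
  proof (elim disjE exE bexE conjE)
    fix l assume l: "v = Xv l" "l \<noteq> 2" "Xv l \<notin> middle S"
    then have "\<not> (l mod 4 = 1 \<and> l div 4 \<in> S)" by (auto simp: middle_def)
    moreover have "v \<noteq> z" using l by (auto simp: z_def)
    ultimately show ?thesis using l by (auto simp: key_X)
  next
    assume v: "v = z"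
    have "z \<noteq> Xv i" if "i \<noteq> 2" using that by (auto simp: z_def)
    moreover have "z \<noteq> Yv (i div 4 + 1)" if "i div 4 \<in> S" using S1[OF that] by (auto simp: z_def)
    ultimately show ?thesis using v key_z by auto
  next
    fix j assume j: "j \<in> S" "v = Yv (j + 1)"
    have "1 \<le> j" by (rule S1[OF j(1)])
    then have kv: "key v = 4 * j + 1" "v \<noteq> z" using j key_Y by (auto simp: z_def)
    have "i = 4 * j + 1 \<longleftrightarrow> i mod 4 = 1 \<and> i div 4 = j" by presburger
    then show ?thesis using kv j \<open>1 \<le> j\<close> by auto
  qed
  have inj: "inj_on key R"
  proof (rule inj_onI)
    fix u v assume uv: "u \<in> R" "v \<in> R" "key u = key v"
    show "u = v" by (rule trans[OF iffD1[OF key_R[OF uv(1)] uv(3)] iffD1[OF key_R[OF uv(2)] refl, symmetric]])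
  qed
  have key_bounds: "1 \<le> key v \<and> key v \<le> L" if "v \<in> R" for v
    using R_cases[OF that]
  proof (elim disjE exE bexE conjE)
    fix j assume j: "j \<in> S" "v = Yv (j + 1)"
    then show ?thesis using key_Y[OF S1[OF j(1)]] L4[OF j(1)] by simp
  qed (use key_z key_X L in auto)
  define \<rho> where "\<rho> v = card {w \<in> R. key w < key v}" for v
  have rank: "bij_betw \<rho> R {..2 * k}"
    using rank_bij[OF finR inj] unfolding cardR k[symmetric] \<rho>_def by (simp add: lessThan_Suc_atMost)
  have next': "cyclic_neighbours k (\<rho> u) (\<rho> v)"
    if "u \<in> R" "key u < key v" "\<And>w. w \<in> R \<Longrightarrow> key u < key w \<Longrightarrow> key w < key v \<Longrightarrow> False" for u v
  proof -
    have "\<rho> v = \<rho> u + 1"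
      unfolding \<rho>_def by (rule rank_next[OF finR inj that(1,2)]) (rule that(3))
    then show ?thesis unfolding cyclic_neighbours_def by simp
  qed
  have R_edge: "cyclic_neighbours k (\<rho> u) (\<rho> v)" if u: "u \<in> R" and v: "v \<in> R" and e: "{u, v} \<in> edges (H t)" for u v
  proof -
    have sym: "cyclic_neighbours k (\<rho> u) (\<rho> v)" if "{u, v} = {x, y}" "x \<in> R \<Longrightarrow> y \<in> R \<Longrightarrow> cyclic_neighbours k (\<rho> x) (\<rho> y)" for x y
      using that u v cyclic_neighbours_sym by (auto simp: doubleton_eq_iff)
    from e show ?thesis
    proof (cases rule: H_edge_cases)
      case (cycle i)
      show ?thesis by (rule sym[OF cycle(3)], rule next') (auto simp: key_X)
    next
      case closing
      show ?thesis
      proof (rule sym[OF closing])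
        assume last: "Xv (cycle_length t) \<in> R" "Xv 1 \<in> R"
        have first_empty: "{w \<in> R. key w < 1} = {}" using key_bounds by fastforce
        have "\<rho> (Xv 1) = 0" unfolding \<rho>_def key_X first_empty by simp
        moreover have before_last: "{w \<in> R. key w < L} = R - {Xv L}"
        proof -
          have "w = Xv L" if "w \<in> R" "key w = L" for w
            using inj_onD[OF inj _ that(1) last(1)] that(2) by (simp add: key_X L_def)
          then have "key w < L \<longleftrightarrow> w \<noteq> Xv L" if "w \<in> R" for w
            using key_bounds[OF that] key_X[of L] that by (cases "key w = L") auto
          then show ?thesis by blast
        qed
        moreover have "\<rho> (Xv L) = 2 * k"
        proof -
          have "Xv L \<in> R" using last(1) by (simp add: L_def)
          then show ?thesis unfolding \<rho>_def key_X before_last using cardR k finR by simp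
        qed
        ultimately show "cyclic_neighbours k (\<rho> (Xv (cycle_length t))) (\<rho> (Xv 1))"
          by (simp add: cyclic_neighbours_def L_def)
      qed
    next
      case (first j)
      show ?thesis
      proof (rule sym[OF first(2)])
        assume Y1: "Yv 1 \<in> R" and Xj: "Xv j \<in> R"
        have z: "z = Yv 1" using R_cases[OF Y1] S1 by (auto simp: z_def)
        have "Xv 2 \<notin> R" using z S1 by (auto simp: R_def X_def)
        then have "j = 1 \<or> j = 3" using first(1) Xj by auto
        moreover have kY: "key (Yv 1) = 2" using key_z z by simp
        moreover have "cyclic_neighbours k (\<rho> (Xv j)) (\<rho> (Yv 1))" if "j = 1"
          by (rule next'[OF Xj]) (use that kY in \<open>auto simp: key_X\<close>)
        moreover have "cyclic_neighbours k (\<rho> (Yv 1)) (\<rho> (Xv j))" if "j = 3"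
          by (rule next'[OF Y1]) (use that kY in \<open>auto simp: key_X\<close>)
        ultimately show "cyclic_neighbours k (\<rho> (Yv 1)) (\<rho> (Xv j))" using cyclic_neighbours_sym by blast
      qed
    next
      case (later j r)
      show ?thesis
      proof (rule sym[OF later(3)])
        assume Yj: "Yv (j + 1) \<in> R" and Xr: "Xv (4 * j + r) \<in> R"
        have j1: "1 \<le> j" using later(1) by simp
        then have jS: "j \<in> S" using R_cases[OF Yj] by (auto simp: z_def split: if_splits)
        have "Xv (4 * j + r) \<notin> middle S" using Xr RW mid by blast
        then have "r = 0 \<or> r = 3" using later(2) middle_simps(4,5)[of j S] jS by auto
        moreover have kY: "key (Yv (j + 1)) = 4 * j + 1" by (rule key_Y[OF j1])
        moreover have "cyclic_neighbours k (\<rho> (Xv (4 * j + r))) (\<rho> (Yv (j + 1)))" if "r = 0"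
          by (rule next'[OF Xr]) (unfold kY key_X that, simp_all)
        moreover have "cyclic_neighbours k (\<rho> (Yv (j + 1))) (\<rho> (Xv (4 * j + r)))" if r: "r = 3"
        proof (rule next'[OF Yj])
          show "key (Yv (j + 1)) < key (Xv (4 * j + r))" unfolding kY key_X r by simp
          fix w assume w: "w \<in> R" "key (Yv (j + 1)) < key w" "key w < key (Xv (4 * j + r))"
          then have "key w = 4 * j + 2" unfolding kY key_X r by linarith
          moreover have "(4 * j + 2) mod 4 \<noteq> 1" "4 * j + 2 \<noteq> 2" using j1 by presburger+
          ultimately have "w = Xv (4 * j + 2)" using key_R[OF w(1), of "4 * j + 2"] by simp
          moreover have "Xv (4 * j + 2) \<in> middle S" using jS middle_simps(5)[of j S] by blast
          ultimately show False using w(1) RW mid by blast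
        qed
        ultimately show "cyclic_neighbours k (\<rho> (Yv (j + 1))) (\<rho> (Xv (4 * j + r)))" using cyclic_neighbours_sym by blast
      qed
    qed
  qed
  have F_Y: "\<exists>i\<in>{1..t}. y = Yv i" if y: "y \<in> F" for y
  proof (cases y)
    case (Xv l)
    have yW: "y \<in> W" "y \<notin> R" using y by (auto simp: F_def)
    then have "l \<in> {1..L}" using W Xv by (auto simp: verts_H L_def)
    moreover have "l \<noteq> 2" using yW Xv by (auto simp: R_def z_def)
    moreover have "Xv l \<notin> middle S" using yW mid Xv by blast
    ultimately show ?thesis using Xv_R[of l] yW Xv by simp
  qed (use that W in \<open>auto simp: F_def verts_H\<close>)
  have F_edge: "\<exists>j\<le>2 * k. \<forall>v\<in>R. {y, v} \<in> edges (H t) \<longrightarrow> offset k j (\<rho> v) \<le> 3" if y: "y \<in> F" for y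
  proof -
    obtain i where i: "i \<in> {1..t}" "y = Yv i" using F_Y[OF y] by blast
    show ?thesis
    proof (cases "i = 1")
      case True
      have "offset k 0 (\<rho> v) \<le> 3" if v: "v \<in> R" "{y, v} \<in> edges (H t)" for v
      proof -
        have "\<exists>l\<in>{1, 2, 3}. v = Xv l"
          using v(2) by (cases rule: H_edge_cases) (use i True in \<open>auto simp: doubleton_eq_iff\<close>)
        then obtain l where l: "v = Xv l" "l \<le> 3" by auto
        have X1: "{w \<in> R. key w < key (Xv 0)} = {}" by (simp add: key_X)
        have "\<rho> v \<le> card {w \<in> R. key w < key (Xv 0)} + (key v - key (Xv 0))"
          unfolding \<rho>_def by (rule rank_diff_le(2)[OF finR inj]) (simp add: key_X)
        then have "\<rho> v \<le> 3" using X1 l by (simp add: key_X)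
        then show ?thesis by (simp add: offset_def)
      qed
      then show ?thesis by (intro exI[of _ 0]) simp
    next
      case False
      define j where "j = i - 1"
      have j: "j \<in> {1..<t}" "y = Yv (j + 1)" using i False by (auto simp: j_def)
      have R4: "Xv (4 * j) \<in> R" using j L5[OF j(1)] by (intro Xv_R) (auto simp only: middle_simps, simp_all)
      have "offset k (\<rho> (Xv (4 * j))) (\<rho> v) \<le> 3" if v: "v \<in> R" "{y, v} \<in> edges (H t)" for v
      proof -
        have "\<exists>r\<in>{0, 1, 2, 3}. v = Xv (4 * j + r)"
          using v(2) by (cases rule: H_edge_cases) (use j in \<open>auto simp: doubleton_eq_iff\<close>)
        then obtain r where r: "v = Xv (4 * j + r)" "r \<le> 3" by auto
        have le: "key (Xv (4 * j)) \<le> key v" unfolding r(1) key_X by simp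
        have "\<rho> (Xv (4 * j)) \<le> \<rho> v" "\<rho> v \<le> \<rho> (Xv (4 * j)) + (key v - key (Xv (4 * j)))"
          unfolding \<rho>_def using rank_diff_le[OF finR inj le] by simp_all
        moreover have "key v - key (Xv (4 * j)) \<le> 3" unfolding r(1) key_X using r(2) by simp
        ultimately show ?thesis by (simp add: offset_def)
      qed
      moreover have "\<rho> (Xv (4 * j)) \<le> 2 * k" using rank R4 by (auto simp: bij_betw_def)
      ultimately show ?thesis by (intro exI[of _ "\<rho> (Xv (4 * j))"]) simp
    qed
  qed
  have "F \<subseteq> Yv ` {1..t}" using F_Y by blast
  then have "card F \<le> card (Yv ` {1..t})" by (intro card_mono) auto
  also have "\<dots> = t" by (simp add: card_image inj_on_def)
  finally have cardF: "2 + card F \<le> n" using n by simp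
  have alpha: "card I \<le> k" if "I \<subseteq> R \<union> F" "stable_set (H t) I" for I
  proof -
    have "I \<subseteq> verts (H t) - middle S" using that(1) RF W mid by blast
    then have "2 * card I + card S \<le> L" unfolding L_def by (rule twice_stable_card_le[OF t S(1) that(2)])
    then show ?thesis using k by linarith
  qed
  have "critical (H t) n (R \<union> F)"
    by (rule odd_hole_critical[OF finite_simple_graph_H[OF t] _ _ k2 rank R_edge F_edge alpha cardF])
      (use RF W in \<open>auto simp: F_def\<close>)
  then show ?thesis unfolding RF .
qed

section \<open>Obstructions to multicolouring \<open>H\<^sub>t\<close>\<close>

lemma split_set:
  assumes "finite M" "card M = a + b"
  obtains M1 M2 where "M1 \<subseteq> M" "M2 \<subseteq> M" "M1 \<inter> M2 = {}" "card M1 = a" "card M2 = b"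
proof -
  have "a \<le> card M" using assms by simp
  then obtain M1 where M1: "M1 \<subseteq> M" "card M1 = a" "finite M1" by (rule obtain_subset_with_card_n)
  have "card (M - M1) = b" using M1 assms by (simp add: card_Diff_subset)
  then show ?thesis using that[of M1 "M - M1"] M1 by blast
qed

lemma doubleton_disjoint:
  assumes "{u, v} = {x, y}" "f x \<inter> f y = {}"
  shows "f u \<inter> f v = {}"
  using assms by (auto simp: doubleton_eq_iff)

lemma index_cases:
  fixes k :: nat
  assumes "4 \<le> k" "k \<le> 4 * t - 1"
  obtains i where "i < t - 1" "k = 4 * Suc i" | i where "i < t - 1" "k = 4 * Suc i + 1"
    | i where "i < t - 1" "k = 4 * Suc i + 2" | i where "i < t - 1" "k = 4 * Suc i + 3"
proof -
  define d r where "d = k div 4" and "r = k mod 4"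
  have k: "k = 4 * d + r" "r < 4" by (simp_all add: d_def r_def)
  then have d: "1 \<le> d" "d \<le> t - 1" using assms by linarith+
  define i where "i = d - 1"
  have i: "d = Suc i" "i < t - 1" using d by (simp_all add: i_def)
  have "r = 0 \<or> r = 1 \<or> r = 2 \<or> r = 3" using k(2) by linarith
  then show ?thesis
    using k(1) that(1)[OF i(2)] that(2)[OF i(2)] that(3)[OF i(2)] that(4)[OF i(2)] unfolding i(1)
    by (elim disjE) simp_all
qed

lemma fan_ring_of_H:
  assumes t: "t \<ge> 2"
    and pair: "\<And>u v. {u, v} \<in> edges (H t) \<Longrightarrow> b u + b v \<le> n"
    and tri: "\<And>u v w. {u, v} \<in> edges (H t) \<Longrightarrow> {w, u} \<in> edges (H t) \<Longrightarrow> {w, v} \<in> edges (H t) \<Longrightarrow> b u + b v + b w \<le> n"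
  shows "fan_ring n (t - 1) (b (Xv 1)) (b (Xv 2) + b (Yv 1)) (\<lambda>j. b (Xv (4 * j))) (\<lambda>j. b (Xv (4 * j + 3)))
    (\<lambda>j. b (Yv (j + 1))) (\<lambda>j. b (Xv (4 * j + 1))) (\<lambda>j. b (Xv (4 * j + 2)))"
proof
  note N = cycle_length_ge_2[OF t]
  fix i assume i: "i < t - 1"
  show "b (Xv (4 * i + 3)) + b (Xv (4 * Suc i)) \<le> n"
    by (rule pair, rule H_edge_next) (use i N in simp_all)
  show "b (Xv (4 * Suc i)) + b (Xv (4 * Suc i + 1)) + b (Yv (Suc i + 1)) \<le> n"
    by (rule tri; (rule H_edge_next | rule H_edge_Y'); use i N in simp)
  show "b (Xv (4 * Suc i + 1)) + b (Xv (4 * Suc i + 2)) + b (Yv (Suc i + 1)) \<le> n"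
    by (rule tri; (rule H_edge_next | rule H_edge_Y'); use i N in simp)
  have "b (Xv (4 * Suc i + 2)) + b (Xv (4 * Suc i + 3)) + b (Yv (Suc i + 1)) \<le> n"
    by (rule tri; (rule H_edge_next | rule H_edge_Y'); use i N in simp)
  then show "b (Xv (4 * Suc i + 2)) + b (Xv (4 * Suc i + 3)) + b (Yv (Suc i + 1)) \<le> n" .
next
  note N = cycle_length_ge_2[OF t]
  have "4 * (t - 1) + 3 = cycle_length t" using t N by simp
  then show "b (Xv (4 * (t - 1) + 3)) + b (Xv 1) \<le> n" using pair[OF H_edge_closing[of t]] by simp
  have "b (Xv 1) + b (Xv 2) + b (Yv 1) \<le> n"
    by (rule tri; (rule H_edge_next | rule H_edge_Y1); use t N in simp)
  then show "b (Xv 1) + (b (Xv 2) + b (Yv 1)) \<le> n" by simp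
  have "b (Xv 2) + b (Xv 3) + b (Yv 1) \<le> n"
    by (rule tri; (rule H_edge_next | rule H_edge_Y1); use t N in simp)
  then show "b (Xv 2) + b (Yv 1) + b (Xv (4 * 0 + 3)) \<le> n" by simp
qed

lemma H_colour_of_ring_coloring:
  assumes t: "t \<ge> 2"
    and ring: "fan_ring.ring_coloring n (t - 1) (b (Xv 1)) (b (Xv 2) + b (Yv 1)) (\<lambda>j. b (Xv (4 * j))) (\<lambda>j. b (Xv (4 * j + 3)))
      (\<lambda>j. b (Yv (j + 1))) (\<lambda>j. b (Xv (4 * j + 1))) (\<lambda>j. b (Xv (4 * j + 2))) P B C Q Y A M"
    and fr: "fan_ring n (t - 1) (b (Xv 1)) (b (Xv 2) + b (Yv 1)) (\<lambda>j. b (Xv (4 * j))) (\<lambda>j. b (Xv (4 * j + 3)))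
    (\<lambda>j. b (Yv (j + 1))) (\<lambda>j. b (Xv (4 * j + 1))) (\<lambda>j. b (Xv (4 * j + 2)))"
  shows "multicolorable (H t) n b"
proof -
  note N = cycle_length_ge_2[OF t]
  note rc = ring[unfolded fan_ring.ring_coloring_def[OF fr]]
  have "card (Q 0) = b (Xv 3)" using rc[THEN conjunct2, THEN conjunct1] by simp
  note top = rc[THEN conjunct1] this
    rc[THEN conjunct2, THEN conjunct2, THEN conjunct1]
    rc[THEN conjunct2, THEN conjunct2, THEN conjunct2, THEN conjunct1]
    rc[THEN conjunct2, THEN conjunct2, THEN conjunct2, THEN conjunct2, THEN conjunct1]
    rc[THEN conjunct2, THEN conjunct2, THEN conjunct2, THEN conjunct2, THEN conjunct2, THEN conjunct1]
    rc[THEN conjunct2, THEN conjunct2, THEN conjunct2, THEN conjunct2, THEN conjunct2, THEN conjunct2, THEN conjunct1]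
    rc[THEN conjunct2, THEN conjunct2, THEN conjunct2, THEN conjunct2, THEN conjunct2, THEN conjunct2, THEN conjunct2, THEN conjunct1]
    rc[THEN conjunct2, THEN conjunct2, THEN conjunct2, THEN conjunct2, THEN conjunct2, THEN conjunct2, THEN conjunct2, THEN conjunct2, THEN conjunct1]
  have blk: "P (Suc i) \<subseteq> {..<n} \<and> B (Suc i) \<subseteq> {..<n} \<and> C (Suc i) \<subseteq> {..<n} \<and> Q (Suc i) \<subseteq> {..<n} \<and> Y (Suc i) \<subseteq> {..<n} \<and>
       card (P (Suc i)) = b (Xv (4 * Suc i)) \<and> card (B (Suc i)) = b (Xv (4 * Suc i + 1)) \<and> card (C (Suc i)) = b (Xv (4 * Suc i + 2)) \<and>
       card (Q (Suc i)) = b (Xv (4 * Suc i + 3)) \<and> card (Y (Suc i)) = b (Yv (Suc i + 1)) \<and>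
       Q i \<inter> P (Suc i) = {} \<and> P (Suc i) \<inter> B (Suc i) = {} \<and> B (Suc i) \<inter> C (Suc i) = {} \<and> C (Suc i) \<inter> Q (Suc i) = {} \<and>
       Y (Suc i) \<inter> P (Suc i) = {} \<and> Y (Suc i) \<inter> B (Suc i) = {} \<and> Y (Suc i) \<inter> C (Suc i) = {} \<and> Y (Suc i) \<inter> Q (Suc i) = {}"
    if i: "i < t - 1" for i
  proof -
    note all_blocks = rc[THEN conjunct2, THEN conjunct2, THEN conjunct2, THEN conjunct2, THEN conjunct2,
        THEN conjunct2, THEN conjunct2, THEN conjunct2, THEN conjunct2]
    show ?thesis by (rule all_blocks[rule_format, OF i])
  qed
  have "finite M" using top finite_subset by blast
  then obtain M1 M2 where M: "M1 \<subseteq> M" "M2 \<subseteq> M" "M1 \<inter> M2 = {}" "card M1 = b (Xv 2)" "card M2 = b (Yv 1)"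
    using top(6) by (rule split_set)
  define f where "f v = (case v of
      Xv k \<Rightarrow> if k = 1 then A else if k = 2 then M1
        else (if k mod 4 = 0 then P else if k mod 4 = 1 then B else if k mod 4 = 2 then C else Q) (k div 4)
    | Yv i \<Rightarrow> if i = 1 then M2 else Y (i - 1))" for v
  have f_top: "f (Xv 1) = A" "f (Xv 2) = M1" "f (Xv 3) = Q 0" "f (Yv 1) = M2" by (simp_all add: f_def)
  have f_X: "f (Xv (4 * Suc i + r)) = (if r = 0 then P else if r = 1 then B else if r = 2 then C else Q) (Suc i)"
    if "r < 4" for i r
  proof -
    have "(4 * Suc i + r) mod 4 = r" unfolding mod_mult_self4 using that by simp
    moreover have "(4 * Suc i + r) div 4 = Suc i" by (subst div_mult_self4) (use that in auto)
    moreover have "4 * Suc i + r \<noteq> 1" "4 * Suc i + r \<noteq> 2" by simp_all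
    ultimately show ?thesis unfolding f_def by (simp only: vertex.case if_False)
  qed
  have f_blk: "f (Xv (4 * Suc i)) = P (Suc i)" "f (Xv (4 * Suc i + 1)) = B (Suc i)" "f (Xv (4 * Suc i + 2)) = C (Suc i)"
    "f (Xv (4 * Suc i + 3)) = Q (Suc i)" "f (Yv (Suc i + 1)) = Y (Suc i)" for i
    using f_X[of 0 i] f_X[of 1 i] f_X[of 2 i] f_X[of 3 i] by (simp_all add: f_def)
  have f_last: "f (Xv (4 * i + 3)) = Q i" for i using f_top f_blk(4)[of "i - 1"] by (cases i) simp_all
  have good: "f v \<subseteq> {..<n} \<and> b v \<le> card (f v)" if v: "v \<in> verts (H t)" for v
  proof (cases v)
    case (Xv k)
    then have k: "1 \<le> k" "k \<le> 4 * t - 1" using v by (auto simp: verts_H N)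
    show ?thesis
    proof (cases "k \<le> 3")
      case True
      then have "k = 1 \<or> k = 2 \<or> k = 3" using k by linarith
      then show ?thesis using top M f_top Xv by auto
    next
      case False
      then have "4 \<le> k" by simp
      then show ?thesis using k(2)
      proof (cases rule: index_cases)
        case (1 i) show ?thesis unfolding Xv 1(2) f_blk using blk[OF 1(1)] by simp
      next
        case (2 i) show ?thesis unfolding Xv 2(2) f_blk using blk[OF 2(1)] by simp
      next
        case (3 i) show ?thesis unfolding Xv 3(2) f_blk using blk[OF 3(1)] by simp
      next
        case (4 i) show ?thesis unfolding Xv 4(2) f_blk using blk[OF 4(1)] by simp
      qed
    qed
  next
    case (Yv i)
    then have i: "1 \<le> i" "i \<le> t" using v by (auto simp: verts_H)
    show ?thesis
    proof (cases "i = 1")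
      case True
      then show ?thesis using top M f_top Yv by auto
    next
      case False
      define i' where "i' = i - 2"
      have "i = Suc i' + 1" "i' < t - 1" using i False by (auto simp: i'_def)
      then show ?thesis using blk[of i'] f_blk(5)[of i'] Yv by simp
    qed
  qed
  have step: "f (Xv i) \<inter> f (Xv (i + 1)) = {}" if i: "1 \<le> i" "i < 4 * t - 1" for i
  proof (cases "i \<le> 3")
    case True
    then consider "i = 1" | "i = 2" | "i = 3" using i by linarith
    then show ?thesis
    proof cases
      case 1
      have "A \<inter> M1 = {}" using top(7) M(1) by blast
      moreover have e: "i + 1 = 2" using 1 by simp
      ultimately show ?thesis unfolding e unfolding 1 f_top by blast
    next
      case 2
      have "M1 \<inter> Q 0 = {}" using top(8) M(1) by blast
      moreover have e: "i + 1 = 3" using 2 by simp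
      ultimately show ?thesis unfolding e unfolding 2 f_top by blast
    next
      case 3
      have e: "i + 1 = 4 * Suc 0" using 3 by simp
      show ?thesis unfolding e f_blk unfolding 3 f_top using blk[of 0] t by simp
    qed
  next
    case False
    then have "4 \<le> i" by simp
    moreover have "i \<le> 4 * t - 1" using i by simp
    ultimately show ?thesis
    proof (cases rule: index_cases)
      case (1 j) show ?thesis unfolding 1(2) f_blk using blk[OF 1(1)] by simp
    next
      case (2 j)
      have e: "i + 1 = 4 * Suc j + 2" using 2 by simp
      show ?thesis unfolding e f_blk unfolding 2(2) f_blk using blk[OF 2(1)] by simp
    next
      case (3 j)
      have e: "i + 1 = 4 * Suc j + 3" using 3 by simp
      show ?thesis unfolding e f_blk unfolding 3(2) f_blk using blk[OF 3(1)] by simp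
    next
      case (4 j)
      have e: "i + 1 = 4 * Suc (Suc j)" "Suc j < t - 1" using 4 i by simp_all
      show ?thesis unfolding e(1) f_blk unfolding 4(2) f_blk using blk[OF e(2)] by simp
    qed
  qed
  have disj: "f u \<inter> f v = {}" if e: "{u, v} \<in> edges (H t)" for u v
    using e
  proof (cases rule: H_edge_cases)
    case (cycle i)
    show ?thesis by (rule doubleton_disjoint[OF cycle(3)]) (use step cycle N in simp)
  next
    case closing
    have "4 * (t - 1) + 3 = cycle_length t" using t N by simp
    then have "f (Xv (cycle_length t)) = Q (t - 1)" using f_last[of "t - 1"] by simp
    then have "f (Xv (cycle_length t)) \<inter> f (Xv 1) = {}" unfolding f_top using top(9) by (simp only:)
    then show ?thesis by (rule doubleton_disjoint[OF closing])
  next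
    case (first j)
    have "M2 \<inter> A = {}" "M2 \<inter> M1 = {}" "M2 \<inter> Q 0 = {}" using top(7,8) M(2,3) by blast+
    then have "f (Yv 1) \<inter> f (Xv j) = {}" using first(1) f_top by auto
    then show ?thesis by (rule doubleton_disjoint[OF first(2)])
  next
    case (later j r)
    define i where "i = j - 1"
    have i: "j = Suc i" "i < t - 1" using later(1) by (auto simp: i_def)
    have "f (Yv (j + 1)) \<inter> f (Xv (4 * j + r)) = {}"
      using later(2) blk[OF i(2)] f_blk[of i] unfolding i(1) by auto
    then show ?thesis by (rule doubleton_disjoint[OF later(3)])
  qed
  show ?thesis by (rule multicolorableI[where A = f]) (use good disj in auto)
qed

lemma H_obstruction_ge_2:
  assumes t: "t \<ge> 2" and not_col: "\<not> multicolorable (H t) n b"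
    and pair: "\<And>u v. {u, v} \<in> edges (H t) \<Longrightarrow> b u + b v \<le> n"
    and tri: "\<And>u v w. {u, v} \<in> edges (H t) \<Longrightarrow> {w, u} \<in> edges (H t) \<Longrightarrow> {w, v} \<in> edges (H t) \<Longrightarrow> b u + b v + b w \<le> n"
  shows "\<exists>S. spans_odd_hole t S {v. 0 < b v} \<and>
    n * ((cycle_length t - card S) div 2) < (\<Sum>v\<in>verts (H t) - middle S. b v)"
proof -
  note N = cycle_length_ge_2[OF t]
  note fr = fan_ring_of_H[OF t pair tri]
  interpret fan_ring n "t - 1" "b (Xv 1)" "b (Xv 2) + b (Yv 1)" "\<lambda>j. b (Xv (4 * j))" "\<lambda>j. b (Xv (4 * j + 3))"
    "\<lambda>j. b (Yv (j + 1))" "\<lambda>j. b (Xv (4 * j + 1))" "\<lambda>j. b (Xv (4 * j + 2))" by (rule fr)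
  have no: "\<not> (\<exists>P B C Q Y A M. ring_coloring P B C Q Y A M)"
    using H_colour_of_ring_coloring[where b = b, OF t _ fr] not_col by blast
  have "\<exists>S. traversed (t - 1) S \<and> 0 < b (Xv 1) \<and> 0 < b (Xv 2) + b (Yv 1) \<and> even (card S) \<and>
      n * (2 * (t - 1) + 1) < total S + n * (card S div 2)"
    by (rule mp[OF iffD1[OF disj_imp ring_coloring_or_violation] no])
  then obtain S where S: "traversed (t - 1) S" "0 < b (Xv 1)" "0 < b (Xv 2) + b (Yv 1)" "even (card S)"
    and big: "n * (2 * (t - 1) + 1) < total S + n * (card S div 2)"
    by (elim exE conjE)
  note S1 = S(1)[unfolded traversed_def]
  have S_sub: "S \<subseteq> {1..t - 1}" by (rule S1[THEN conjunct1])
  have q0: "0 < b (Xv 3)" using S1[THEN conjunct2, THEN conjunct1] by simp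
  have tr: "0 < b (Xv (4 * j)) \<and> 0 < b (Xv (4 * j + 3)) \<and> (j \<in> S \<longrightarrow> 0 < b (Yv (j + 1))) \<and>
      (j \<notin> S \<longrightarrow> 0 < b (Xv (4 * j + 1)) \<and> 0 < b (Xv (4 * j + 2)))" if "j \<in> {1..t - 1}" for j
    using S(1) that unfolding traversed_def by blast
  have span: "spans_odd_hole t S {v. 0 < b v}"
    unfolding spans_odd_hole_def
  proof (intro conjI ballI impI)
    have "{1..t - 1} = {1..<t}" by auto
    then show "S \<subseteq> {1..<t}" using S_sub by (simp only:)
    show "Xv 2 \<in> {v. 0 < b v} \<or> Yv 1 \<in> {v. 0 < b v}" using S(3) by auto
  next
    fix k assume k: "k \<in> {4..cycle_length t}" "Xv k \<notin> middle S"
    then have "4 \<le> k" "k \<le> 4 * t - 1" by (simp_all add: N)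
    then have "0 < b (Xv k)"
    proof (cases rule: index_cases)
      case (1 i)
      then show ?thesis using tr[of "Suc i"] by simp
    next
      case (2 i)
      then have "Suc i \<notin> S" using k(2) by (metis middle_simps(4))
      then show ?thesis using tr[of "Suc i"] 2 by simp
    next
      case (3 i)
      then have "Suc i \<notin> S" using k(2) by (metis middle_simps(5))
      then show ?thesis using tr[of "Suc i"] 3 by simp
    next
      case (4 i)
      then show ?thesis using tr[of "Suc i"] by simp
    qed
    then show "Xv k \<in> {v. 0 < b v}" by simp
  next
    fix j assume "j \<in> S"
    then have "j \<in> {1..t - 1}" using S_sub by blast
    then show "Yv (j + 1) \<in> {v. 0 < b v}" using tr[of j] \<open>j \<in> S\<close> by blast
  qed (use S q0 in simp_all)
  have total_eq: "total S = (\<Sum>v\<in>verts (H t) - middle S. b v)"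
  proof -
    define g where "g v = (if v \<in> middle S then 0 else b v)" for v
    have not_mid: "Xv 1 \<notin> middle S" "Xv 2 \<notin> middle S" "Xv 3 \<notin> middle S"
      using S_sub by (auto simp: middle_def)
    have fin: "finite (verts (H t))" by (simp add: verts_H)
    have "(\<Sum>v\<in>verts (H t) - middle S. b v) = (\<Sum>v\<in>verts (H t). g v)"
      using fin by (intro sum.mono_neutral_cong_left) (auto simp: g_def)
    also have "\<dots> = g (Xv 1) + g (Xv 2) + g (Xv 3) + g (Yv 1) +
      (\<Sum>j\<in>{1..<t}. g (Xv (4 * j)) + g (Xv (4 * j + 1)) + g (Xv (4 * j + 2)) + g (Xv (4 * j + 3)) + g (Yv (j + 1)))"
      unfolding verts_H N by (rule sum_blocks) (use t in simp)
    also have "(\<Sum>j\<in>{1..<t}. g (Xv (4 * j)) + g (Xv (4 * j + 1)) + g (Xv (4 * j + 2)) + g (Xv (4 * j + 3)) + g (Yv (j + 1))) =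
      (\<Sum>j\<in>{1..t - 1}. (b (Xv (4 * j)) + b (Xv (4 * j + 3)) + b (Yv (j + 1))) +
         (if j \<in> S then 0 else b (Xv (4 * j + 1)) + b (Xv (4 * j + 2))))"
      by (rule sum.cong) (use t in \<open>auto simp: g_def simp del: add_2_eq_Suc' add_Suc_right One_nat_def\<close>)
    also have "\<dots> = (\<Sum>j\<in>{1..t - 1}. b (Xv (4 * j)) + b (Xv (4 * j + 3)) + b (Yv (j + 1))) +
        (\<Sum>j\<in>{1..t - 1} - S. b (Xv (4 * j + 1)) + b (Xv (4 * j + 2)))"
    proof -
      have "(\<Sum>j\<in>{1..t - 1}. if j \<in> S then 0 else b (Xv (4 * j + 1)) + b (Xv (4 * j + 2))) =
        (\<Sum>j\<in>{1..t - 1} - S. b (Xv (4 * j + 1)) + b (Xv (4 * j + 2)))"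
        by (rule sum.mono_neutral_cong_right) auto
      then show ?thesis by (simp only: sum.distrib)
    qed
    finally have "(\<Sum>v\<in>verts (H t) - middle S. b v) = b (Xv 1) + b (Xv 2) + b (Xv 3) + b (Yv 1) +
      ((\<Sum>j\<in>{1..t - 1}. b (Xv (4 * j)) + b (Xv (4 * j + 3)) + b (Yv (j + 1))) +
       (\<Sum>j\<in>{1..t - 1} - S. b (Xv (4 * j + 1)) + b (Xv (4 * j + 2))))"
      unfolding g_def using not_mid by (simp only: if_False middle_simps(1))
    then show ?thesis unfolding total_def by simp
  qed
  have big': "n * ((cycle_length t - card S) div 2) < total S"
  proof -
    obtain d where d: "card S = 2 * d" using S(4) by (elim evenE)
    have "card S \<le> t - 1" using card_mono[OF _ S_sub] by simp
    then have "cycle_length t - card S = 2 * (2 * t - 1 - d) + 1" "2 * t - 1 - d + d = 2 * (t - 1) + 1"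
      unfolding N d using t by simp_all
    then have "(cycle_length t - card S) div 2 + d = 2 * (t - 1) + 1" by simp
    then have "n * ((cycle_length t - card S) div 2) + n * d = n * (2 * (t - 1) + 1)"
      unfolding add_mult_distrib2[symmetric] by (simp only:)
    then show ?thesis using big d by simp
  qed
  show ?thesis by (intro exI[of _ S] conjI span big'[unfolded total_eq])
qed

text \<open>For \<open>t = 1\<close> the edge \<open>x\<^sub>4 x\<^sub>5\<close> takes the place of a fan. It behaves like a fan without apex whose middle
  demands add up to \<open>n\<close>: the second set is then the complement of the first, and the third equals
  the first, so the first and last set are disjoint.\<close>

lemma H_obstruction_1:
  assumes not_col: "\<not> multicolorable (H 1) n b"
    and pair: "\<And>u v. {u, v} \<in> edges (H 1) \<Longrightarrow> b u + b v \<le> n"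
    and tri: "\<And>u v w. {u, v} \<in> edges (H 1) \<Longrightarrow> {w, u} \<in> edges (H 1) \<Longrightarrow> {w, v} \<in> edges (H 1) \<Longrightarrow> b u + b v + b w \<le> n"
  shows "\<exists>S. spans_odd_hole 1 S {v. 0 < b v} \<and>
    n * ((cycle_length 1 - card S) div 2) < (\<Sum>v\<in>verts (H 1) - middle S. b v)"
proof -
  have len: "cycle_length 1 = 5" by (simp add: cycle_length_def)
  have V: "verts (H 1) = {Xv 1, Xv 2, Xv 3, Xv 4, Xv 5, Yv 1}"
  proof -
    have "{1..cycle_length 1} = {1, 2, 3, 4, 5}" "{1..1::nat} = {1}" unfolding len by auto
    then show ?thesis by (simp only: verts_H) auto
  qed
  have p: "b (Xv 3) + b (Xv 4) \<le> n" "b (Xv 4) + b (Xv 5) \<le> n"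
    by (rule pair, rule H_edge_next; simp add: len[unfolded One_nat_def])+
  have c: "b (Xv 5) + b (Xv 1) \<le> n" using pair[OF H_edge_closing[of 1]] unfolding len .
  have tr: "b (Xv 1) + b (Xv 2) + b (Yv 1) \<le> n" "b (Xv 2) + b (Xv 3) + b (Yv 1) \<le> n"
    by (rule tri; (rule H_edge_next | rule H_edge_Y1); simp add: len[unfolded One_nat_def])+
  have fr: "fan_ring n 1 (b (Xv 1)) (b (Xv 2) + b (Yv 1)) (\<lambda>j. b (Xv 4)) (\<lambda>j. if j = 0 then b (Xv 3) else b (Xv 5))
    (\<lambda>j. 0) (\<lambda>j. n - b (Xv 4)) (\<lambda>j. b (Xv 4))"
    by unfold_locales (use p c tr in simp_all)
  interpret fan_ring n 1 "b (Xv 1)" "b (Xv 2) + b (Yv 1)" "\<lambda>j. b (Xv 4)" "\<lambda>j. if j = 0 then b (Xv 3) else b (Xv 5)"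
    "\<lambda>j. 0" "\<lambda>j. n - b (Xv 4)" "\<lambda>j. b (Xv 4)" by (rule fr)
  have no: "\<not> (\<exists>P B C Q Y A M. ring_coloring P B C Q Y A M)"
  proof (intro notI, elim exE)
    fix P B C Q Y A M assume "ring_coloring P B C Q Y A M"
    note rc = this[unfolded ring_coloring_def]
    have top: "Q 0 \<subseteq> {..<n}" "card (Q 0) = b (Xv 3)" "A \<subseteq> {..<n}" "card A = b (Xv 1)" "M \<subseteq> {..<n}"
      "card M = b (Xv 2) + b (Yv 1)" "A \<inter> M = {}" "M \<inter> Q 0 = {}" "Q 1 \<inter> A = {}" and
      blk: "P 1 \<subseteq> {..<n}" "B 1 \<subseteq> {..<n}" "C 1 \<subseteq> {..<n}" "Q 1 \<subseteq> {..<n}" "card (P 1) = b (Xv 4)"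
      "card (B 1) = n - b (Xv 4)" "card (C 1) = b (Xv 4)" "card (Q 1) = b (Xv 5)"
      "Q 0 \<inter> P 1 = {}" "P 1 \<inter> B 1 = {}" "B 1 \<inter> C 1 = {}" "C 1 \<inter> Q 1 = {}"
      using rc by simp_all
    have fin: "finite (P 1)" "finite (B 1)" "finite (C 1)" using blk finite_subset by blast+
    have "B 1 = {..<n} - P 1"
    proof (rule card_subset_eq)
      show "B 1 \<subseteq> {..<n} - P 1" using blk by blast
      show "card (B 1) = card ({..<n} - P 1)" using blk fin by (simp add: card_Diff_subset)
    qed simp
    then have "C 1 \<subseteq> P 1" using blk by blast
    then have "C 1 = P 1" by (rule card_subset_eq[OF fin(1)]) (simp only: blk)
    then have PQ: "P 1 \<inter> Q 1 = {}" using blk by simp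
    have "finite M" using top finite_subset by blast
    then obtain M1 M2 where M: "M1 \<subseteq> M" "M2 \<subseteq> M" "M1 \<inter> M2 = {}" "card M1 = b (Xv 2)" "card M2 = b (Yv 1)"
      using top(6) by (rule split_set)
    define f where "f v = (case v of Xv k \<Rightarrow> if k = 1 then A else if k = 2 then M1 else if k = 3 then Q 0
        else if k = 4 then P 1 else Q 1 | Yv i \<Rightarrow> M2)" for v
    have f: "f (Xv 1) = A" "f (Xv 2) = M1" "f (Xv 3) = Q 0" "f (Xv 4) = P 1" "f (Xv 5) = Q 1" "f (Yv 1) = M2"
      by (simp_all add: f_def)
    have disj: "A \<inter> M1 = {}" "M1 \<inter> Q 0 = {}" "M2 \<inter> A = {}" "M2 \<inter> Q 0 = {}" "M2 \<inter> M1 = {}"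
      using top(7,8) M(1,2,3) by blast+
    have "multicolorable (H 1) n b"
    proof (rule multicolorableI[where A = f])
      fix v assume "v \<in> verts (H 1)"
      then have v: "v = Xv 1 \<or> v = Xv 2 \<or> v = Xv 3 \<or> v = Xv 4 \<or> v = Xv 5 \<or> v = Yv 1" unfolding V by blast
      have "M1 \<subseteq> {..<n}" "M2 \<subseteq> {..<n}" using M top(5) by blast+
      then show "f v \<subseteq> {..<n}" using v f top blk by (elim disjE) (simp_all only:)
      show "b v \<le> card (f v)" using v f top blk M by (elim disjE) (simp_all only: order_refl)
    next
      fix u v assume "{u, v} \<in> edges (H 1)"
      then show "f u \<inter> f v = {}"
      proof (cases rule: H_edge_cases)
        case (cycle i)
        have "i = 1 \<or> i = 2 \<or> i = 3 \<or> i = 4" using cycle(1,2) unfolding len by linarith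
        moreover have "1 + 1 = (2::nat)" "2 + 1 = (3::nat)" "3 + 1 = (4::nat)" "4 + 1 = (5::nat)" by simp_all
        ultimately have "f (Xv i) \<inter> f (Xv (i + 1)) = {}"
          using f disj blk(9) PQ by (elim disjE) (simp_all only:)
        then show ?thesis by (rule doubleton_disjoint[OF cycle(3)])
      next
        case closing
        show ?thesis by (rule doubleton_disjoint[OF closing]) (unfold len f, rule top(9))
      next
        case (first j)
        have "f (Yv 1) \<inter> f (Xv j) = {}" using first(1) f disj by (elim insertE emptyE) (simp_all only:)
        then show ?thesis by (rule doubleton_disjoint[OF first(2)])
      qed simp
    qed
    then show False using not_col by contradiction
  qed
  have "\<exists>S. traversed 1 S \<and> 0 < b (Xv 1) \<and> 0 < b (Xv 2) + b (Yv 1) \<and> even (card S) \<and>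
      n * (2 * 1 + 1) < total S + n * (card S div 2)"
    by (rule mp[OF iffD1[OF disj_imp ring_coloring_or_violation] no])
  then obtain S where S: "traversed 1 S" "0 < b (Xv 1)" "0 < b (Xv 2) + b (Yv 1)" "even (card S)"
    and big: "n * (2 * 1 + 1) < total S + n * (card S div 2)" by (elim exE conjE)
  note tr1 = S(1)[unfolded traversed_def]
  have "S \<subseteq> {1..1}" by (rule tr1[THEN conjunct1])
  then have "S = {} \<or> S = {1}" by auto
  then have S0: "S = {}" using S(4) by auto
  have pos: "0 < b (Xv 3)" "0 < b (Xv 4)" "0 < b (Xv 5)"
    using tr1[THEN conjunct2, THEN conjunct1] bspec[OF tr1[THEN conjunct2, THEN conjunct2], of 1] by simp_all
  have span: "spans_odd_hole 1 {} {v. 0 < b v}"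
    unfolding spans_odd_hole_def len
  proof (intro conjI ballI impI)
    show "Xv 2 \<in> {v. 0 < b v} \<or> Yv 1 \<in> {v. 0 < b v}" using S(3) by auto
    fix k :: nat assume "k \<in> {4..5}"
    then have "k = 4 \<or> k = 5" by auto
    then show "Xv k \<in> {v. 0 < b v}" using pos by auto
  qed (use S(2) pos in simp_all)
  have b4: "b (Xv 4) \<le> n" using p by simp
  have "n * 2 < b (Xv 1) + b (Xv 2) + b (Xv 3) + b (Xv 4) + b (Xv 5) + b (Yv 1)"
    using big b4 unfolding S0 total_def by simp
  moreover have "verts (H 1) - middle {} = verts (H 1)" by (simp add: middle_def)
  ultimately have "n * ((cycle_length 1 - card ({} :: nat set)) div 2) < (\<Sum>v\<in>verts (H 1) - middle {}. b v)"
    unfolding len V by simp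
  then show ?thesis by (intro exI[of _ "{}"] conjI span)
qed

lemma H_obstruction:
  assumes t: "t \<ge> 1" and "\<not> multicolorable (H t) n b"
    and "\<And>u v. {u, v} \<in> edges (H t) \<Longrightarrow> b u + b v \<le> n"
    and "\<And>u v w. {u, v} \<in> edges (H t) \<Longrightarrow> {w, u} \<in> edges (H t) \<Longrightarrow> {w, v} \<in> edges (H t) \<Longrightarrow> b u + b v + b w \<le> n"
  shows "\<exists>S. spans_odd_hole t S {v. 0 < b v} \<and>
    n * ((cycle_length t - card S) div 2) < (\<Sum>v\<in>verts (H t) - middle S. b v)"
proof (cases "t = 1")
  case True
  show ?thesis unfolding True by (rule H_obstruction_1[OF assms(2-4)[unfolded True]])
next
  case False
  then have "t \<ge> 2" using t by simp
  show ?thesis by (rule H_obstruction_ge_2[OF \<open>t \<ge> 2\<close> assms(2-4)])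
qed

lemma H_stable_card_le:
  assumes t: "t \<ge> 1" and S: "S \<subseteq> {1..<t}" and I: "I \<subseteq> verts (H t) - middle S" "stable_set (H t) I"
  shows "card I \<le> (cycle_length t - card S) div 2"
  using twice_stable_card_le[OF t S I(2,1)] by simp

text \<open>If a violated inequality does not involve a vertex, it stays violated when the demand of that
  vertex drops. So the support lies in the violated clique, or avoids the vertices missing in the violated hole inequality.\<close>

lemma critical_obstruction:
  assumes t: "t \<ge> 1" and le: "\<And>v. b v \<le> n" and supp: "{v. b v > 0} \<subseteq> verts (H t)"
    and not_col: "\<not> multicolorable (H t) n b"
    and col: "\<And>v. b v > 0 \<Longrightarrow> multicolorable (H t) n (b(v := b v - 1))"
  shows "(is_clique (H t) {v. b v > 0} \<and> 2 \<le> card {v. b v > 0} \<and> card {v. b v > 0} \<le> 3) \<or>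
    (\<exists>S. spans_odd_hole t S {v. b v > 0} \<and> {v. b v > 0} \<inter> middle S = {} \<and>
       n * ((cycle_length t - card S) div 2) < (\<Sum>v\<in>verts (H t) - middle S. b v))"
proof (cases "\<exists>K. K \<subseteq> verts (H t) \<and> is_clique (H t) K \<and> card K \<le> 3 \<and> n < (\<Sum>v\<in>K. b v)")
  case True
  then obtain K where K: "K \<subseteq> verts (H t)" "is_clique (H t) K" "card K \<le> 3" and big: "n < (\<Sum>v\<in>K. b v)" by blast
  note G = finite_simple_graph_H[OF t]
  have fin: "finite K" using G K(1) finite_subset unfolding finite_simple_graph_def by blast
  have WK: "{v. b v > 0} \<subseteq> K"
  proof (rule subsetI, rule ccontr)
    fix v assume v: "v \<in> {v. b v > 0}" "v \<notin> K"
    have "(\<Sum>w\<in>K. (b(v := b v - 1)) w) = (\<Sum>w\<in>K. b w)" using v by (intro sum.cong) auto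
    then show False using clique_sum_le[OF G K(1,2) col[of v]] v big by simp
  qed
  have "(\<Sum>v\<in>K. b v) = (\<Sum>v\<in>{v. b v > 0}. b v)"
    by (rule sum.mono_neutral_right[OF fin WK]) auto
  then have bigW: "n < (\<Sum>v\<in>{v. b v > 0}. b v)" using big by simp
  have "\<not> card {v. b v > 0} \<le> 1"
  proof
    assume "card {v. b v > 0} \<le> 1"
    then have "card {v. b v > 0} * n \<le> n" by (cases "card {v. b v > 0}") simp_all
    moreover have "(\<Sum>v\<in>{v. b v > 0}. b v) \<le> card {v. b v > 0} * n"
      using sum_bounded_above[of "{v. b v > 0}" b n] le by simp
    ultimately show False using bigW by linarith
  qed
  moreover have "card {v. b v > 0} \<le> 3" using card_mono[OF fin WK] K(3) by simp
  moreover have "is_clique (H t) {v. b v > 0}" using K(2) WK unfolding is_clique_def by blast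
  ultimately show ?thesis by simp
next
  case False
  note G = finite_simple_graph_H[OF t]
  have clique: "(\<Sum>v\<in>K. b v) \<le> n" if "K \<subseteq> verts (H t)" "is_clique (H t) K" "card K \<le> 3" for K
    using False that by (meson not_le)
  have edge: "u \<noteq> v \<and> u \<in> verts (H t) \<and> v \<in> verts (H t)" if "{u, v} \<in> edges (H t)" for u v
  proof -
    have "{u, v} \<subseteq> verts (H t)" "card {u, v} = 2" using G that unfolding finite_simple_graph_def by blast+
    then show ?thesis by auto
  qed
  have pair: "b u + b v \<le> n" if e: "{u, v} \<in> edges (H t)" for u v
    using clique[of "{u, v}"] edge[OF e] e by (simp add: is_clique_def insert_commute)
  have tri: "b u + b v + b w \<le> n" if e: "{u, v} \<in> edges (H t)" "{w, u} \<in> edges (H t)" "{w, v} \<in> edges (H t)" for u v w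
  proof -
    have ne: "u \<noteq> v" "u \<noteq> w" "v \<noteq> w" and V: "u \<in> verts (H t)" "v \<in> verts (H t)" "w \<in> verts (H t)"
      using edge[OF e(1)] edge[OF e(2)] edge[OF e(3)] by blast+
    have "(\<Sum>x\<in>{u, v, w}. b x) \<le> n"
    proof (rule clique)
      show "is_clique (H t) {u, v, w}" using e by (simp add: is_clique_def insert_commute)
      show "card {u, v, w} \<le> 3" using ne by simp
    qed (use V in \<open>simp\<close>)
    then show ?thesis using ne by simp
  qed
  have "\<exists>S. spans_odd_hole t S {v. 0 < b v} \<and>
    n * ((cycle_length t - card S) div 2) < (\<Sum>v\<in>verts (H t) - middle S. b v)"
    by (rule H_obstruction[OF t not_col pair tri])
  then obtain S where S: "spans_odd_hole t S {v. 0 < b v}"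
    and big: "n * ((cycle_length t - card S) div 2) < (\<Sum>v\<in>verts (H t) - middle S. b v)" by (elim exE conjE)
  have S_sub: "S \<subseteq> {1..<t}" using S unfolding spans_odd_hole_def by blast
  have "v \<notin> middle S" if v: "b v > 0" for v
  proof
    assume "v \<in> middle S"
    then have "(\<Sum>w\<in>verts (H t) - middle S. (b(v := b v - 1)) w) = (\<Sum>w\<in>verts (H t) - middle S. b w)"
      by (intro sum.cong) auto
    moreover have "(\<Sum>w\<in>verts (H t) - middle S. (b(v := b v - 1)) w) \<le> n * ((cycle_length t - card S) div 2)"
      by (rule multicolorable_sum_le[OF G Diff_subset H_stable_card_le[OF t S_sub] col[OF v]])
    ultimately show False using big by simp
  qed
  then have "{v. b v > 0} \<inter> middle S = {}" by blast
  then show ?thesis using S big by blast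
qed

text \<open>By counting colour classes as in the introduction: the violated inequality involves all vertices, hence the
  hole is the full cycle, and one unit less makes every class a maximum stable set.\<close>

lemma not_critical_H:
  assumes t: "t \<ge> 1"
  shows "\<not> critical (H t) (t + 1) (verts (H t))"
proof
  assume "critical (H t) (t + 1) (verts (H t))"
  then obtain b where supp: "{v. b v > 0} = verts (H t)" and le: "\<forall>v. b v \<le> t + 1"
    and not_col: "\<not> multicolorable (H t) (t + 1) b"
    and col: "\<forall>v\<in>verts (H t). multicolorable (H t) (t + 1) (b(v := b v - 1))"
    unfolding critical_def by (elim exE conjE)
  note G = finite_simple_graph_H[OF t]
  have finV: "finite (verts (H t))" by (simp add: verts_H)
  have len: "cycle_length t \<ge> 3" "odd (cycle_length t)" using t by (auto simp: cycle_length_def)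
  have X_in: "Xv i \<in> verts (H t)" if "i \<in> {1, 2, 3}" for i using that len by (auto simp: verts_H)
  have pos: "b v > 0 \<longleftrightarrow> v \<in> verts (H t)" for v using supp by blast
  define k where "k = cycle_length t div 2"
  have k: "2 * k + 1 = cycle_length t" unfolding k_def using len(2) by (rule odd_two_times_div_two_succ)
  have not_clique: "\<not> (is_clique (H t) (verts (H t)) \<and> card (verts (H t)) \<le> 3)"
  proof -
    have "card {Xv 1, Xv 2, Xv 3, Yv 1} \<le> card (verts (H t))"
      by (rule card_mono[OF finV]) (use X_in t in \<open>auto simp: verts_H\<close>)
    then show ?thesis by simp
  qed
  have "(is_clique (H t) {v. b v > 0} \<and> 2 \<le> card {v. b v > 0} \<and> card {v. b v > 0} \<le> 3) \<or>
    (\<exists>S. spans_odd_hole t S {v. b v > 0} \<and> {v. b v > 0} \<inter> middle S = {} \<and>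
       (t + 1) * ((cycle_length t - card S) div 2) < (\<Sum>v\<in>verts (H t) - middle S. b v))"
  proof (rule critical_obstruction[OF t spec[OF le] _ not_col])
    show "{v. b v > 0} \<subseteq> verts (H t)" unfolding supp ..
    show "multicolorable (H t) (t + 1) (b(v := b v - 1))" if "b v > 0" for v
      using bspec[OF col, of v] that pos[of v] by simp
  qed
  then obtain S where S: "spans_odd_hole t S (verts (H t))" "verts (H t) \<inter> middle S = {}"
    and big: "(t + 1) * ((cycle_length t - card S) div 2) < (\<Sum>v\<in>verts (H t) - middle S. b v)"
    unfolding supp using not_clique by blast
  have "S = {}"
  proof (rule ccontr)
    assume "S \<noteq> {}"
    then obtain j where j: "j \<in> S" by blast
    then have "j \<in> {1..<t}" using S(1) unfolding spans_odd_hole_def by blast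
    then have "4 * j + 1 \<in> {1..cycle_length t}" by (auto simp: cycle_length_def)
    then have "Xv (4 * j + 1) \<in> verts (H t)" unfolding verts_H by blast
    moreover have "Xv (4 * j + 1) \<in> middle S" using j by (simp only: middle_simps)
    ultimately show False using S(2) by blast
  qed
  moreover have "middle {} = {}" by (simp add: middle_def)
  ultimately have total: "(t + 1) * k < (\<Sum>v\<in>verts (H t). b v)" using big by (simp add: k_def)
  define Z where "Z = insert (Xv 2) (Yv ` {1..t})"
  have ZV: "Z \<subseteq> verts (H t)" using X_in by (auto simp: Z_def verts_H)
  have cardZ: "card Z = t + 1" by (simp add: Z_def image_iff card_image inj_on_def)
  have notZ: "Xv 1 \<notin> Z" "Xv 3 \<notin> Z" by (auto simp: Z_def)
  have equal: "(b(v := b v - 1)) (Xv 1) = (b(v := b v - 1)) (Xv 3)" if v: "v \<in> verts (H t)" "v \<notin> Z" for v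
  proof -
    let ?b = "b(v := b v - 1)"
    have colv: "multicolorable (H t) (t + 1) ?b" using col v by blast
    obtain A where A: "\<And>w. A w \<subseteq> {..<t + 1}" "\<And>w. w \<in> verts (H t) \<Longrightarrow> card (A w) = ?b w"
      "\<And>w. w \<notin> verts (H t) \<Longrightarrow> A w = {}" "\<And>c. stable_set (H t) {w. c \<in> A w}"
      using multicolorable_obtain[OF G colv] by metis
    define I where "I c = {w \<in> verts (H t). c \<in> A w}" for c
    have I: "stable_set (H t) (I c)" "I c \<subseteq> verts (H t)" for c
      using stable_subset[OF A(4)[of c], of "I c"] by (auto simp: I_def)
    have count: "(\<Sum>w\<in>W. ?b w) = (\<Sum>c<t + 1. card {w \<in> W. c \<in> A w})" if "W \<subseteq> verts (H t)" for W
    proof -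
      have "(\<Sum>w\<in>W. ?b w) = (\<Sum>w\<in>W. card (A w))" using A(2) that by (intro sum.cong) auto
      then show ?thesis using color_double_count[OF finite_subset[OF that finV] A(1)] by simp
    qed
    have max: "card (I c) = k" if c: "c < t + 1" for c
    proof (rule ccontr)
      assume ne: "card (I c) \<noteq> k"
      have le_k: "card (I c') \<le> k" for c'
      proof -
        have "2 * card (I c') + card ({} :: nat set) \<le> cycle_length t"
          by (rule twice_stable_card_le[OF t empty_subsetI I(1)]) (use I(2) in \<open>simp add: middle_def\<close>)
        then have "2 * card (I c') \<le> cycle_length t" by simp
        then show ?thesis using k by linarith
      qed
      have "(\<Sum>w\<in>verts (H t). ?b w) = (\<Sum>c<t + 1. card (I c))" using count[OF order_refl] by (simp add: I_def)
      also have "\<dots> < (\<Sum>c<t + 1. k)"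
      proof (rule sum_strict_mono_ex1)
        show "\<exists>c\<in>{..<t + 1}. card (I c) < k" using le_k[of c] ne c by (intro bexI[of _ c]) simp_all
      qed (use le_k in simp_all)
      finally have "(\<Sum>w\<in>verts (H t). ?b w) < (t + 1) * k" by simp
      moreover have "(\<Sum>w\<in>verts (H t). ?b w) = (b v - 1) + (\<Sum>w\<in>verts (H t) - {v}. b w)"
        by (subst sum.remove[OF finV v(1)]) simp
      moreover have "(\<Sum>w\<in>verts (H t). b w) = b v + (\<Sum>w\<in>verts (H t) - {v}. b w)"
        by (rule sum.remove[OF finV v(1)])
      ultimately show False using total pos[of v] v(1) by linarith
    qed
    have hit: "card (I c \<inter> Z) \<le> 1" "I c \<inter> Z \<noteq> {} \<Longrightarrow> Xv 1 \<in> I c \<longleftrightarrow> Xv 3 \<in> I c" if c: "c < t + 1" for c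
      using maximum_stable_hits_apex_once[OF t I _ Z_def] max[OF c] k by simp_all
    have hit_all: "I c \<inter> Z \<noteq> {}" if c: "c < t + 1" for c
    proof
      assume empty: "I c \<inter> Z = {}"
      have "card Z \<le> (\<Sum>w\<in>Z. ?b w)"
      proof -
        have "(\<Sum>w\<in>Z. 1) \<le> (\<Sum>w\<in>Z. ?b w)"
        proof (rule sum_mono)
          fix w assume w: "w \<in> Z"
          then have "b w > 0" "w \<noteq> v" using pos ZV v by auto
          then show "1 \<le> ?b w" by simp
        qed
        then show ?thesis by simp
      qed
      also have "(\<Sum>w\<in>Z. ?b w) = (\<Sum>c<t + 1. card (I c \<inter> Z))"
      proof -
        have "{w \<in> Z. c \<in> A w} = I c \<inter> Z" for c using ZV by (auto simp: I_def)
        then show ?thesis using count[OF ZV] by simp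
      qed
      also have "\<dots> < (\<Sum>c<t + 1. 1)"
      proof (rule sum_strict_mono_ex1)
        show "\<exists>c\<in>{..<t + 1}. card (I c \<inter> Z) < 1" using c empty by (intro bexI[of _ c]) simp_all
      qed (use hit(1) in simp_all)
      finally show False using cardZ by simp
    qed
    have "Xv 1 \<in> I c \<longleftrightarrow> Xv 3 \<in> I c" if "c < t + 1" for c using hit(2)[OF that hit_all[OF that]] .
    then have "c \<in> A (Xv 1) \<longleftrightarrow> c \<in> A (Xv 3)" if "c < t + 1" for c
      using that X_in[of 1] X_in[of 3] by (simp add: I_def)
    then have "A (Xv 1) = A (Xv 3)" using A(1)[of "Xv 1"] A(1)[of "Xv 3"] by blast
    then show ?thesis using A(2)[OF X_in[of 1]] A(2)[OF X_in[of 3]] by simp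
  qed
  have "b (Xv 1) - 1 = b (Xv 3)" using equal[OF X_in[of 1] notZ(1)] by simp
  moreover have "b (Xv 1) = b (Xv 3) - 1" using equal[OF X_in[of 3] notZ(2)] by simp
  moreover have "b (Xv 1) > 0" using pos X_in[of 1] by simp
  ultimately show False by linarith
qed

text \<open>The odd cycle needs three colours. Conversely colour the cycle alternately, with a third colour for
  the odd vertices of the last block, where it resolves the conflict with \<open>x\<^sub>1\<close>.\<close>

lemma chromatic_number_H:
  assumes t: "t \<ge> 1"
  shows "chromatic_number (H t) = 3"
  unfolding chromatic_number_def
proof (rule Least_equality)
  define c :: "vertex \<Rightarrow> nat" where
    "c = case_vertex (\<lambda>j. if even j then 0 else if max 4 (4 * t - 4) \<le> j then 2 else 1)
      (\<lambda>i. if i = t \<and> 2 \<le> t then 1 else 2)"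
  have ne: "c u \<noteq> c v" if e: "{u, v} \<in> edges (H t)" for u v
  proof -
    have sym: "c u \<noteq> c v" if "{u, v} = {x, y}" "c x \<noteq> c y" for x y
      using that by (auto simp: doubleton_eq_iff)
    from e show ?thesis
    proof (cases rule: H_edge_cases)
      case (cycle i)
      show ?thesis by (rule sym[OF cycle(3)]) (auto simp: c_def)
    next
      case closing
      show ?thesis by (rule sym[OF closing]) (use t in \<open>auto simp: c_def cycle_length_def max_def\<close>)
    next
      case (first j)
      show ?thesis by (rule sym[OF first(2)]) (use t first(1) in \<open>auto simp: c_def max_def\<close>)
    next
      case (later j r)
      show ?thesis by (rule sym[OF later(3)]) (use later(1,2) in \<open>auto simp: c_def max_def\<close>)
    qed
  qed
  have "c v < 3" for v by (simp add: c_def split: vertex.split)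
  then have range: "c ` verts (H t) \<subseteq> {..<3}" by blast
  show "colorable (H t) 3" unfolding colorable_def by (intro exI[of _ c] conjI allI impI range ne)
next
  fix m assume "colorable (H t) m"
  then obtain c where c: "c ` verts (H t) \<subseteq> {..<m}" "\<forall>u v. {u, v} \<in> edges (H t) \<longrightarrow> c u \<noteq> c v"
    unfolding colorable_def by (elim exE conjE)
  have len: "odd (cycle_length t)" "5 \<le> cycle_length t \<or> cycle_length t = 3" "3 \<le> cycle_length t"
    using t by (auto simp: cycle_length_def)
  have "multicolorable (H t) m (\<lambda>v. 1)"
    by (rule multicolorableI[where A = "\<lambda>v. {c v}"]) (use c in auto)
  moreover have "card I \<le> cycle_length t div 2" if "I \<subseteq> Xv ` {1..cycle_length t}" "stable_set (H t) I" for I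
    using H_stable_card_le[OF t empty_subsetI _ that(2)] that(1) by (auto simp: verts_H middle_def)
  moreover have "Xv ` {1..cycle_length t} \<subseteq> verts (H t)" by (simp add: verts_H)
  ultimately have "(\<Sum>v\<in>Xv ` {1..cycle_length t}. 1) \<le> m * (cycle_length t div 2)"
    by (intro multicolorable_sum_le[OF finite_simple_graph_H[OF t]])
  then have le: "cycle_length t \<le> m * (cycle_length t div 2)" by (simp add: card_image inj_on_def)
  show "3 \<le> m"
  proof (rule ccontr)
    assume "\<not> 3 \<le> m"
    then have "m * (cycle_length t div 2) \<le> 2 * (cycle_length t div 2)" by simp
    moreover have "2 * (cycle_length t div 2) < cycle_length t"
      using odd_two_times_div_two_succ[OF len(1)] by simp
    ultimately show False using le by linarith
  qed
qed

section \<open>Stabilization\<close>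

text \<open>Leading terms require a linear order on the variables; any one will do.\<close>

instantiation vertex :: linorder
begin

definition vertex_code :: "vertex \<Rightarrow> nat" where
  "vertex_code v = (case v of Xv i \<Rightarrow> 2 * i | Yv i \<Rightarrow> 2 * i + 1)"

definition less_eq_vertex :: "vertex \<Rightarrow> vertex \<Rightarrow> bool" where
  "u \<le> v \<longleftrightarrow> vertex_code u \<le> vertex_code v"

definition less_vertex :: "vertex \<Rightarrow> vertex \<Rightarrow> bool" where
  "u < v \<longleftrightarrow> vertex_code u < vertex_code v"

instance
proof
  have inj: "u = v" if "vertex_code u = vertex_code v" for u v
    using that by (cases u; cases v) (auto simp: vertex_code_def, presburger+)
  fix u v w :: vertex
  show "u < v \<longleftrightarrow> u \<le> v \<and> \<not> v \<le> u" "u \<le> u" "u \<le> v \<or> v \<le> u"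
    unfolding less_eq_vertex_def less_vertex_def by auto
  show "u \<le> w" if "u \<le> v" "v \<le> w" using that unfolding less_eq_vertex_def by simp
  show "u = v" if "u \<le> v" "v \<le> u" using that inj unfolding less_eq_vertex_def by simp
qed

end

lemma critical_H_cases:
  assumes t: "t \<ge> 1" and W: "W \<subseteq> verts (H t)" and crit: "critical (H t) n W"
  shows "(is_clique (H t) W \<and> 2 \<le> card W \<and> card W \<le> 3) \<or>
    (\<exists>S. spans_odd_hole t S W \<and> W \<inter> middle S = {})"
proof -
  from crit obtain b where supp: "{v. b v > 0} = W" and b: "\<forall>v. b v \<le> n" "\<not> multicolorable (H t) n b"
    "\<forall>v\<in>W. multicolorable (H t) n (b(v := b v - 1))"
    unfolding critical_def by (elim exE conjE)
  have "v \<in> W" if "b v > 0" for v using supp that by blast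
  then have col: "multicolorable (H t) n (b(v := b v - 1))" if "b v > 0" for v using bspec[OF b(3)] that by simp
  have "{v. b v > 0} \<subseteq> verts (H t)" unfolding supp by (rule W)
  from critical_obstruction[OF t spec[OF b(1)] this b(2) col]
  show ?thesis unfolding supp by blast
qed

lemma critical_H_iff:
  assumes t: "t \<ge> 1" and W: "W \<subseteq> verts (H t)" and n: "n \<ge> t + 2"
  shows "critical (H t) n W \<longleftrightarrow>
    (is_clique (H t) W \<and> 2 \<le> card W \<and> card W \<le> 3) \<or> (\<exists>S. spans_odd_hole t S W \<and> W \<inter> middle S = {})"
proof
  assume "critical (H t) n W"
  then show "(is_clique (H t) W \<and> 2 \<le> card W \<and> card W \<le> 3) \<or> (\<exists>S. spans_odd_hole t S W \<and> W \<inter> middle S = {})"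
    by (rule critical_H_cases[OF t W])
next
  assume "(is_clique (H t) W \<and> 2 \<le> card W \<and> card W \<le> 3) \<or> (\<exists>S. spans_odd_hole t S W \<and> W \<inter> middle S = {})"
  then show "critical (H t) n W"
  proof (elim disjE exE conjE)
    assume "is_clique (H t) W" "2 \<le> card W" "card W \<le> 3"
    then show ?thesis using n by (intro clique_critical[OF finite_simple_graph_H[OF t] W]) auto
  next
    fix S assume "spans_odd_hole t S W" "W \<inter> middle S = {}"
    then show ?thesis by (rule odd_hole_critical_H[OF t W _ _ n])
  qed
qed

lemma critical_H_full:
  assumes t: "t \<ge> 1"
  shows "critical (H t) (t + 2) (verts (H t))"
proof (rule odd_hole_critical_H[OF t order_refl _ _ order_refl])
  have "1 \<in> {1..cycle_length t}" "3 \<in> {1..cycle_length t}" "1 \<in> {1..t}" using t by (auto simp: cycle_length_def)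
  then show "spans_odd_hole t {} (verts (H t))" by (auto simp: spans_odd_hole_def verts_H)
  show "verts (H t) \<inter> middle {} = {}" by (simp add: middle_def)
qed

theorem theorem4p1:
  fixes t :: nat
    and R\<^sub>t :: "(vertex, 'k::field) mpoly ring"
    and J\<^sub>t :: "(vertex, 'k) mpoly set"
  assumes "t \<ge> 1"
    and "R\<^sub>t = mpoly_ring (verts (H t))"
    and "J\<^sub>t = cover_ideal (H t)"
  shows "Ass_stabilizes_at R\<^sub>t J\<^sub>t ((chromatic_number (H t) - 1) + t) \<and>
         (chromatic_number (H t) - 1) + t = 2 + t"
proof -
  note t = assms(1)
  let ?V = "verts (H t)"
  let ?P = "variable_prime ?V :: vertex set \<Rightarrow> (vertex, 'k) mpoly set"
  have Ass: "Ass_power R\<^sub>t J\<^sub>t n = {?P W |W. W \<subseteq> ?V \<and> critical (H t) n W}" for n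
    unfolding assms(2,3) by (rule Ass_power_cover_ideal[OF finite_simple_graph_H[OF t]])
  have chi: "(chromatic_number (H t) - 1) + t = 2 + t" by (simp add: chromatic_number_H[OF t])
  have stable: "Ass_power R\<^sub>t J\<^sub>t n = Ass_power R\<^sub>t J\<^sub>t (2 + t)" if n: "n \<ge> 2 + t" for n
  proof -
    have "critical (H t) n W \<longleftrightarrow> critical (H t) (2 + t) W" if "W \<subseteq> ?V" for W
      using critical_H_iff[OF t that, of n] critical_H_iff[OF t that, of "2 + t"] n by simp
    then have "(W \<subseteq> ?V \<and> critical (H t) n W) = (W \<subseteq> ?V \<and> critical (H t) (2 + t) W)" for W
      by (cases "W \<subseteq> ?V") simp_all
    then show ?thesis unfolding Ass by (simp only:)
  qed
  have full_in: "?P ?V \<in> Ass_power R\<^sub>t J\<^sub>t (2 + t)"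
    unfolding Ass add.commute[of 2 t] by (intro CollectI exI[of _ ?V] conjI refl order_refl critical_H_full[OF t])
  have full_out: "?P ?V \<notin> Ass_power R\<^sub>t J\<^sub>t (t + 1)"
  proof
    assume "?P ?V \<in> Ass_power R\<^sub>t J\<^sub>t (t + 1)"
    then obtain W where W: "W \<subseteq> ?V" "critical (H t) (t + 1) W" "?P ?V = ?P W" unfolding Ass by (elim CollectE exE conjE)
    have "?V = W" by (rule variable_prime_inject[OF order_refl W(1,3)])
    then show False using W(2) not_critical_H[OF t] by simp
  qed
  have "Ass_stabilizes_at R\<^sub>t J\<^sub>t (2 + t)"
    unfolding Ass_stabilizes_at_def
  proof (intro conjI allI impI)
    show "0 < 2 + t" by simp
    show "Ass_power R\<^sub>t J\<^sub>t n = Ass_power R\<^sub>t J\<^sub>t (2 + t)" if "2 + t \<le> n" for n by (rule stable[OF that])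
    fix s' assume s': "\<forall>n\<ge>s'. Ass_power R\<^sub>t J\<^sub>t n = Ass_power R\<^sub>t J\<^sub>t s'"
    show "2 + t \<le> s'"
    proof (rule ccontr)
      assume "\<not> 2 + t \<le> s'"
      then have "s' \<le> t + 1" "s' \<le> 2 + t" by simp_all
      have e1: "Ass_power R\<^sub>t J\<^sub>t (t + 1) = Ass_power R\<^sub>t J\<^sub>t s'"
        by (rule s'[rule_format]) (rule \<open>s' \<le> t + 1\<close>)
      have e2: "Ass_power R\<^sub>t J\<^sub>t (2 + t) = Ass_power R\<^sub>t J\<^sub>t s'"
        by (rule s'[rule_format]) (rule \<open>s' \<le> 2 + t\<close>)
      show False by (rule notE[OF full_out]) (use full_in in \<open>simp only: e1 e2\<close>)
    qed
  qed
  then show ?thesis using chi by simp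
qed

end
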